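(* Let $\gamma>0$ and let $(X_1,y_1),\dots,(X_n,y_n)$ be i.i.d. from the adaptive response contamination model with generalized Gaussian covariates $X_i\sim\mathcal{GN}_\gamma(0,I_p)$, contamination rate $\epsilon$, regression vector $\beta\in\mathbb{R}^p$, noise level $\sigma>0$ and an arbitrary contamination kernel $Q$. (Upper bound) For any $\alpha\in(0,1)$ there exist $C,c>0$ (depending only on $\alpha$ and $\gamma$) such that whenever $\sqrt{p/n}+\epsilon\le c$, the truncated-depth estimator $\widehat\beta\in\arg\max_{\widetilde\beta\in\mathbb{R}^p}\mathcal{D}(\widetilde\beta,\mathbb{P}_n,t)$ with $t=\left(\log(n\epsilon^2/p+e)/3\right)^{1/\gamma}$ satisfies $$\|\widehat\beta-\beta\|_2\le C\sigma\left(\sqrt{\frac pn}+\frac{\epsilon}{\left(\log(n\epsilon^2/p+e)\right)^{1/\gamma}}\right)$$ with probability at least $1-\alpha$. (Lower bound) Moreover, there exists $C'>0$ (depending only on $\gamma$) such that $$\inf_{\widehat\beta}\sup_{\beta,Q}\mathbb{P}_{\beta,\sigma,Q}\left(\|\widehat\beta-\beta\|_2\ge C'\sigma\left(\sqrt{\frac pn}+\frac{\epsilon}{\left(\log(n\epsilon^2/p+e)\right)^{1/\gamma}}\right)\right)\ge\frac12,$$ where the infimum is over all estimators based on the $n$ samples, the supremum is over all $\beta\in\mathbb{R}^p$ and all contamination kernels $Q$, and $\mathbb{P}_{\beta,\sigma,Q}$ is the data distribution.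
   Context: Generalized Gaussian: a $p$-dimensional random vector $X$ follows $\mathcal{GN}_\gamma(0,I_p)$ if for every unit vector $v\in\mathcal{S}^{p-1}$ the projection $v^\top X$ has density at $t$ proportional to $\exp(-|t|^\gamma/2)$. Model: $\epsilon\in[0,1/2)$, $p\in\mathbb{N}$; $(X_i,y_i)$ are i.i.d. with $X_i\sim\mathcal{GN}_\gamma(0,I_p)$ and $y_i\mid X_i\sim(1-\epsilon)\mathcal{N}(X_i^\top\beta,\sigma^2)+\epsilon Q_{X_i}$, where $Q_x$ is an arbitrary conditional distribution on $\mathbb{R}$ depending on $x$. Empirical truncated regression depth: $$\mathcal{D}(\widetilde\beta,\mathbb{P}_n,t)=\inf_{v\in\mathcal{S}^{p-1}}\frac1n\sum_{i=1}^n\mathbf{1}\{v^\top X_i(y_i-X_i^\top\widetilde\beta)\ge 0,\ |v^\top X_i|\ge t\}.$$ Logarithms are natural. *)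

theory Defs
  imports "HOL-Probability.Probability"
begin

text \<open>
  The constants of the theorem must not depend on the dimension \<open>p\<close>, so \<open>p\<close> cannot be the
  cardinality of an index type.  Vectors of \<open>\<real>\<^sup>p\<close> are extensional functions on \<open>{..<p}\<close>, with the
  product Borel sigma-algebra.
\<close>

abbreviation Rp :: "nat \<Rightarrow> (nat \<Rightarrow> real) measure" where
  "Rp p \<equiv> Pi\<^sub>M {..<p} (\<lambda>_. borel)"

definition dot :: "nat \<Rightarrow> (nat \<Rightarrow> real) \<Rightarrow> (nat \<Rightarrow> real) \<Rightarrow> real" where
  "dot p u v = (\<Sum>j<p. u j * v j)"

definition l2_dist :: "nat \<Rightarrow> (nat \<Rightarrow> real) \<Rightarrow> (nat \<Rightarrow> real) \<Rightarrow> real" where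
  "l2_dist p u v = L2_set (\<lambda>j. u j - v j) {..<p}"

definition unit_sphere :: "nat \<Rightarrow> (nat \<Rightarrow> real) set" where
  "unit_sphere p = {v \<in> space (Rp p). L2_set v {..<p} = 1}"

definition generalized_gaussian :: "real \<Rightarrow> nat \<Rightarrow> (nat \<Rightarrow> real) measure \<Rightarrow> bool" where
  "generalized_gaussian \<gamma> p \<mu> \<longleftrightarrow>
     prob_space \<mu> \<and> sets \<mu> = sets (Rp p) \<and>
     (\<forall>v \<in> unit_sphere p. \<exists>k > 0.
        distributed \<mu> lborel (dot p v) (\<lambda>t. ennreal (k * exp (- (\<bar>t\<bar> powr \<gamma>) / 2))))"

abbreviation contamination_kernels :: "nat \<Rightarrow> ((nat \<Rightarrow> real) \<Rightarrow> real measure) set" where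
  "contamination_kernels p \<equiv> Rp p \<rightarrow>\<^sub>M prob_algebra borel"

text \<open>
  The mixture \<open>(1 - \<epsilon>) N(x \<bullet> \<beta>, \<sigma>\<^sup>2) + \<epsilon> Q x\<close>, written with a Bernoulli label that is true when the
  response is contaminated; \<open>normal_density\<close> takes the standard deviation.
\<close>

definition response_law ::
  "nat \<Rightarrow> real \<Rightarrow> real \<Rightarrow> (nat \<Rightarrow> real) \<Rightarrow> ((nat \<Rightarrow> real) \<Rightarrow> real measure) \<Rightarrow> (nat \<Rightarrow> real) \<Rightarrow> real measure"
  where
  "response_law p \<epsilon> \<sigma> \<beta> Q x =
     measure_pmf (bernoulli_pmf \<epsilon>) \<bind>
       (\<lambda>contaminated. if contaminated then Q x else density lborel (normal_density (dot p x \<beta>) \<sigma>))"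

definition observation_law ::
  "nat \<Rightarrow> (nat \<Rightarrow> real) measure \<Rightarrow> real \<Rightarrow> real \<Rightarrow> (nat \<Rightarrow> real) \<Rightarrow> ((nat \<Rightarrow> real) \<Rightarrow> real measure) \<Rightarrow>
   ((nat \<Rightarrow> real) \<times> real) measure" where
  "observation_law p \<mu> \<epsilon> \<sigma> \<beta> Q =
     \<mu> \<bind> (\<lambda>x. distr (response_law p \<epsilon> \<sigma> \<beta> Q x) (Rp p \<Otimes>\<^sub>M borel) (\<lambda>y. (x, y)))"

abbreviation sample_space :: "nat \<Rightarrow> nat \<Rightarrow> (nat \<Rightarrow> (nat \<Rightarrow> real) \<times> real) measure" where
  "sample_space n p \<equiv> Pi\<^sub>M {..<n} (\<lambda>_. Rp p \<Otimes>\<^sub>M borel)"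

definition sample_law ::
  "nat \<Rightarrow> nat \<Rightarrow> (nat \<Rightarrow> real) measure \<Rightarrow> real \<Rightarrow> real \<Rightarrow> (nat \<Rightarrow> real) \<Rightarrow>
   ((nat \<Rightarrow> real) \<Rightarrow> real measure) \<Rightarrow> (nat \<Rightarrow> (nat \<Rightarrow> real) \<times> real) measure" where
  "sample_law n p \<mu> \<epsilon> \<sigma> \<beta> Q = Pi\<^sub>M {..<n} (\<lambda>_. observation_law p \<mu> \<epsilon> \<sigma> \<beta> Q)"

definition truncated_depth ::
  "nat \<Rightarrow> nat \<Rightarrow> (nat \<Rightarrow> (nat \<Rightarrow> real) \<times> real) \<Rightarrow> real \<Rightarrow> (nat \<Rightarrow> real) \<Rightarrow> real" where
  "truncated_depth n p d t b =
     (INF v \<in> unit_sphere p. 1 / real n *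
        (\<Sum>i<n. let (x, y) = d i in
           of_bool (dot p v x * (y - dot p x b) \<ge> 0 \<and> \<bar>dot p v x\<bar> \<ge> t)))"

definition log_factor :: "nat \<Rightarrow> nat \<Rightarrow> real \<Rightarrow> real" where
  "log_factor n p \<epsilon> = ln (real n * \<epsilon>\<^sup>2 / real p + exp 1)"

definition truncation_level :: "real \<Rightarrow> nat \<Rightarrow> nat \<Rightarrow> real \<Rightarrow> real" where
  "truncation_level \<gamma> n p \<epsilon> = (log_factor n p \<epsilon> / 3) powr (1 / \<gamma>)"

definition rate :: "real \<Rightarrow> nat \<Rightarrow> nat \<Rightarrow> real \<Rightarrow> real" where
  "rate \<gamma> n p \<epsilon> = sqrt (real p / real n) + \<epsilon> / log_factor n p \<epsilon> powr (1 / \<gamma>)"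

lemma dot_const_measurable [measurable]:
  "(\<lambda>x. dot p x b) \<in> borel_measurable (Rp p)"
  unfolding dot_def by measurable

lemma normal_prob_algebra:
  assumes "\<sigma> > 0"
  shows "density lborel (normal_density m \<sigma>) \<in> space (prob_algebra borel)"
  using prob_space_normal_density[OF assms] by (simp add: space_prob_algebra)

lemma emeasure_response_law:
  assumes "0 \<le> \<epsilon>" "\<epsilon> \<le> 1" "\<sigma> > 0" "Q \<in> contamination_kernels p" "x \<in> space (Rp p)" "B \<in> sets borel"
  shows "emeasure (response_law p \<epsilon> \<sigma> \<beta> Q x) B =
    ennreal (1 - \<epsilon>) * emeasure (density lborel (normal_density (dot p x \<beta>) \<sigma>)) B
    + ennreal \<epsilon> * emeasure (Q x) B"
proof -
  have Q: "Q x \<in> space (prob_algebra borel)"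
    using measurable_space[OF assms(4,5)] .
  have "(\<lambda>c. if c then Q x else density lborel (normal_density (dot p x \<beta>) \<sigma>))
      \<in> measure_pmf (bernoulli_pmf \<epsilon>) \<rightarrow>\<^sub>M subprob_algebra borel"
    using Q normal_prob_algebra[OF assms(3), of "dot p x \<beta>"]
    by (auto simp: space_prob_algebra space_subprob_algebra prob_space_imp_subprob_space)
  from emeasure_bind[OF _ this assms(6)] show ?thesis
    unfolding response_law_def
    using assms(1,2) by (simp add: nn_integral_bernoulli_pmf mult.commute add.commute)
qed

lemma measurable_response_law:
  assumes e: "0 \<le> \<epsilon>" "\<epsilon> \<le> 1" and s: "\<sigma> > 0" and Q: "Q \<in> contamination_kernels p"
  shows "response_law p \<epsilon> \<sigma> \<beta> Q \<in> Rp p \<rightarrow>\<^sub>M prob_algebra borel"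
proof (rule measurable_prob_algebraI)
  have sets: "sets (response_law p \<epsilon> \<sigma> \<beta> Q x) = sets borel" if "x \<in> space (Rp p)" for x
    unfolding response_law_def
    using measurable_space[OF Q that] by (subst sets_bind) (auto simp: space_prob_algebra)
  show prob: "prob_space (response_law p \<epsilon> \<sigma> \<beta> Q x)" if x: "x \<in> space (Rp p)" for x
  proof
    have "space (response_law p \<epsilon> \<sigma> \<beta> Q x) = UNIV" 
      using sets_eq_imp_space_eq[OF sets[OF x]] by simp
    moreover have "emeasure (Q x) UNIV = 1"
    proof -
      have "prob_space (Q x)" "sets (Q x) = sets borel"
        using measurable_space[OF Q x] by (auto simp: space_prob_algebra)
      then show ?thesis
        using prob_space.emeasure_space_1[of "Q x"] sets_eq_imp_space_eq[of "Q x" borel] by simp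
    qed
    moreover have "emeasure (density lborel (normal_density (dot p x \<beta>) \<sigma>)) UNIV = 1"
      using prob_space.emeasure_space_1[OF prob_space_normal_density[OF s]] by simp
    ultimately show "emeasure (response_law p \<epsilon> \<sigma> \<beta> Q x) (space (response_law p \<epsilon> \<sigma> \<beta> Q x)) = 1"
      using e by (simp add: emeasure_response_law[OF e s Q x] flip: ennreal_plus)
  qed
  show "response_law p \<epsilon> \<sigma> \<beta> Q \<in> Rp p \<rightarrow>\<^sub>M subprob_algebra borel"
  proof (rule measurable_subprob_algebra)
    show "subprob_space (response_law p \<epsilon> \<sigma> \<beta> Q x)" if "x \<in> space (Rp p)" for x
      using prob[OF that] by (rule prob_space_imp_subprob_space)
    show "(\<lambda>x. emeasure (response_law p \<epsilon> \<sigma> \<beta> Q x) B) \<in> borel_measurable (Rp p)" if B: "B \<in> sets borel" for B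
    proof (subst measurable_cong[OF emeasure_response_law[OF e s Q _ B]])
      have Q': "(\<lambda>x. emeasure (Q x) B) \<in> borel_measurable (Rp p)"
        using measurable_prob_algebraD[OF Q] B by (rule measurable_emeasure_kernel)
      have "(\<lambda>x. emeasure (density lborel (normal_density (dot p x \<beta>) \<sigma>)) B)
          = (\<lambda>x. \<integral>\<^sup>+y. ennreal (normal_density (dot p x \<beta>) \<sigma> y) * indicator B y \<partial>lborel)"
        using B by (simp add: emeasure_density)
      also have "\<dots> \<in> borel_measurable (Rp p)"
        using B unfolding normal_density_def by measurable
      finally show "(\<lambda>x. ennreal (1 - \<epsilon>) * emeasure (density lborel (normal_density (dot p x \<beta>) \<sigma>)) B
          + ennreal \<epsilon> * emeasure (Q x) B) \<in> borel_measurable (Rp p)"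
        using Q' by measurable
    qed
  qed (fact sets)
qed

lemma observation_law:
  assumes e: "0 \<le> \<epsilon>" "\<epsilon> \<le> 1" and s: "\<sigma> > 0" and Q: "Q \<in> contamination_kernels p"
    and m: "prob_space \<mu>" "sets \<mu> = sets (Rp p)"
  shows sets_observation_law: "sets (observation_law p \<mu> \<epsilon> \<sigma> \<beta> Q) = sets (Rp p \<Otimes>\<^sub>M borel)"
    and prob_space_observation_law: "prob_space (observation_law p \<mu> \<epsilon> \<sigma> \<beta> Q)"
    and emeasure_observation_law: "A \<in> sets (Rp p \<Otimes>\<^sub>M borel) \<Longrightarrow>
      emeasure (observation_law p \<mu> \<epsilon> \<sigma> \<beta> Q) A =
        (\<integral>\<^sup>+x. emeasure (response_law p \<epsilon> \<sigma> \<beta> Q x) (Pair x -` A) \<partial>\<mu>)"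
proof -
  note R = measurable_response_law[OF e s Q, of \<beta>]
  have K: "(\<lambda>x. distr (response_law p \<epsilon> \<sigma> \<beta> Q x) (Rp p \<Otimes>\<^sub>M borel) (\<lambda>y. (x, y)))
      \<in> \<mu> \<rightarrow>\<^sub>M prob_algebra (Rp p \<Otimes>\<^sub>M borel)"
    unfolding measurable_cong_sets[OF m(2) refl]
    by (rule measurable_distr_prob_space2[OF R]) measurable
  have mu: "\<mu> \<in> space (prob_algebra (Rp p))"
    using m by (simp add: space_prob_algebra)
  have K': "(\<lambda>x. distr (response_law p \<epsilon> \<sigma> \<beta> Q x) (Rp p \<Otimes>\<^sub>M borel) (\<lambda>y. (x, y)))
      \<in> Rp p \<rightarrow>\<^sub>M prob_algebra (Rp p \<Otimes>\<^sub>M borel)"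
    using K unfolding measurable_cong_sets[OF m(2) refl] .
  show "sets (observation_law p \<mu> \<epsilon> \<sigma> \<beta> Q) = sets (Rp p \<Otimes>\<^sub>M borel)"
    "prob_space (observation_law p \<mu> \<epsilon> \<sigma> \<beta> Q)"
    unfolding observation_law_def
    using sets_bind'[OF mu K'] prob_space_bind'[OF mu K'] by auto
  assume A: "A \<in> sets (Rp p \<Otimes>\<^sub>M borel)"
  show "emeasure (observation_law p \<mu> \<epsilon> \<sigma> \<beta> Q) A =
        (\<integral>\<^sup>+x. emeasure (response_law p \<epsilon> \<sigma> \<beta> Q x) (Pair x -` A) \<partial>\<mu>)"
    unfolding observation_law_def
    apply (subst emeasure_bind[OF _ measurable_prob_algebraD[OF K] A])
    subgoal using prob_space.not_empty[OF m(1)] .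
    apply (rule nn_integral_cong)
    subgoal premises prems for x
    proof -
      have x: "x \<in> space (Rp p)" using prems sets_eq_imp_space_eq[OF m(2)] by simp
      have S: "sets (response_law p \<epsilon> \<sigma> \<beta> Q x) = sets borel"
        using measurable_space[OF R x] by (simp add: space_prob_algebra)
      have "(\<lambda>y. (x, y)) \<in> response_law p \<epsilon> \<sigma> \<beta> Q x \<rightarrow>\<^sub>M Rp p \<Otimes>\<^sub>M borel"
        unfolding measurable_cong_sets[OF S refl] using x by measurable
      then show ?thesis
        using A sets_eq_imp_space_eq[OF S] by (simp add: emeasure_distr vimage_def)
    qed
    done
qed

end

theory Submission
  imports Defs
begin

text \<open>
  Upper bound. Only the events that enter the depth at \<open>\<beta>\<close>, and at a fixed distance \<open>r\<close> from \<open>\<beta>\<close>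
  along a direction \<open>v\<close>, have to be controlled: moving a candidate further away along \<open>v\<close> can only
  shrink its event. Both families are indexed by \<open>v\<close> alone and are Boolean combinations of four
  half-spaces, so they have polynomial growth (Sauer-Shelah); symmetrization and chaining then bound
  the deviations uniformly by a multiple of \<open>sqrt (p / n)\<close>, without a logarithm. A candidate at distance \<open>r\<close> loses
  a fraction of order \<open>r t / \<sigma>\<close> of the tail mass at the truncation level \<open>t\<close>, while contamination can
  only restore a fraction \<open>\<epsilon>\<close> of it.

  Lower bound. The adversary replaces the normal response law by a normal density flattened on an
  interval of length \<open>2 \<sigma> \<epsilon>\<close>, shifted by the soft-thresholded regression function. The chi-square divergence per
  observation then only sees \<open>(\<bar>x \<bullet> \<beta>\<bar> - \<sigma> \<epsilon>)\<^sub>+\<close>, which for \<open>\<beta>\<close> of the size of the rate is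
  nonzero only in the tail of \<open>x\<close>. A grid of \<open>100\<^sup>p\<close> vectors \<open>\<beta>\<close>, of which at most
  \<open>4\<^sup>p\<close> are close to any given point, and a truncated second-moment comparison with \<open>\<beta> = 0\<close> show that every
  estimator fails with probability at least 1/2 for some grid point.
\<close>

section \<open>Growth of half-space patterns and packing\<close>

text \<open>Neither the estimator nor a supremum over the uncountable sphere has to be measurable.
  The good event is therefore built from deviations over a countable dense set of directions only.
  Depth events use strict inequalities, so that bounds pass between a direction and its neighbours;
  for far candidates the mismatch with the weak inequalities of the depth is absorbed by a threshold
  slightly below \<open>t\<close>. In the lower bound the obstacle is the covariate tail: for
  \<gamma> < 2 the chi-square factor exp(h^2 / \<sigma>^2), with h growing linearly in the
  covariate, is not integrable. The second moment is therefore damped by exp(-V), where V is the sum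
  of the conditional chi-square exponents. This makes it at most 1, and samples with V \<ge> p are
  paid for by the first moment of V. The damping costs a factor exp(p). It is harmless because a
  point is close to at most a fraction (4/100)^p of the grid, and 4e \<le> 12.\<close>

lemma linear_dependence:
  fixes f :: "'a \<Rightarrow> nat \<Rightarrow> real"
  assumes "finite J" "card J > q"
  shows "\<exists>c. (\<exists>j\<in>J. c j \<noteq> 0) \<and> (\<forall>i<q. (\<Sum>j\<in>J. c j * f j i) = 0)"
  using assms
proof (induction q arbitrary: J f)
  case 0
  then have "J \<noteq> {}" by auto
  then show ?case by (auto intro!: exI[of _ "\<lambda>_. 1"])
next
  case (Suc q)
  show ?case
  proof (cases "\<forall>j\<in>J. f j q = 0")
    case True
    obtain c where "\<exists>j\<in>J. c j \<noteq> 0" "\<forall>i<q. (\<Sum>j\<in>J. c j * f j i) = 0"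
      using Suc.IH[OF Suc.prems(1), of f] Suc.prems(2) by auto
    then show ?thesis using True by (auto simp: less_Suc_eq intro!: exI[of _ c] sum.neutral)
  next
    case False
    then obtain j0 where j0: "j0 \<in> J" "f j0 q \<noteq> 0" by auto
    \<comment> \<open>Gaussian elimination with pivot \<open>j0\<close>: the subtracted multiple of
      \<open>f j0\<close> kills coordinate \<open>q\<close>, and \<open>c'\<close> restores the
      coefficient of \<open>j0\<close>.\<close>
    define f' where "f' j i = f j i - f j q / f j0 q * f j0 i" for j i
    have "card (J - {j0}) > q" using Suc.prems j0 by simp
    then obtain c where c: "\<exists>j\<in>J - {j0}. c j \<noteq> 0" "\<And>i. i < q \<Longrightarrow> (\<Sum>j\<in>J - {j0}. c j * f' j i) = 0"
      using Suc.IH[of "J - {j0}" f'] Suc.prems(1) by auto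
    define c' where "c' = c(j0 := - (\<Sum>j\<in>J - {j0}. c j * f j q / f j0 q))"
    have *: "(\<Sum>j\<in>J. c' j * f j i) = (\<Sum>j\<in>J - {j0}. c j * f' j i)" for i
    proof -
      have "(\<Sum>j\<in>J. c' j * f j i) = c' j0 * f j0 i + (\<Sum>j\<in>J - {j0}. c' j * f j i)"
        using Suc.prems(1) j0(1) by (rule sum.remove)
      also have "(\<Sum>j\<in>J - {j0}. c' j * f j i) = (\<Sum>j\<in>J - {j0}. c j * f j i)"
        by (rule sum.cong) (auto simp: c'_def)
      also have "c' j0 * f j0 i = - (\<Sum>j\<in>J - {j0}. c j * f j q / f j0 q * f j0 i)"
        by (simp add: c'_def sum_distrib_right)
      finally show ?thesis
        by (simp add: f'_def right_diff_distrib sum_subtractf mult.assoc)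
    qed
    have "f' j q = 0" for j using j0 by (simp add: f'_def)
    then have "(\<Sum>j\<in>J. c' j * f j i) = 0" if "i < Suc q" for i
      using that c(2)[of i] unfolding * by (auto simp: less_Suc_eq)
    moreover have "\<exists>j\<in>J. c' j \<noteq> 0" using c(1) by (auto simp: c'_def)
    ultimately show ?thesis by blast
  qed
qed

section \<open>Shattering and the Sauer-Shelah bound for half-spaces\<close>

definition shattered :: "'a set set \<Rightarrow> 'a set \<Rightarrow> bool" where
  "shattered \<F> S \<longleftrightarrow> (\<forall>T\<subseteq>S. \<exists>A\<in>\<F>. A \<inter> S = T)"

text \<open>Pajor's strengthening of the Sauer-Shelah lemma. The family is split by membership of
  \<open>x\<close>. A set shattered by one half is shattered by the whole family, and a set
  shattered by both halves stays shattered after inserting \<open>x\<close>, so it counts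
  twice.\<close>

lemma card_le_card_shattered:
  assumes "finite I" "\<F> \<subseteq> Pow I"
  shows "card \<F> \<le> card {S. S \<subseteq> I \<and> shattered \<F> S}"
  using assms
proof (induction I arbitrary: \<F>)
  case empty
  then have "\<F> = {} \<or> \<F> = {{}}" by auto
  then show ?case
  proof
    assume "\<F> = {{}}"
    then have "{S. S \<subseteq> {} \<and> shattered \<F> S} = {{}}" by (auto simp: shattered_def)
    then show ?thesis using \<open>\<F> = {{}}\<close> by simp
  qed simp
next
  case (insert x I)
  define F0 where "F0 = {A\<in>\<F>. x \<notin> A}"
  define F1 where "F1 = (\<lambda>A. A - {x}) ` {A\<in>\<F>. x \<in> A}"
  have fin: "finite \<F>" using insert.prems insert.hyps(1)
    by (meson finite.insertI finite_Pow_iff finite_subset)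
  have "card \<F> = card F0 + card {A\<in>\<F>. x \<in> A}"
    unfolding F0_def using fin
    by (subst card_Un_disjoint[symmetric]) (auto intro!: arg_cong[where f=card])
  also have "card {A\<in>\<F>. x \<in> A} = card F1"
    unfolding F1_def by (rule card_image[symmetric]) (auto simp: inj_on_def)
  finally have c: "card \<F> = card F0 + card F1" .
  let ?S = "\<lambda>F I. {S. S \<subseteq> I \<and> shattered F S}"
  have "F0 \<subseteq> Pow I" "F1 \<subseteq> Pow I" using insert.prems by (auto simp: F0_def F1_def)
  then have IH: "card F0 \<le> card (?S F0 I)" "card F1 \<le> card (?S F1 I)"
    using insert.IH by auto
  have finS: "finite (?S F J)" if "finite J" for F and J :: "'a set"
    using that by simp
  have "card (?S F0 I) + card (?S F1 I) = card (?S F0 I \<union> ?S F1 I) + card (?S F0 I \<inter> ?S F1 I)"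
    by (rule card_Un_Int) (use finS insert.hyps in auto)
  also have "card (?S F0 I \<inter> ?S F1 I) = card (insert x ` (?S F0 I \<inter> ?S F1 I))"
    by (rule card_image[symmetric]) (use insert.hyps(2) in \<open>auto simp: inj_on_def\<close>)
  also have "card (?S F0 I \<union> ?S F1 I) + \<dots> = card ((?S F0 I \<union> ?S F1 I) \<union> insert x ` (?S F0 I \<inter> ?S F1 I))"
    by (rule card_Un_disjoint[symmetric]) (use insert.hyps in auto)
  also have "\<dots> \<le> card (?S \<F> (insert x I))"
  proof (rule card_mono)
    show "finite (?S \<F> (insert x I))" using insert.hyps by simp
    have one: "shattered \<F> S" if "S \<subseteq> I" "shattered F0 S \<or> shattered F1 S" for S
      unfolding shattered_def
    proof (intro allI impI)
      fix T assume "T \<subseteq> S"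
      with that(2) consider A where "A \<in> F0" "A \<inter> S = T" | A where "A \<in> F1" "A \<inter> S = T"
        unfolding shattered_def by blast
      then show "\<exists>A\<in>\<F>. A \<inter> S = T"
      proof cases
        case 2
        then obtain B where "B \<in> \<F>" "A = B - {x}" by (auto simp: F1_def)
        moreover have "x \<notin> S" using that insert.hyps by auto
        ultimately show ?thesis using 2 by (auto intro!: bexI[of _ B])
      qed (auto simp: F0_def)
    qed
    have two: "shattered \<F> (insert x S)" if S: "S \<subseteq> I" "shattered F0 S" "shattered F1 S" for S
      unfolding shattered_def
    proof (intro allI impI)
      fix T assume T: "T \<subseteq> insert x S"
      have xS: "x \<notin> S" using S insert.hyps by auto
      show "\<exists>A\<in>\<F>. A \<inter> insert x S = T"
      proof (cases "x \<in> T")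
        case True
        obtain A where "A \<in> F1" "A \<inter> S = T - {x}"
          using S(3)[unfolded shattered_def, rule_format, of "T - {x}"] T by auto
        then obtain B where "B \<in> \<F>" "x \<in> B" "A = B - {x}" by (auto simp: F1_def)
        then show ?thesis using \<open>A \<inter> S = T - {x}\<close> True xS by (intro bexI[of _ B]) auto
      next
        case False
        then have "T \<subseteq> S" using T by auto
        then obtain A where "A \<in> F0" "A \<inter> S = T" using S(2) unfolding shattered_def by blast
        then show ?thesis by (auto simp: F0_def intro!: bexI[of _ A])
      qed
    qed
    show "(?S F0 I \<union> ?S F1 I) \<union> insert x ` (?S F0 I \<inter> ?S F1 I) \<subseteq> ?S \<F> (insert x I)"
      using one two by (intro Un_least subsetI) auto
  qed
  finally show ?case using c IH by linarith
qed

text \<open>Each set of size at most \<open>D\<close> gets weight at least \<open>s ^ D\<close>,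
  while the weights of all subsets add up to \<open>(1 + s) ^ card I\<close>. The choice s = D / (M
  + D) never exceeds 1; this is why the bound contains 1 + M / D rather than the usual M / D and
  also covers small \<open>I\<close>.\<close>

lemma card_small_subsets_le:
  assumes "finite I" "D \<ge> 1"
  shows "real (card {S. S \<subseteq> I \<and> card S \<le> D}) \<le> (exp 1 * (1 + real (card I) / real D)) ^ D"
proof -
  define M where "M = real (card I)"
  define s where "s = real D / (M + real D)"
  have M: "M \<ge> 0" by (simp add: M_def)
  have s: "0 < s" "s \<le> 1" using assms M by (auto simp: s_def)
  have "real (card {S. S \<subseteq> I \<and> card S \<le> D}) * s ^ D = (\<Sum>S\<in>{S. S \<subseteq> I \<and> card S \<le> D}. s ^ D)"
    by simp
  also have "\<dots> \<le> (\<Sum>S\<in>{S. S \<subseteq> I \<and> card S \<le> D}. s ^ card S)"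
    by (rule sum_mono) (use s in \<open>auto intro!: power_decreasing\<close>)
  also have "\<dots> \<le> (\<Sum>S\<in>Pow I. s ^ card S)"
    by (rule sum_mono2) (use assms s in auto)
  also have "\<dots> = (\<Prod>i\<in>I. s + 1)"
    using assms(1) by (subst prod_add) auto
  also have "\<dots> = (1 + s) ^ card I" by (simp add: add.commute)
  also have "\<dots> \<le> exp s ^ card I" by (rule power_mono) (use s in auto)
  also have "\<dots> = exp (M * s)" by (simp add: exp_of_nat_mult M_def)
  also have "\<dots> \<le> exp (real D)"
    using M assms by (simp add: s_def field_simps)
  also have "\<dots> = exp 1 ^ D" by (simp flip: exp_of_nat_mult)
  finally have "real (card {S. S \<subseteq> I \<and> card S \<le> D}) \<le> exp 1 ^ D / s ^ D"
    using s by (simp add: field_simps)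
  also have "\<dots> = (exp 1 * (1 + M / real D)) ^ D"
    using assms M by (simp add: s_def power_mult_distrib power_divide field_simps flip: power_mult_distrib)
  finally show ?thesis by (simp add: M_def)
qed

text \<open>The vectors (a i, b i) live in dimension p + 1, so more than p + 1 of them satisfy a
  linear relation. The sign pattern of its coefficients cannot be realised, hence a shattered set
  has at most \<open>Suc p\<close> points.\<close>

lemma card_halfspace_patterns_le:
  fixes a :: "'a \<Rightarrow> nat \<Rightarrow> real" and b :: "'a \<Rightarrow> real"
  assumes I: "finite I"
  shows "real (card ((\<lambda>v. {i\<in>I. 0 \<le> dot p v (a i) + b i}) ` V))
      \<le> (exp 1 * (1 + real (card I) / real (Suc p))) ^ Suc p"
proof -
  define \<F> where "\<F> = (\<lambda>v. {i\<in>I. 0 \<le> dot p v (a i) + b i}) ` V"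
  have "card \<F> \<le> card {S. S \<subseteq> I \<and> shattered \<F> S}"
    by (rule card_le_card_shattered) (use I in \<open>auto simp: \<F>_def\<close>)
  also have "\<dots> \<le> card {S. S \<subseteq> I \<and> card S \<le> Suc p}"
  proof (rule card_mono)
    show "finite {S. S \<subseteq> I \<and> card S \<le> Suc p}" using I by simp
    have False if S: "S \<subseteq> I" "shattered \<F> S" "card S > Suc p" for S
    proof -
      have fS: "finite S" using I S finite_subset by blast
      define f where "f i j = (if j < p then a i j else b i)" for i j
      obtain c where c: "\<exists>i\<in>S. c i \<noteq> 0" "\<And>j. j < Suc p \<Longrightarrow> (\<Sum>i\<in>S. c i * f i j) = 0"
        using linear_dependence[OF fS S(3), of f] by auto
      have c0: "(\<Sum>i\<in>S. c i * (dot p v (a i) + b i)) = 0" for v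
      proof -
        have "(\<Sum>i\<in>S. c i * (dot p v (a i) + b i)) = (\<Sum>i\<in>S. \<Sum>j<p. v j * (c i * a i j)) + (\<Sum>i\<in>S. c i * b i)"
          by (simp add: dot_def distrib_left sum.distrib sum_distrib_left mult_ac)
        also have "(\<Sum>i\<in>S. \<Sum>j<p. v j * (c i * a i j)) = (\<Sum>j<p. v j * (\<Sum>i\<in>S. c i * f i j))"
          by (subst sum.swap) (simp add: sum_distrib_left f_def)
        also have "\<dots> = 0" by (simp add: c(2))
        also have "(\<Sum>i\<in>S. c i * b i) = 0" using c(2)[of p] by (simp add: f_def)
        finally show ?thesis by simp
      qed
      \<comment> \<open>For the pattern of nonnegative coefficients no term of the vanishing sum is
        negative, and a term with \<open>d i < 0\<close> is strictly positive because lying outside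
        a closed half-space is a strict inequality. A nonzero relation has a negative coefficient
        after changing its sign if necessary, so this is applied to \<open>c\<close> and to
        \<open>- c\<close>.\<close>
      have no: False if d: "\<exists>i\<in>S. d i < 0"
        "\<And>v. (\<Sum>i\<in>S. d i * (dot p v (a i) + b i)) = 0" for d :: "'a \<Rightarrow> real"
      proof -
        obtain A where A: "A \<in> \<F>" "A \<inter> S = {i\<in>S. d i \<ge> 0}"
          using S(2)[unfolded shattered_def, rule_format, of "{i\<in>S. d i \<ge> 0}"] by auto
        then obtain v where v: "A = {i\<in>I. 0 \<le> dot p v (a i) + b i}" by (auto simp: \<F>_def)
        have *: "0 \<le> dot p v (a i) + b i \<longleftrightarrow> d i \<ge> 0" if "i \<in> S" for i
        proof -
          have "i \<in> A \<inter> S \<longleftrightarrow> d i \<ge> 0" using that unfolding A(2) by simp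
          then show ?thesis using v S(1) that by auto
        qed
        obtain i where i: "i \<in> S" "d i < 0" using d by auto
        have "0 < (\<Sum>i\<in>S. d i * (dot p v (a i) + b i))"
        proof (rule sum_pos2)
          show "i \<in> S" by fact
          show "0 < d i * (dot p v (a i) + b i)" using *[OF i(1)] i by (auto simp: zero_less_mult_iff)
          show "0 \<le> d i * (dot p v (a i) + b i)" if "i \<in> S" for i
            using *[OF that] by (auto simp: zero_le_mult_iff not_le)
        qed (rule fS)
        with d(2) show False by simp
      qed
      have "(\<Sum>i\<in>S. - c i * (dot p v (a i) + b i)) = 0" for v
        using c0[of v] by (simp add: sum_negf)
      with c0 no[of c] no[of "\<lambda>i. - c i"] have "\<not> c i < 0" "\<not> - c i < 0" if "i \<in> S" for i
        using that by blast+
      with c(1) show False by force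
    qed
    then show "{S. S \<subseteq> I \<and> shattered \<F> S} \<subseteq> {S. S \<subseteq> I \<and> card S \<le> Suc p}"
      by (auto simp flip: not_less)
  qed
  finally have "real (card \<F>) \<le> real (card {S. S \<subseteq> I \<and> card S \<le> Suc p})" by simp
  also have "\<dots> \<le> (exp 1 * (1 + real (card I) / real (Suc p))) ^ Suc p"
    by (rule card_small_subsets_le[OF I]) simp
  finally show ?thesis by (simp add: \<F>_def)
qed

text \<open>Probabilistic method, phrased as counting: some sample of about 2 ln N / \<delta> points
  of \<open>I\<close> separates all N members, so N is at most the number of patterns on that
  sample. The resulting inequality has ln N on its right side and is then solved for N. The factor 4
  in \<open>growth\<close> reflects the four half-spaces that make up a depth event.\<close>

lemma packing_card_le:
  fixes \<G> :: "'a set set"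
  assumes I: "finite I" "I \<noteq> {}" and G: "\<G> \<subseteq> Pow I" and D: "D \<ge> 1" and d: "0 < \<delta>" "\<delta> \<le> 1"
    and growth: "\<And>J. J \<subseteq> I \<Longrightarrow> real (card ((\<inter>) J ` \<G>)) \<le> (exp 1 * (1 + 4 * real (card J) / real D)) ^ D"
    and sep: "\<And>A B. A \<in> \<G> \<Longrightarrow> B \<in> \<G> \<Longrightarrow> A \<noteq> B \<Longrightarrow> \<delta> * real (card I) \<le> real (card (sym_diff A B))"
  shows "real (card \<G>) \<le> (16 * exp 1 / \<delta>) ^ (2 * D)"
proof (cases "\<G> = {}")
  case True
  then show ?thesis using d by simp
next
  case False
  have finG: "finite \<G>" using G I(1) by (meson finite_Pow_iff finite_subset)
  define N where "N = real (card \<G>)"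
  define n where "n = card I"
  have n: "n > 0" using I by (simp add: n_def card_gt_0_iff)
  have N: "N \<ge> 1" using False finG by (simp add: N_def card_gt_0_iff Suc_leI)
  define l where "l = ln N / D"
  have l: "l \<ge> 0" using N by (simp add: l_def)
  \<comment> \<open>Large enough that a union bound over fewer than \<open>N ^ 2\<close> ordered
    pairs, each left unseparated by a fraction at most \<open>exp (- \<delta> * m)\<close> of the
    samples, stays below 1.\<close>
  define m where "m = nat \<lceil>2 * ln N / \<delta>\<rceil>"
  have m1: "real m \<ge> 2 * ln N / \<delta>" unfolding m_def by linarith
  have "2 * ln N / \<delta> \<ge> 0" using N d by simp
  then have m2: "real m \<le> 2 * ln N / \<delta> + 1" unfolding m_def by linarith
  let ?X = "PiE {..<m} (\<lambda>_. I)"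
  let ?P = "{(A, B). A \<in> \<G> \<and> B \<in> \<G> \<and> A \<noteq> B}"
  have Peq: "?P = \<G> \<times> \<G> - (\<lambda>A. (A, A)) ` \<G>" by auto
  have diag: "card ((\<lambda>A. (A, A)) ` \<G>) = card \<G>" by (rule card_image) (auto simp: inj_on_def)
  have "card ?P = card (\<G> \<times> \<G>) - card ((\<lambda>A. (A, A)) ` \<G>)"
    unfolding Peq by (rule card_Diff_subset) (use finG in auto)
  also have "\<dots> = card \<G> * card \<G> - card \<G>" unfolding diag card_cartesian_product ..
  finally have "real (card ?P) = N * N - N" unfolding N_def
    by (simp add: of_nat_diff)
  \<comment> \<open>Strictness comes from the discarded diagonal; it is what makes the bad samples
    strictly fewer than all samples.\<close>
  then have cP: "real (card ?P) < N ^ 2" using N by (simp add: power2_eq_square)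
  have finP: "finite ?P" by (rule finite_subset[of _ "\<G> \<times> \<G>"]) (use finG in auto)
  let ?bad = "\<lambda>(A, B). PiE {..<m} (\<lambda>_. I - sym_diff A B)"
  have "real (card (\<Union>P\<in>?P. ?bad P)) \<le> real (\<Sum>P\<in>?P. card (?bad P))"
    using card_UN_le[OF finP, of ?bad] by (simp only: of_nat_le_iff)
  also have "\<dots> \<le> (\<Sum>P\<in>?P. real n ^ m * exp (- \<delta> * real m))"
    unfolding of_nat_sum
  proof (rule sum_mono, clarify)
    fix A B assume AB: "A \<in> \<G>" "B \<in> \<G>" "A \<noteq> B"
    have sub: "sym_diff A B \<subseteq> I" using AB G by auto
    then have "card (I - sym_diff A B) = n - card (sym_diff A B)"
      using card_Diff_subset[OF finite_subset[OF sub I(1)] sub] by (simp add: n_def)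
    moreover have "card (sym_diff A B) \<le> n" unfolding n_def using sub I(1) by (rule card_mono[rotated])
    ultimately have "real (card (I - sym_diff A B)) = real n - real (card (sym_diff A B))" by simp
    also have "\<dots> \<le> real n * (1 - \<delta>)"
      using sep[OF AB] by (simp add: n_def algebra_simps)
    also have "\<dots> \<le> real n * exp (- \<delta>)"
      using exp_ge_add_one_self[of "-\<delta>"] by (intro mult_left_mono) auto
    finally have "real (card (I - sym_diff A B)) ^ m \<le> (real n * exp (- \<delta>)) ^ m"
      by (rule power_mono) simp
    then show "real (card (PiE {..<m} (\<lambda>_. I - sym_diff A B))) \<le> real n ^ m * exp (- \<delta> * real m)"
      by (simp add: card_PiE power_mult_distrib mult.commute flip: exp_of_nat_mult)
  qed
  also have "\<dots> = real (card ?P) * (real n ^ m * exp (- \<delta> * real m))" by simp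
  also have "\<dots> < N ^ 2 * (real n ^ m * exp (- \<delta> * real m))"
    using cP n by (intro mult_strict_right_mono) auto
  also have "\<dots> \<le> N ^ 2 * (real n ^ m * exp (- 2 * ln N))"
    using m1 d by (intro mult_left_mono) (auto simp: field_simps)
  also have "exp (- 2 * ln N) = 1 / N ^ 2"
    using N by (simp add: exp_minus exp_double divide_inverse)
  also have "N ^ 2 * (real n ^ m * (1 / N ^ 2)) = real n ^ m" using N by simp
  also have "\<dots> = real (card ?X)" by (simp add: card_PiE n_def)
  finally have "card (\<Union>P\<in>?P. ?bad P) < card ?X" by simp
  moreover have "finite (\<Union>P\<in>?P. ?bad P)"
    by (rule finite_UN_I[OF finP]) (use I(1) in \<open>auto split: prod.splits intro!: finite_PiE\<close>)
  ultimately have "\<not> ?X \<subseteq> (\<Union>P\<in>?P. ?bad P)" using card_mono[of "\<Union>P\<in>?P. ?bad P" ?X] by linarith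
  then obtain s where s: "s \<in> ?X" "s \<notin> (\<Union>P\<in>?P. ?bad P)" unfolding subset_iff not_all not_imp by (elim exE conjE)
  define J where "J = s ` {..<m}"
  have J: "J \<subseteq> I" using s(1) by (auto simp: J_def)
  have cJ: "card J \<le> m" unfolding J_def using card_image_le[of "{..<m}" s] by simp
  have inj: "inj_on ((\<inter>) J) \<G>"
  proof (rule inj_onI, rule ccontr)
    fix A B assume AB: "A \<in> \<G>" "B \<in> \<G>" "J \<inter> A = J \<inter> B" "A \<noteq> B"
    then have "J \<inter> sym_diff A B = {}" by auto
    then have "s \<in> ?bad (A, B)" using s(1) by (auto simp: J_def PiE_iff)
    moreover have "(A, B) \<in> ?P" using AB by simp
    ultimately have "s \<in> (\<Union>P\<in>?P. ?bad P)" by (rule UN_I[rotated])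
    then show False using s(2) by contradiction
  qed
  have "N = real (card ((\<inter>) J ` \<G>))" using card_image[OF inj] by (simp add: N_def)
  also have "\<dots> \<le> (exp 1 * (1 + 4 * real (card J) / real D)) ^ D" by (rule growth[OF J])
  \<comment> \<open>The ln N hidden in the sample size is absorbed by 1 + l/2 \<le> exp(l/2). Since
    \<open>exp (l / 2) ^ D\<close> is exactly \<open>sqrt N\<close>, one factor
    \<open>sqrt N\<close> can be cancelled, at the price of the exponent
    \<open>2 * D\<close>.\<close>
  also have "\<dots> \<le> (exp 1 * (16 * exp (l / 2) / \<delta>)) ^ D"
  proof (intro power_mono mult_left_mono)
    have "4 * real (card J) / real D \<le> 4 * (2 * ln N / \<delta> + 1) / real D"
      using cJ m2 D by (intro divide_right_mono mult_left_mono) auto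
    also have "\<dots> = 8 * l / \<delta> + 4 / real D" by (simp add: l_def add_divide_distrib mult_ac)
    also have "4 / real D \<le> 4" using D by (simp add: field_simps)
    finally have "1 + 4 * real (card J) / real D \<le> 5 + 8 * l / \<delta>" by simp
    also have "\<dots> \<le> 5 / \<delta> + 8 * l / \<delta>" using d by (simp add: field_simps)
    also have "\<dots> \<le> 16 * (1 + l / 2) / \<delta>" using d by (simp add: field_simps)
    also have "\<dots> \<le> 16 * exp (l / 2) / \<delta>"
      using d exp_ge_add_one_self[of "l/2"] by (intro divide_right_mono mult_left_mono) auto
    finally show "1 + 4 * real (card J) / real D \<le> 16 * exp (l / 2) / \<delta>" .
  qed (auto intro!: add_nonneg_nonneg)
  also have "\<dots> = (16 * exp 1 / \<delta>) ^ D * exp (l / 2) ^ D"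
    by (simp add: power_mult_distrib power_divide mult_ac)
  also have "exp (l / 2) ^ D = sqrt N"
  proof -
    have "exp (l / 2) ^ D = exp (ln N / 2)" using D by (simp add: l_def flip: exp_of_nat_mult)
    also have "\<dots> = sqrt N" using N by (simp add: powr_half_sqrt[symmetric] powr_def)
    finally show ?thesis .
  qed
  finally have "N \<le> (16 * exp 1 / \<delta>) ^ D * sqrt N" .
  then have "sqrt N * sqrt N \<le> (16 * exp 1 / \<delta>) ^ D * sqrt N" using N by simp
  moreover have "0 < sqrt N" using N by simp
  ultimately have "sqrt N \<le> (16 * exp 1 / \<delta>) ^ D" by (simp only: mult_le_cancel_right_pos)
  then have "sqrt N ^ 2 \<le> ((16 * exp 1 / \<delta>) ^ D) ^ 2" by (rule power_mono) (use N in simp)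
  then have "sqrt N ^ 2 \<le> (16 * exp 1 / \<delta>) ^ (2 * D)" by (simp only: power_mult[symmetric] mult.commute)
  then show ?thesis using N by (simp add: N_def)
qed

section \<open>Chaining for Rademacher averages\<close>

definition signs :: "'a set \<Rightarrow> ('a \<Rightarrow> real) set" where
  "signs I = PiE I (\<lambda>_. {-1, 1})"

text \<open>The mean over uniform random signs, with sums that are not divided by
  \<open>card I\<close>; the natural size is therefore sqrt(card I * D).\<close>

definition rademacher_average :: "'a set \<Rightarrow> 'a set set \<Rightarrow> real" where
  "rademacher_average I \<F> = (\<Sum>s\<in>signs I. Max ((\<lambda>A. \<bar>sum s A\<bar>) ` \<F>)) / 2 ^ card I"

lemma card_signs: "finite I \<Longrightarrow> card (signs I) = 2 ^ card I"
  by (simp add: signs_def card_PiE numeral_2_eq_2)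

text \<open>A random sign is sub-Gaussian with variance proxy 1. After taking logarithms, the
  derivative comparison is tanh y \<le> y, and that in turn follows by differentiating y cosh y -
  sinh y.\<close>

lemma cosh_le_exp_half_square: "cosh x \<le> exp (x\<^sup>2 / 2)" for x :: real
proof -
  have main: "cosh x \<le> exp (x\<^sup>2 / 2)" if "x \<ge> 0" for x :: real
  proof -
    define f where "f x = x\<^sup>2 / 2 - ln (cosh x)" for x :: real
    have "f 0 \<le> f x"
    proof (rule DERIV_nonneg_imp_nondecreasing[OF that])
      fix y :: real assume y: "0 \<le> y"
      have "(f has_real_derivative y - sinh y / cosh y) (at y)"
        unfolding f_def by (auto intro!: derivative_eq_intros simp: cosh_real_pos)
      moreover have "sinh y / cosh y \<le> y"
      proof -
        define g where "g y = y * cosh y - sinh y" for y :: real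
        have "g 0 \<le> g y"
        proof (rule DERIV_nonneg_imp_nondecreasing[OF y])
          fix z :: real assume z: "0 \<le> z"
          have "(g has_real_derivative z * sinh z) (at z)"
            unfolding g_def by (auto intro!: derivative_eq_intros)
          then show "\<exists>d. (g has_real_derivative d) (at z) \<and> 0 \<le> d"
            using z by (intro exI[of _ "z * sinh z"]) auto
        qed
        then show ?thesis by (simp add: g_def field_simps cosh_real_pos)
      qed
      ultimately show "\<exists>d. (f has_real_derivative d) (at y) \<and> 0 \<le> d"
        by (intro exI[of _ "y - sinh y / cosh y"]) auto
    qed
    then have "ln (cosh x) \<le> x\<^sup>2 / 2" by (simp add: f_def)
    then show ?thesis by (metis cosh_real_pos exp_ln exp_le_cancel_iff)
  qed
  show ?thesis using main[of x] main[of "-x"] by (cases "x \<ge> 0") auto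
qed

lemma signs_exp_sum_le:
  assumes "finite I"
  shows "(\<Sum>s\<in>signs I. exp (\<theta> * (\<Sum>i\<in>I. c i * s i))) \<le> 2 ^ card I * exp (\<theta>\<^sup>2 * (\<Sum>i\<in>I. (c i)\<^sup>2) / 2)"
proof -
  have "(\<Sum>s\<in>signs I. exp (\<theta> * (\<Sum>i\<in>I. c i * s i))) = (\<Sum>s\<in>PiE I (\<lambda>_. {-1, 1}). \<Prod>i\<in>I. exp (\<theta> * c i * s i))"
    using assms by (simp add: signs_def sum_distrib_left exp_sum mult.assoc)
  also have "\<dots> = (\<Prod>i\<in>I. \<Sum>u\<in>{-1, 1}. exp (\<theta> * c i * u))"
    by (rule prod_sum_PiE[symmetric]) (use assms in auto)
  also have "\<dots> = (\<Prod>i\<in>I. 2 * cosh (\<theta> * c i))"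
    by (rule prod.cong) (auto simp: cosh_def)
  also have "\<dots> \<le> (\<Prod>i\<in>I. 2 * exp ((\<theta> * c i)\<^sup>2 / 2))"
    by (rule prod_mono) (auto intro: cosh_le_exp_half_square)
  also have "\<dots> = 2 ^ card I * exp (\<Sum>i\<in>I. (\<theta> * c i)\<^sup>2 / 2)"
    using assms by (simp add: prod.distrib exp_sum)
  also have "(\<Sum>i\<in>I. (\<theta> * c i)\<^sup>2 / 2) = \<theta>\<^sup>2 * (\<Sum>i\<in>I. (c i)\<^sup>2) / 2"
    by (simp add: power_mult_distrib sum_distrib_left sum_divide_distrib)
  finally show ?thesis .
qed

text \<open>Maximal inequality for finitely many sub-Gaussian sums; the 2 inside the logarithm
  accounts for the absolute value. The parameter \<theta> is left free because each chaining level
  chooses its own.\<close>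

lemma signs_max_le:
  fixes c :: "'b \<Rightarrow> 'a \<Rightarrow> real"
  assumes I: "finite I" and \<A>: "finite \<A>" "\<A> \<noteq> {}" and l: "\<theta> > 0"
    and w: "\<And>A. A \<in> \<A> \<Longrightarrow> (\<Sum>i\<in>I. (c A i)\<^sup>2) \<le> w"
  shows "(\<Sum>s\<in>signs I. Max ((\<lambda>A. \<bar>\<Sum>i\<in>I. c A i * s i\<bar>) ` \<A>)) / 2 ^ card I
      \<le> ln (2 * real (card \<A>)) / \<theta> + \<theta> * w / 2"
proof -
  define N where "N = real (card \<A>)"
  define T where "T = 2 * N * exp (\<theta>\<^sup>2 * w / 2)"
  have N: "N \<ge> 1" using \<A> by (simp add: N_def Suc_leI card_gt_0_iff)
  have T: "T > 0" using N by (simp add: T_def)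
  define m where "m s = Max ((\<lambda>A. \<bar>\<Sum>i\<in>I. c A i * s i\<bar>) ` \<A>)" for s
  define Y where "Y s A = \<theta> * (\<Sum>i\<in>I. c A i * s i)" for s A
  have E: "(\<Sum>s\<in>signs I. exp (Y s A)) \<le> 2 ^ card I * exp (\<theta>\<^sup>2 * w / 2)"
    "(\<Sum>s\<in>signs I. exp (- Y s A)) \<le> 2 ^ card I * exp (\<theta>\<^sup>2 * w / 2)" if "A \<in> \<A>" for A
  proof -
    have *: "2 ^ card I * exp (\<theta>\<^sup>2 * (\<Sum>i\<in>I. (c A i)\<^sup>2) / 2) \<le> 2 ^ card I * exp (\<theta>\<^sup>2 * w / 2)"
      using w[OF that] by (simp add: mult_left_mono)
    show "(\<Sum>s\<in>signs I. exp (Y s A)) \<le> 2 ^ card I * exp (\<theta>\<^sup>2 * w / 2)"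
      unfolding Y_def by (rule order_trans[OF signs_exp_sum_le[OF I] *])
    show "(\<Sum>s\<in>signs I. exp (- Y s A)) \<le> 2 ^ card I * exp (\<theta>\<^sup>2 * w / 2)"
      using order_trans[OF signs_exp_sum_le[OF I, of "-\<theta>" "c A"]] * by (simp add: Y_def)
  qed
  have "(\<Sum>s\<in>signs I. exp (\<theta> * m s)) \<le> (\<Sum>s\<in>signs I. \<Sum>A\<in>\<A>. exp (Y s A) + exp (- Y s A))"
  proof (rule sum_mono)
    fix s
    have "m s \<in> (\<lambda>A. \<bar>\<Sum>i\<in>I. c A i * s i\<bar>) ` \<A>"
      unfolding m_def by (rule Max_in) (use \<A> in auto)
    then obtain A where A: "A \<in> \<A>" "m s = \<bar>\<Sum>i\<in>I. c A i * s i\<bar>" by auto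
    have "exp (\<theta> * m s) = exp \<bar>Y s A\<bar>" using l by (simp add: A Y_def abs_mult)
    also have "\<dots> \<le> exp (Y s A) + exp (- Y s A)" by (simp add: abs_if)
    also have "\<dots> \<le> (\<Sum>A\<in>\<A>. exp (Y s A) + exp (- Y s A))"
      using A \<A> by (intro member_le_sum[where f="\<lambda>A. exp (Y s A) + exp (- Y s A)"]) (auto intro: add_nonneg_nonneg)
    finally show "exp (\<theta> * m s) \<le> (\<Sum>A\<in>\<A>. exp (Y s A) + exp (- Y s A))" .
  qed
  also have "\<dots> = (\<Sum>A\<in>\<A>. (\<Sum>s\<in>signs I. exp (Y s A)) + (\<Sum>s\<in>signs I. exp (- Y s A)))"
    by (subst sum.swap) (simp add: sum.distrib)
  also have "\<dots> \<le> (\<Sum>A\<in>\<A>. 2 ^ card I * exp (\<theta>\<^sup>2 * w / 2) + 2 ^ card I * exp (\<theta>\<^sup>2 * w / 2))"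
    using E by (intro sum_mono add_mono)
  also have "\<dots> = 2 ^ card I * T" by (simp add: T_def N_def)
  finally have bound: "(\<Sum>s\<in>signs I. exp (\<theta> * m s)) \<le> 2 ^ card I * T" .
  have "\<theta> * (\<Sum>s\<in>signs I. m s) = (\<Sum>s\<in>signs I. \<theta> * m s)" by (simp add: sum_distrib_left)
  also have "\<dots> \<le> (\<Sum>s\<in>signs I. ln T + (exp (\<theta> * m s) / T - 1))"
  proof (rule sum_mono)
    fix s
    \<comment> \<open>Jensen's inequality in pointwise form: \<open>ln\<close> lies below its
      tangent at \<open>T\<close>, and \<open>T\<close> bounds the mean of
      \<open>exp (\<theta> * m s)\<close>.\<close>
    have "ln (exp (\<theta> * m s) / T) \<le> exp (\<theta> * m s) / T - 1" using T by (intro ln_le_minus_one) simp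
    then show "\<theta> * m s \<le> ln T + (exp (\<theta> * m s) / T - 1)" using T by (simp add: ln_div)
  qed
  also have "\<dots> = 2 ^ card I * (ln T - 1) + (\<Sum>s\<in>signs I. exp (\<theta> * m s)) / T"
    by (simp add: sum.distrib sum_subtractf card_signs[OF I] sum_divide_distrib algebra_simps)
  also have "\<dots> \<le> 2 ^ card I * (ln T - 1) + 2 ^ card I"
    using bound T by (simp add: divide_le_eq)
  also have "\<dots> = 2 ^ card I * ln T" by (simp add: algebra_simps)
  finally have "(\<Sum>s\<in>signs I. m s) / 2 ^ card I \<le> ln T / \<theta>"
    using l by (simp add: field_simps)
  also have "ln T = ln (2 * N) + \<theta>\<^sup>2 * w / 2" using N by (simp add: T_def ln_mult)
  finally show ?thesis using l by (simp add: m_def N_def add_divide_distrib power2_eq_square)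
qed

text \<open>One chaining step. Every \<open>A\<close> is replaced by a neighbour
  \<open>\<pi> A\<close>, and the increment has squared coefficient norm equal to the size of their
  symmetric difference. Only one neighbour per \<open>A\<close> is used, so the logarithm involves
  \<open>card \<A>\<close> and not the number of pairs.\<close>

lemma rademacher_average_link:
  assumes I: "finite I" and \<A>: "\<A> \<subseteq> Pow I" "\<A> \<noteq> {}" and \<B>: "\<B> \<subseteq> Pow I" and l: "\<theta> > 0"
    and close: "\<And>A. A \<in> \<A> \<Longrightarrow> \<exists>B\<in>\<B>. real (card (sym_diff A B)) \<le> w"
  shows "rademacher_average I \<A>
    \<le> rademacher_average I \<B> + (ln (2 * real (card \<A>)) / \<theta> + \<theta> * w / 2)"
proof -
  obtain \<pi> where \<pi>: "\<And>A. A \<in> \<A> \<Longrightarrow> \<pi> A \<in> \<B>" "\<And>A. A \<in> \<A> \<Longrightarrow> real (card (sym_diff A (\<pi> A))) \<le> w"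
    using close by metis
  have fin: "finite \<A>" "finite \<B>" using I \<A> \<B> by (meson finite_Pow_iff finite_subset)+
  define c where "c A i = of_bool (i \<in> A) - (of_bool (i \<in> \<pi> A) :: real)" for A i
  have c2: "(\<Sum>i\<in>I. (c A i)\<^sup>2) \<le> w" if A: "A \<in> \<A>" for A
  proof -
    have "(\<Sum>i\<in>I. (c A i)\<^sup>2) = (\<Sum>i\<in>I. of_bool (i \<in> sym_diff A (\<pi> A)))"
      by (rule sum.cong) (auto simp: c_def)
    also have "\<dots> = real (card (I \<inter> sym_diff A (\<pi> A)))"
      using I by (simp add: of_bool_def sum.If_cases Int_def)
    also have "I \<inter> sym_diff A (\<pi> A) = sym_diff A (\<pi> A)" using A \<A> \<pi>(1)[OF A] \<B> by auto
    finally show ?thesis using \<pi>(2)[OF A] by simp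
  qed
  have sum_eq: "(\<Sum>i\<in>I. c A i * s i) = sum s A - sum s (\<pi> A)" if A: "A \<in> \<A>" for A s
  proof -
    have ind: "(\<Sum>i\<in>I. of_bool (i \<in> B) * s i) = sum s B" if "B \<subseteq> I" for B
    proof -
      have "(\<Sum>i\<in>I. of_bool (i \<in> B) * s i) = (\<Sum>i\<in>I. if i \<in> B then s i else 0)"
        by (rule sum.cong) auto
      then show ?thesis using that I by (simp add: sum.If_cases Int_absorb1)
    qed
    have "(\<Sum>i\<in>I. c A i * s i) = (\<Sum>i\<in>I. of_bool (i \<in> A) * s i) - (\<Sum>i\<in>I. of_bool (i \<in> \<pi> A) * s i)"
      by (simp add: c_def left_diff_distrib sum_subtractf)
    moreover have "A \<subseteq> I" "\<pi> A \<subseteq> I" using A \<A> \<pi>(1)[OF A] \<B> by blast+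
    ultimately show ?thesis by (simp add: ind)
  qed
  have "Max ((\<lambda>A. \<bar>sum s A\<bar>) ` \<A>)
      \<le> Max ((\<lambda>A. \<bar>sum s A\<bar>) ` \<B>) + Max ((\<lambda>A. \<bar>\<Sum>i\<in>I. c A i * s i\<bar>) ` \<A>)" for s
  proof (rule Max.boundedI)
    fix x assume "x \<in> (\<lambda>A. \<bar>sum s A\<bar>) ` \<A>"
    then obtain A where A: "A \<in> \<A>" "x = \<bar>sum s A\<bar>" by auto
    have "x \<le> \<bar>sum s (\<pi> A)\<bar> + \<bar>\<Sum>i\<in>I. c A i * s i\<bar>" using A by (simp add: sum_eq)
    also have "\<dots> \<le> Max ((\<lambda>A. \<bar>sum s A\<bar>) ` \<B>) + Max ((\<lambda>A. \<bar>\<Sum>i\<in>I. c A i * s i\<bar>) ` \<A>)"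
      using A fin \<pi>(1) by (intro add_mono Max_ge) auto
    finally show "x \<le> \<dots>" .
  qed (use fin \<A> in auto)
  then have "(\<Sum>s\<in>signs I. Max ((\<lambda>A. \<bar>sum s A\<bar>) ` \<A>)) \<le>
      (\<Sum>s\<in>signs I. Max ((\<lambda>A. \<bar>sum s A\<bar>) ` \<B>) + Max ((\<lambda>A. \<bar>\<Sum>i\<in>I. c A i * s i\<bar>) ` \<A>))"
    by (intro sum_mono)
  then have "rademacher_average I \<A> \<le> rademacher_average I \<B> +
      (\<Sum>s\<in>signs I. Max ((\<lambda>A. \<bar>\<Sum>i\<in>I. c A i * s i\<bar>) ` \<A>)) / 2 ^ card I"
    by (simp add: rademacher_average_def sum.distrib divide_right_mono flip: add_divide_distrib)
  then show ?thesis using signs_max_le[where c = c, OF I fin(1) \<A>(2) l c2] by linarith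
qed

text \<open>Both conclusions are used for the same net: separation feeds the packing bound, covering
  feeds the chaining step.\<close>

lemma maximal_separated_subset:
  assumes "finite F" "\<And>A. close A A" "\<And>A B. close A B \<Longrightarrow> close B A"
  shows "\<exists>G\<subseteq>F. (\<forall>A\<in>G. \<forall>B\<in>G. A \<noteq> B \<longrightarrow> \<not> close A B) \<and> (\<forall>A\<in>F. \<exists>B\<in>G. close A B)"
  using assms(1)
proof (induction F)
  case (insert x F)
  then obtain G where G: "G \<subseteq> F" "\<forall>A\<in>G. \<forall>B\<in>G. A \<noteq> B \<longrightarrow> \<not> close A B" "\<forall>A\<in>F. \<exists>B\<in>G. close A B"
    by auto
  show ?case
  proof (cases "\<exists>B\<in>G. close x B")
    case True
    then show ?thesis using G by (intro exI[of _ G]) auto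
  next
    case False
    then show ?thesis using G assms(2,3) by (intro exI[of _ "insert x G"]) auto
  qed
qed simp

text \<open>The entropy at scale 4^(-k) grows only linearly in k, so it remains summable against the
  increment sizes 2^(-k). This is what removes the logarithm from the final bound.\<close>

lemma ln_two_packing_le:
  assumes "D \<ge> 1" "M \<ge> 1" "M \<le> (16 * exp 1 * 4 ^ k) ^ (2 * D)"
  shows "ln (2 * M) \<le> real D * (11 + 4 * real k)"
proof -
  have l2: "ln 2 \<le> (1::real)" using ln_le_minus_one[of "2::real"] by simp
  have l4: "ln 4 = 2 * ln (2::real)" using ln_realpow[of "2::real" 2] by simp
  have l16: "ln 16 = 4 * ln (2::real)" using ln_realpow[of "2::real" 4] by simp
  have "ln (2 * M) = ln 2 + ln M" using assms by (simp add: ln_mult)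
  also have "ln M \<le> ln ((16 * exp 1 * 4 ^ k) ^ (2 * D))" using assms by (subst ln_le_cancel_iff) auto
  also have "\<dots> = real (2 * D) * (ln 16 + 1 + real k * ln 4)"
    by (simp only: ln_realpow) (simp add: ln_mult ln_realpow)
  also have "\<dots> \<le> real (2 * D) * (4 + 1 + real k * 2)"
    using l2 by (intro mult_left_mono add_mono) (auto simp: l4 l16)
  also have "ln 2 + real (2 * D) * (4 + 1 + real k * 2) \<le> real D * (11 + 4 * real k)"
    using l2 assms(1) by (simp add: algebra_simps)
  finally show ?thesis by simp
qed

theorem rademacher_average_le:
  assumes I: "finite I" "I \<noteq> {}" and F: "\<F> \<subseteq> Pow I" "\<F> \<noteq> {}" and D: "D \<ge> 1"
    and growth: "\<And>J. J \<subseteq> I \<Longrightarrow> real (card ((\<inter>) J ` \<F>)) \<le> (exp 1 * (1 + 4 * real (card J) / real D)) ^ D"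
  shows "rademacher_average I \<F> \<le> 34 * sqrt (real (card I) * real D)"
proof -
  define n where "n = real (card I)"
  have n: "n \<ge> 1" using I by (simp add: n_def Suc_leI card_gt_0_iff)
  have fin: "finite \<F>" using F(1) I(1) by (meson finite_Pow_iff finite_subset)
  \<comment> \<open>The counting radii shrink by 4, so the Euclidean norms of the increments shrink
    by 2 per level.\<close>
  define net where "net k G \<longleftrightarrow> G \<subseteq> \<F> \<and> (\<forall>A\<in>G. \<forall>B\<in>G. A \<noteq> B \<longrightarrow> n / 4 ^ k < real (card (sym_diff A B))) \<and>
      (\<forall>A\<in>\<F>. \<exists>B\<in>G. real (card (sym_diff A B)) \<le> n / 4 ^ k)" for k G
  have "\<exists>G. net k G" for k
  proof -
    have "sym_diff A B = sym_diff B A" for A B :: "'a set" by auto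
    then show ?thesis
      using maximal_separated_subset[OF fin, of "\<lambda>A B. real (card (sym_diff A B)) \<le> n / 4 ^ k"] n
      by (auto simp: net_def not_le)
  qed
  then obtain G where G: "\<And>k. net k (G k)" by metis
  have GF: "G k \<subseteq> \<F>" for k using G[of k] by (simp add: net_def)
  have sub: "G k \<subseteq> Pow I" for k using GF[of k] F(1) by blast
  have ne: "G k \<noteq> {}" for k using G[of k] F(2) by (auto simp: net_def)
  have finG: "finite (G k)" for k using GF fin finite_subset by blast
  \<comment> \<open>The radius \<open>4 * n / 4 ^ k\<close> is the covering radius of the previous
    level, so \<open>\<B>\<close> is going to be \<open>G (k - 1)\<close>, or the family containing
    only the empty set when k = 0.\<close>
  have link: "rademacher_average I (G k) \<le> rademacher_average I \<B> + sqrt (n * D) * ((13 + 4 * real k) / 2 ^ k)"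
    if B: "\<B> \<subseteq> Pow I" "\<And>A. A \<in> G k \<Longrightarrow> \<exists>B\<in>\<B>. real (card (sym_diff A B)) \<le> 4 * n / 4 ^ k" for k \<B>
  proof -
    \<comment> \<open>Balances the two terms of \<open>rademacher_average_link\<close>: both become
      multiples of sqrt(n D) / 2^k, with factors 11 + 4k and 2.\<close>
    define \<theta> where "\<theta> = sqrt (D / n) * 2 ^ k"
    have l: "\<theta> > 0" using D n by (simp add: \<theta>_def)
    have card: "real (card (G k)) \<le> (16 * exp 1 / (1 / 4 ^ k)) ^ (2 * D)"
    proof (rule packing_card_le[OF I sub D])
      show "real (card ((\<inter>) J ` G k)) \<le> (exp 1 * (1 + 4 * real (card J) / real D)) ^ D" if "J \<subseteq> I" for J
      proof -
        have "card ((\<inter>) J ` G k) \<le> card ((\<inter>) J ` \<F>)" using GF fin by (intro card_mono) auto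
        then show ?thesis using growth[OF that] by linarith
      qed
      show "1 / 4 ^ k * real (card I) \<le> real (card (sym_diff A B))" if "A \<in> G k" "B \<in> G k" "A \<noteq> B" for A B
        using G[of k] that by (force simp: net_def n_def)
    qed auto
    have "card (G k) \<ge> 1" using finG ne by (simp add: Suc_leI card_gt_0_iff)
    then have ln: "ln (2 * real (card (G k))) \<le> D * (11 + 4 * real k)"
      using card by (intro ln_two_packing_le[OF D]) auto
    have "rademacher_average I (G k) \<le> rademacher_average I \<B> +
        (ln (2 * real (card (G k))) / \<theta> + \<theta> * (4 * n / 4 ^ k) / 2)"
      by (rule rademacher_average_link[OF I(1) sub ne B(1) l B(2)])
    also have "ln (2 * real (card (G k))) / \<theta> \<le> D * (11 + 4 * real k) / \<theta>"
      using ln l by (simp add: divide_right_mono)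
    also have "D * (11 + 4 * real k) / \<theta> = sqrt (n * D) * ((11 + 4 * real k) / 2 ^ k)"
    proof -
      have "real D = sqrt D * sqrt D" by simp
      then show ?thesis
        using n D by (simp add: \<theta>_def real_sqrt_divide real_sqrt_mult divide_simps del: real_sqrt_mult_self)
    qed
    also have "\<theta> * (4 * n / 4 ^ k) / 2 = sqrt (n * D) * (2 / 2 ^ k)"
    proof -
      have "(4::real) ^ k = 2 ^ k * 2 ^ k" by (simp flip: power_mult_distrib)
      then show ?thesis
        using n D by (simp add: \<theta>_def real_sqrt_divide real_sqrt_mult field_simps)
    qed
    finally show ?thesis by (simp add: algebra_simps add_divide_distrib)
  qed
  \<comment> \<open>The subtracted fraction is the tail of the convergent series: the sum of (13 +
    4j) / 2^j over j \<le> k equals 34 - (21 + 4k) / 2^k.\<close>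
  have bound: "rademacher_average I (G k) \<le> sqrt (n * D) * (34 - (21 + 4 * real k) / 2 ^ k)" for k
  proof (induction k)
    case 0
    \<comment> \<open>The chain starts at the empty set, which is within n of every subset of
      \<open>I\<close> and contributes nothing.\<close>
    have "rademacher_average I {{}} = 0" by (simp add: rademacher_average_def)
    moreover have "rademacher_average I (G 0) \<le> rademacher_average I {{}} + sqrt (n * D) * ((13 + 4 * real 0) / 2 ^ 0)"
    proof (rule link)
      fix A assume "A \<in> G 0"
      then have "A \<subseteq> I" using sub by auto
      then have "real (card A) \<le> n" using I by (simp add: n_def card_mono)
      then show "\<exists>B\<in>{{}}. real (card (sym_diff A B)) \<le> 4 * n / 4 ^ 0" using n by simp
    qed simp
    ultimately show ?case by simp
  next
    case (Suc k)
    have "rademacher_average I (G (Suc k))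
        \<le> rademacher_average I (G k) + sqrt (n * D) * ((13 + 4 * real (Suc k)) / 2 ^ Suc k)"
    proof (rule link[OF sub])
      fix A assume "A \<in> G (Suc k)"
      then show "\<exists>B\<in>G k. real (card (sym_diff A B)) \<le> 4 * n / 4 ^ Suc k"
        using G[of k] GF[of "Suc k"] by (auto simp: net_def)
    qed
    also have "\<dots> \<le> sqrt (n * D) * (34 - (21 + 4 * real k) / 2 ^ k + (13 + 4 * real (Suc k)) / 2 ^ Suc k)"
      using Suc.IH by (simp add: distrib_left)
    also have "34 - (21 + 4 * real k) / 2 ^ k + (13 + 4 * real (Suc k)) / 2 ^ Suc k
        = 34 - (21 + 4 * real (Suc k)) / 2 ^ Suc k"
      by (simp add: field_simps)
    finally show ?case .
  qed
  \<comment> \<open>Once the covering radius is below 1 the net is all of \<open>\<F>\<close>, so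
    the chain ends without a remainder.\<close>
  obtain K where K: "n < 4 ^ K" using real_arch_pow[of 4 n] by auto
  have "\<F> \<subseteq> G K"
  proof
    fix A assume A: "A \<in> \<F>"
    then obtain B where B: "B \<in> G K" "real (card (sym_diff A B)) \<le> n / 4 ^ K"
      using G[of K] by (auto simp: net_def)
    moreover have "n / 4 ^ K < 1" using K by simp
    ultimately have "real (card (sym_diff A B)) < 1" by linarith
    moreover have "finite (sym_diff A B)"
      using A B(1) F(1) sub[of K] I(1) by (meson PowD finite_Diff finite_UnI finite_subset subsetD)
    ultimately have "sym_diff A B = {}" by simp
    then show "A \<in> G K" using B(1) by (metis Diff_eq_empty_iff Un_empty subset_antisym)
  qed
  then have "G K = \<F>" using GF by blast
  then have "rademacher_average I \<F> \<le> sqrt (n * D) * (34 - (21 + 4 * real K) / 2 ^ K)"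
    using bound[of K] by simp
  also have "\<dots> \<le> sqrt (n * D) * 34"
    using n by (intro mult_left_mono) auto
  finally show ?thesis by (simp add: n_def mult.commute)
qed

section \<open>Symmetrization\<close>

definition deviation :: "nat \<Rightarrow> 'a measure \<Rightarrow> 'a set \<Rightarrow> (nat \<Rightarrow> 'a) \<Rightarrow> real" where
  "deviation n M A x = \<bar>(\<Sum>i<n. indicator A (x i)) - real n * measure M A\<bar>"

text \<open>On a fixed sample an index \<open>v\<close> matters only through the set of sample
  points lying in \<open>H v\<close>. The supremum over a possibly infinite \<open>V\<close> is thus
  a maximum over finitely many patterns, to which chaining applies.\<close>

lemma signs_sum_SUP_le:
  fixes H :: "'v \<Rightarrow> 'a set" and x :: "nat \<Rightarrow> 'a"
  assumes n: "n \<ge> 1" and V: "V \<noteq> {}" and D: "D \<ge> 1"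
    and growth: "\<And>J. finite J \<Longrightarrow>
      real (card ((\<lambda>v. {i\<in>J. x i \<in> H v}) ` V)) \<le> (exp 1 * (1 + 4 * real (card J) / real D)) ^ D"
  shows "(\<Sum>s\<in>signs {..<n}. SUP v\<in>V. ennreal \<bar>\<Sum>i<n. s i * indicator (H v) (x i)\<bar>)
    \<le> ennreal (2 ^ n * (34 * sqrt (real n * real D)))"
proof -
  define \<F> where "\<F> = (\<lambda>v. {i\<in>{..<n}. x i \<in> H v}) ` V"
  have F: "\<F> \<subseteq> Pow {..<n}" "\<F> \<noteq> {}" using V by (auto simp: \<F>_def)
  have fin: "finite \<F>" using F(1) by (rule finite_subset) simp
  have "rademacher_average {..<n} \<F> \<le> 34 * sqrt (real (card {..<n}) * real D)"
  proof (rule rademacher_average_le[OF _ _ F D])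
    fix J assume J: "J \<subseteq> {..<n}"
    have "(\<inter>) J ` \<F> = (\<lambda>v. {i\<in>J. x i \<in> H v}) ` V"
      unfolding \<F>_def image_image using J by (intro image_cong) auto
    then show "real (card ((\<inter>) J ` \<F>)) \<le> (exp 1 * (1 + 4 * real (card J) / real D)) ^ D"
      using growth[OF finite_subset[OF J]] by simp
  qed (use n in \<open>auto simp: lessThan_empty_iff\<close>)
  then have R: "(\<Sum>s\<in>signs {..<n}. Max ((\<lambda>A. \<bar>sum s A\<bar>) ` \<F>)) \<le> 2 ^ n * (34 * sqrt (real n * real D))"
    by (simp add: rademacher_average_def field_simps)
  have M0: "0 \<le> Max ((\<lambda>A. \<bar>sum s A\<bar>) ` \<F>)" for s :: "nat \<Rightarrow> real"
  proof -
    obtain A where "A \<in> \<F>" using F by auto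
    then have "\<bar>sum s A\<bar> \<le> Max ((\<lambda>A. \<bar>sum s A\<bar>) ` \<F>)" using fin by (intro Max_ge) auto
    then show ?thesis by linarith
  qed
  have "(\<Sum>s\<in>signs {..<n}. SUP v\<in>V. ennreal \<bar>\<Sum>i<n. s i * indicator (H v) (x i)\<bar>)
      \<le> (\<Sum>s\<in>signs {..<n}. ennreal (Max ((\<lambda>A. \<bar>sum s A\<bar>) ` \<F>)))"
  proof (intro sum_mono SUP_least ennreal_leI)
    fix s :: "nat \<Rightarrow> real" and v assume v: "v \<in> V"
    have "(\<Sum>i\<in>{i\<in>{..<n}. x i \<in> H v}. s i) = (\<Sum>i<n. if x i \<in> H v then s i else 0)"
      by (rule sum.inter_filter) simp
    also have "\<dots> = (\<Sum>i<n. s i * indicator (H v) (x i))"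
      by (rule sum.cong) auto
    finally have "(\<Sum>i<n. s i * indicator (H v) (x i)) = (\<Sum>i\<in>{i\<in>{..<n}. x i \<in> H v}. s i)" ..
    then show "\<bar>\<Sum>i<n. s i * indicator (H v) (x i)\<bar> \<le> Max ((\<lambda>A. \<bar>sum s A\<bar>) ` \<F>)"
      using fin v by (auto simp: \<F>_def intro!: Max_ge)
  qed
  also have "\<dots> = ennreal (\<Sum>s\<in>signs {..<n}. Max ((\<lambda>A. \<bar>sum s A\<bar>) ` \<F>))"
    using M0 by (rule sum_ennreal)
  also have "\<dots> \<le> ennreal (2 ^ n * (34 * sqrt (real n * real D)))"
    by (rule ennreal_leI[OF R])
  finally show ?thesis .
qed

text \<open>The involution of a doubled sample that exchanges point i with its ghost n + i exactly
  when the sign of i is not 1. Holding both samples in one product over 2n indices makes this a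
  plain reindexing.\<close>

definition swap_index :: "nat \<Rightarrow> (nat \<Rightarrow> real) \<Rightarrow> nat \<Rightarrow> nat" where
  "swap_index n s i = (if i < n then (if s i = 1 then i else n + i)
     else (if s (i - n) = 1 then i else i - n))"

lemma swap_index_involution: "i < 2 * n \<Longrightarrow> swap_index n s (swap_index n s i) = i"
  by (auto simp: swap_index_def)

lemma swap_index_less: "i < 2 * n \<Longrightarrow> swap_index n s i < 2 * n"
  by (auto simp: swap_index_def)

lemma borel_measurable_indicator_component:
  assumes "A \<in> sets M" "i \<in> K"
  shows "(\<lambda>\<omega>. indicator A (\<omega> i) :: real) \<in> borel_measurable (Pi\<^sub>M K (\<lambda>_. M))"
  using assms by measurable

context prob_space
begin

text \<open>The expectation in the deviation is the mean of the empirical count of an independent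
  second sample, so the absolute value of a mean is bounded by the mean of an absolute value. The
  ghost sample occupies the indices from n to 2n - 1.\<close>

lemma nn_integral_deviation_le_ghost:
  fixes n :: nat
  assumes H: "\<And>v. v \<in> V \<Longrightarrow> H v \<in> sets M" and V: "countable V"
  shows "(\<integral>\<^sup>+x. (SUP v\<in>V. ennreal (deviation n M (H v) x)) \<partial>Pi\<^sub>M {..<n} (\<lambda>_. M))
    \<le> (\<integral>\<^sup>+\<omega>. (SUP v\<in>V. ennreal \<bar>\<Sum>i<n. indicator (H v) (\<omega> i) - indicator (H v) (\<omega> (n + i))\<bar>) \<partial>Pi\<^sub>M {..<2 * n} (\<lambda>_. M))"
proof -
  interpret P: product_prob_space "\<lambda>_::nat. M" "{n..<2 * n}" by standard
  have prob_J: "measure (Pi\<^sub>M {n..<2 * n} (\<lambda>_. M)) (space (Pi\<^sub>M {n..<2 * n} (\<lambda>_. M))) = 1"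
    by (rule prob_space.prob_space[OF prob_space_PiM]) (rule prob_space_axioms)
  let ?I = "{..<n}" and ?J = "{n..<2 * n}"
  let ?T = "\<lambda>\<omega> v. \<bar>\<Sum>i<n. indicator (H v) (\<omega> i) - indicator (H v) (\<omega> (n + i)) :: real\<bar>"
  have K: "?I \<union> ?J = {..<2 * n}" by auto
  have meas: "(\<lambda>\<omega>. SUP v\<in>V. ennreal (?T \<omega> v)) \<in> borel_measurable (Pi\<^sub>M (?I \<union> ?J) (\<lambda>_. M))"
    unfolding K
    by (intro borel_measurable_SUP V measurable_compose[OF _ measurable_ennreal] borel_measurable_abs borel_measurable_sum
      borel_measurable_diff borel_measurable_indicator_component H)
      auto
  have "(\<integral>\<^sup>+x. (SUP v\<in>V. ennreal (deviation n M (H v) x)) \<partial>Pi\<^sub>M ?I (\<lambda>_. M))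
      \<le> (\<integral>\<^sup>+x. (\<integral>\<^sup>+y. (SUP v\<in>V. ennreal (?T (merge ?I ?J (x, y)) v)) \<partial>Pi\<^sub>M ?J (\<lambda>_. M)) \<partial>Pi\<^sub>M ?I (\<lambda>_. M))"
  proof (rule nn_integral_mono, rule SUP_least)
    fix x v assume v: "v \<in> V"
    let ?g = "\<lambda>y. (\<Sum>i<n. indicator (H v) (x i)) - (\<Sum>i<n. indicator (H v) (y (n + i)) :: real)"
    have int1: "integrable (Pi\<^sub>M ?J (\<lambda>_. M)) (\<lambda>y. indicator (H v) (y (n + i)) :: real)"
      and int2: "(\<integral>y. indicator (H v) (y (n + i)) \<partial>Pi\<^sub>M ?J (\<lambda>_. M)) = measure M (H v)" if "i < n" for i
    proof -
      have i: "n + i \<in> ?J" using that by auto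
      have c: "(\<lambda>y. y (n + i)) \<in> Pi\<^sub>M ?J (\<lambda>_. M) \<rightarrow>\<^sub>M M" using i by (rule measurable_component_singleton)
      have d: "distr (Pi\<^sub>M ?J (\<lambda>_. M)) M (\<lambda>y. y (n + i)) = M"
        by (rule distr_PiM_component[OF _ i]) (rule prob_space_axioms)
      have *: "integrable M (indicator (H v) :: _ \<Rightarrow> real)" using H[OF v] by (simp add: emeasure_finite less_top[symmetric])
      show "integrable (Pi\<^sub>M ?J (\<lambda>_. M)) (\<lambda>y. indicator (H v) (y (n + i)) :: real)"
        by (rule integrable_distr[OF c]) (use * d in simp)
      have "(\<integral>y. indicator (H v) (y (n + i)) \<partial>Pi\<^sub>M ?J (\<lambda>_. M)) = (\<integral>z. (indicator (H v) z :: real) \<partial>distr (Pi\<^sub>M ?J (\<lambda>_. M)) M (\<lambda>y. y (n + i)))"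
        using H[OF v] by (subst integral_distr[OF c]) auto
      also have "\<dots> = measure M (H v)" unfolding d using H[OF v] by simp
      finally show "(\<integral>y. indicator (H v) (y (n + i)) \<partial>Pi\<^sub>M ?J (\<lambda>_. M)) = measure M (H v)" .
    qed
    have ints: "integrable (Pi\<^sub>M ?J (\<lambda>_. M)) (\<lambda>y. \<Sum>i<n. indicator (H v) (y (n + i)) :: real)"
      using int1 by (intro Bochner_Integration.integrable_sum) auto
    have eq: "(\<integral>y. ?g y \<partial>Pi\<^sub>M ?J (\<lambda>_. M)) = (\<Sum>i<n. indicator (H v) (x i)) - real n * measure M (H v)"
      using ints int1 int2 by (subst Bochner_Integration.integral_diff) (auto simp: prob_J)
    have "ennreal (deviation n M (H v) x) = ennreal (norm (\<integral>y. ?g y \<partial>Pi\<^sub>M ?J (\<lambda>_. M)))"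
      unfolding eq by (simp add: deviation_def)
    also have "\<dots> \<le> (\<integral>\<^sup>+y. norm (?g y) \<partial>Pi\<^sub>M ?J (\<lambda>_. M))"
      by (rule integral_norm_bound_ennreal) (use ints in auto)
    also have "\<dots> \<le> (\<integral>\<^sup>+y. (SUP v\<in>V. ennreal (?T (merge ?I ?J (x, y)) v)) \<partial>Pi\<^sub>M ?J (\<lambda>_. M))"
    proof (rule nn_integral_mono, rule SUP_upper2[OF v])
      fix y
      show "ennreal (norm (?g y)) \<le> ennreal (?T (merge ?I ?J (x, y)) v)"
        by (simp add: sum_subtractf merge_def)
    qed
    finally show "ennreal (deviation n M (H v) x)
      \<le> (\<integral>\<^sup>+y. (SUP v\<in>V. ennreal (?T (merge ?I ?J (x, y)) v)) \<partial>Pi\<^sub>M ?J (\<lambda>_. M))" .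
  qed
  also have "\<dots> = (\<integral>\<^sup>+\<omega>. (SUP v\<in>V. ennreal (?T \<omega> v)) \<partial>Pi\<^sub>M (?I \<union> ?J) (\<lambda>_. M))"
    by (rule P.product_nn_integral_fold[symmetric, OF _ _ _ meas]) auto
  finally show ?thesis unfolding K .
qed

text \<open>The constant is 68 = 2 * 34: after symmetrization the sample and the ghost sample each
  contribute one Rademacher average.\<close>

theorem nn_integral_SUP_deviation_le:
  fixes n :: nat
  assumes n: "n \<ge> 1" and H: "\<And>v. v \<in> V \<Longrightarrow> H v \<in> sets M" and V: "countable V" "V \<noteq> {}" and D: "D \<ge> 1"
    and growth: "\<And>(x::nat \<Rightarrow> 'a) J. finite J \<Longrightarrow>
      real (card ((\<lambda>v. {i\<in>J. x i \<in> H v}) ` V)) \<le> (exp 1 * (1 + 4 * real (card J) / real D)) ^ D"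
  shows "(\<integral>\<^sup>+x. (SUP v\<in>V. ennreal (deviation n M (H v) x)) \<partial>Pi\<^sub>M {..<n} (\<lambda>_. M))
    \<le> ennreal (68 * sqrt (real n * real D))"
proof -
  let ?K = "{..<2 * n}"
  let ?P = "Pi\<^sub>M ?K (\<lambda>_::nat. M)"
  interpret P: prob_space ?P by (rule prob_space_PiM) (rule prob_space_axioms)
  define f where "f s \<omega> = (SUP v\<in>V. ennreal \<bar>\<Sum>i<n. s i * (indicator (H v) (\<omega> i) - indicator (H v) (\<omega> (n + i)))\<bar>)"
    for s :: "nat \<Rightarrow> real" and \<omega>
  have meas: "f s \<in> borel_measurable ?P" for s
    unfolding f_def
    by (intro borel_measurable_SUP V measurable_compose[OF _ measurable_ennreal] borel_measurable_abs borel_measurable_sum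
      borel_measurable_times borel_measurable_const
      borel_measurable_diff borel_measurable_indicator_component H)
      auto
  \<comment> \<open>Exchangeability: flipping the sign of a difference is the same as swapping its
    two independent, identically distributed points.\<close>
  have swap: "(\<integral>\<^sup>+\<omega>. f (\<lambda>_. 1) \<omega> \<partial>?P) = (\<integral>\<^sup>+\<omega>. f s \<omega> \<partial>?P)" if s: "s \<in> signs {..<n}" for s
  proof -
    let ?t = "\<lambda>\<omega>. \<lambda>i\<in>?K. \<omega> (swap_index n s i)"
    have "inj_on (swap_index n s) ?K"
      by (rule inj_on_inverseI[of _ "swap_index n s"]) (auto simp: swap_index_involution)
    moreover have into: "swap_index n s \<in> ?K \<rightarrow> ?K" by (auto simp: swap_index_less)
    ultimately have d: "distr ?P ?P ?t = ?P"
      using distr_PiM_reindex[of ?K "\<lambda>_. M" "swap_index n s" ?K] prob_space_axioms by simp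
    have t: "?t \<in> ?P \<rightarrow>\<^sub>M ?P"
      using into by (intro measurable_restrict measurable_component_singleton) auto
    have "(\<integral>\<^sup>+\<omega>. f (\<lambda>_. 1) \<omega> \<partial>?P) = (\<integral>\<^sup>+\<omega>. f (\<lambda>_. 1) \<omega> \<partial>distr ?P ?P ?t)" by (simp only: d)
    also have "\<dots> = (\<integral>\<^sup>+\<omega>. f (\<lambda>_. 1) (?t \<omega>) \<partial>?P)"
      by (rule nn_integral_distr[OF t]) (simp add: meas)
    also have "\<dots> = (\<integral>\<^sup>+\<omega>. f s \<omega> \<partial>?P)"
    proof (rule nn_integral_cong)
      fix \<omega>
      have "1 * (indicator (H v) (?t \<omega> i) - indicator (H v) (?t \<omega> (n + i)))
        = s i * (indicator (H v) (\<omega> i) - indicator (H v) (\<omega> (n + i)) :: real)" if "i < n" for v i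
      proof -
        have "s i = 1 \<or> s i = -1" using s that by (auto simp: signs_def PiE_iff)
        then show ?thesis using that by (auto simp: swap_index_def)
      qed
      then show "f (\<lambda>_. 1) (?t \<omega>) = f s \<omega>" unfolding f_def by (auto intro!: SUP_cong sum.cong arg_cong[where f=ennreal] arg_cong[where f=abs])
    qed
    finally show ?thesis .
  qed
  have pointwise: "(\<Sum>s\<in>signs {..<n}. f s \<omega>) \<le> ennreal (2 ^ n * (68 * sqrt (real n * real D)))" for \<omega>
  proof -
    have "(\<Sum>s\<in>signs {..<n}. f s \<omega>) \<le> (\<Sum>s\<in>signs {..<n}.
      (SUP v\<in>V. ennreal \<bar>\<Sum>i<n. s i * indicator (H v) (\<omega> i)\<bar>)
      + (SUP v\<in>V. ennreal \<bar>\<Sum>i<n. s i * indicator (H v) (\<omega> (n + i))\<bar>))"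
      unfolding f_def
    proof (intro sum_mono SUP_least)
      fix s :: "nat \<Rightarrow> real" and v assume v: "v \<in> V"
      have "\<bar>\<Sum>i<n. s i * (indicator (H v) (\<omega> i) - indicator (H v) (\<omega> (n + i)))\<bar>
        \<le> \<bar>\<Sum>i<n. s i * indicator (H v) (\<omega> i)\<bar> + \<bar>\<Sum>i<n. s i * indicator (H v) (\<omega> (n + i))\<bar>"
        unfolding right_diff_distrib sum_subtractf by (rule abs_triangle_ineq4)
      then have "ennreal \<bar>\<Sum>i<n. s i * (indicator (H v) (\<omega> i) - indicator (H v) (\<omega> (n + i)))\<bar>
        \<le> ennreal \<bar>\<Sum>i<n. s i * indicator (H v) (\<omega> i)\<bar> + ennreal \<bar>\<Sum>i<n. s i * indicator (H v) (\<omega> (n + i))\<bar>"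
        by (simp add: ennreal_leI flip: ennreal_plus)
      also have "\<dots> \<le> (SUP v\<in>V. ennreal \<bar>\<Sum>i<n. s i * indicator (H v) (\<omega> i)\<bar>)
        + (SUP v\<in>V. ennreal \<bar>\<Sum>i<n. s i * indicator (H v) (\<omega> (n + i))\<bar>)"
        using v by (intro add_mono SUP_upper)
      finally show "ennreal \<bar>\<Sum>i<n. s i * (indicator (H v) (\<omega> i) - indicator (H v) (\<omega> (n + i)))\<bar> \<le> \<dots>" .
    qed
    also have "\<dots> \<le> ennreal (2 ^ n * (34 * sqrt (real n * real D))) + ennreal (2 ^ n * (34 * sqrt (real n * real D)))"
      unfolding sum.distrib
      by (intro add_mono signs_sum_SUP_le[where x="\<lambda>i. \<omega> i"] signs_sum_SUP_le[where x="\<lambda>i. \<omega> (n + i)"] n V D growth)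
    also have "\<dots> = ennreal (2 ^ n * (68 * sqrt (real n * real D)))"
      by (simp flip: ennreal_plus)
    finally show ?thesis .
  qed
  \<comment> \<open>Averaging over signs is done by adding up the 2^n equal integrals, and the bound
    on the sum is available for every fixed doubled sample.\<close>
  have "ennreal (2 ^ n) * (\<integral>\<^sup>+\<omega>. f (\<lambda>_. 1) \<omega> \<partial>?P) = (\<Sum>s\<in>signs {..<n}. (\<integral>\<^sup>+\<omega>. f (\<lambda>_. 1) \<omega> \<partial>?P))"
    by (simp add: card_signs ennreal_power flip: ennreal_numeral)
  also have "\<dots> = (\<Sum>s\<in>signs {..<n}. (\<integral>\<^sup>+\<omega>. f s \<omega> \<partial>?P))"
    by (rule sum.cong[OF refl swap])
  also have "\<dots> = (\<integral>\<^sup>+\<omega>. (\<Sum>s\<in>signs {..<n}. f s \<omega>) \<partial>?P)"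
    by (rule nn_integral_sum[symmetric]) (rule meas)
  also have "\<dots> \<le> (\<integral>\<^sup>+\<omega>. ennreal (2 ^ n * (68 * sqrt (real n * real D))) \<partial>?P)"
    by (rule nn_integral_mono) (rule pointwise)
  also have "\<dots> = ennreal (2 ^ n) * ennreal (68 * sqrt (real n * real D))"
    by (simp add: P.emeasure_space_1 flip: ennreal_mult)
  finally have "(\<integral>\<^sup>+\<omega>. f (\<lambda>_. 1) \<omega> \<partial>?P) \<le> ennreal (68 * sqrt (real n * real D))"
    by (subst (asm) ennreal_mult_le_mult_iff) auto
  with nn_integral_deviation_le_ghost[where n = n and H = H and V = V, OF H V(1)] show ?thesis
    unfolding f_def by simp
qed

text \<open>Markov's inequality applied to the supremum. Countability of \<open>V\<close> makes the
  supremum and the good set measurable.\<close>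

corollary uniform_deviation:
  fixes n :: nat
  assumes n: "n \<ge> 1" and H: "\<And>v. v \<in> V \<Longrightarrow> H v \<in> sets M" and V: "countable V" "V \<noteq> {}" and D: "D \<ge> 1"
    and growth: "\<And>(x::nat \<Rightarrow> 'a) J. finite J \<Longrightarrow>
      real (card ((\<lambda>v. {i\<in>J. x i \<in> H v}) ` V)) \<le> (exp 1 * (1 + 4 * real (card J) / real D)) ^ D"
    and a: "a > 0"
  defines "G \<equiv> {x\<in>space (Pi\<^sub>M {..<n} (\<lambda>_. M)). \<forall>v\<in>V. deviation n M (H v) x < 68 * sqrt (real n * real D) / a}"
  shows "G \<in> sets (Pi\<^sub>M {..<n} (\<lambda>_. M))" "measure (Pi\<^sub>M {..<n} (\<lambda>_. M)) G \<ge> 1 - a"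
proof -
  let ?P = "Pi\<^sub>M {..<n} (\<lambda>_. M)"
  interpret P: prob_space ?P by (rule prob_space_PiM) (rule prob_space_axioms)
  define b where "b = 68 * sqrt (real n * real D)"
  have b: "b > 0" using n D by (simp add: b_def)
  have md: "deviation n M (H v) \<in> borel_measurable ?P" if "v \<in> V" for v
    unfolding deviation_def
    by (intro borel_measurable_abs borel_measurable_sum
      borel_measurable_diff borel_measurable_const borel_measurable_indicator_component H that)
      auto
  show G: "G \<in> sets ?P"
  proof -
    have "G = (\<Inter>v\<in>V. {x\<in>space ?P. deviation n M (H v) x < 68 * sqrt (real n * real D) / a})"
      using V(2) by (auto simp: G_def)
    also have "\<dots> \<in> sets ?P"
      using md by (intro sets.countable_INT' V image_subsetI borel_measurable_less borel_measurable_const) auto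
    finally show ?thesis .
  qed
  define u where "u x = (SUP v\<in>V. ennreal (deviation n M (H v) x))" for x
  have mu[measurable]: "u \<in> borel_measurable ?P"
    unfolding u_def using md by (intro borel_measurable_SUP V measurable_compose[OF _ measurable_ennreal]) auto
  have sub: "space ?P - G \<subseteq> {x\<in>space ?P. 1 \<le> ennreal (a / b) * u x}"
  proof
    fix x assume "x \<in> space ?P - G"
    then obtain v where v: "v \<in> V" "b / a \<le> deviation n M (H v) x" and x: "x \<in> space ?P"
      by (auto simp: G_def b_def not_less)
    have "1 = ennreal (a / b) * ennreal (b / a)" using a b by (simp flip: ennreal_mult)
    also have "\<dots> \<le> ennreal (a / b) * u x"
      unfolding u_def using v by (intro mult_left_mono SUP_upper2[OF v(1)] ennreal_leI) auto
    finally show "x \<in> {x\<in>space ?P. 1 \<le> ennreal (a / b) * u x}" using x by simp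
  qed
  have "emeasure ?P (space ?P - G) \<le> emeasure ?P {x\<in>space ?P. 1 \<le> ennreal (a / b) * u x}"
    by (intro emeasure_mono[OF sub]) measurable
  also have "\<dots> \<le> ennreal (a / b) * (\<integral>\<^sup>+x. u x * indicator (space ?P) x \<partial>?P)"
    by (rule nn_integral_Markov_inequality) (use mu in auto)
  also have "(\<integral>\<^sup>+x. u x * indicator (space ?P) x \<partial>?P) = (\<integral>\<^sup>+x. u x \<partial>?P)"
    by (rule nn_integral_cong) auto
  also have "ennreal (a / b) * \<dots> \<le> ennreal (a / b) * ennreal b"
    unfolding b_def u_def by (intro mult_left_mono nn_integral_SUP_deviation_le[OF n H V D growth]) auto
  also have "\<dots> = ennreal a" using a b by (simp flip: ennreal_mult)
  finally have "measure ?P (space ?P - G) \<le> a" using a by (simp add: P.emeasure_eq_measure)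
  then show "measure ?P G \<ge> 1 - a" using P.prob_compl[OF G] by linarith
qed

end

section \<open>The generalized Gaussian law\<close>

text \<open>Of the two factors 1 + t^2, one is spent on integrability through 1 / (1 + t^2) and the
  other dominates the t^2 of the moment in \<open>gg_moment_finite\<close>. The exponent 1/4 is what
  is left of the density exponent 1/2 after multiplying by exp(\<bar>t\<bar>^\<gamma> / 4).\<close>

lemma ex_poly_exp_bound:
  fixes \<gamma> :: real
  assumes "\<gamma> > 0"
  shows "\<exists>B>0. \<forall>t. (1 + t\<^sup>2)\<^sup>2 * exp (- (\<bar>t\<bar> powr \<gamma>) / 4) \<le> B"
proof -
  \<comment> \<open>With u = \<bar>t\<bar>^\<gamma> \<ge> 1 this gives t^4 = u^(4/\<gamma>) \<le>
    u^m, an integer power that (1 + x/m)^m \<le> exp(x) can handle.\<close>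
  define m where "m = nat \<lceil>4 / \<gamma>\<rceil>"
  have "4 / \<gamma> > 0" using assms by simp
  then have m: "real m \<ge> 4 / \<gamma>" "m > 0" unfolding m_def by linarith+
  define B where "B = 4 + 4 * (4 * real m) ^ m"
  have "(1 + t\<^sup>2)\<^sup>2 * exp (- (\<bar>t\<bar> powr \<gamma>) / 4) \<le> B" for t :: real
  proof (cases "\<bar>t\<bar> \<le> 1")
    case True
    then have "1 + t\<^sup>2 \<le> 2" using abs_le_square_iff[of t 1] by simp
    then have "(1 + t\<^sup>2)\<^sup>2 \<le> 2\<^sup>2" by (rule power_mono) simp
    moreover have "exp (- (\<bar>t\<bar> powr \<gamma>) / 4) \<le> 1" by simp
    ultimately have "(1 + t\<^sup>2)\<^sup>2 * exp (- (\<bar>t\<bar> powr \<gamma>) / 4) \<le> 4 * 1" by (intro mult_mono) auto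
    moreover have "(4 * real m) ^ m \<ge> 0" by simp
    ultimately show ?thesis unfolding B_def by linarith
  next
    case False
    define u where "u = \<bar>t\<bar> powr \<gamma>"
    have t1: "\<bar>t\<bar> \<ge> 1" using False by simp
    have u1: "u \<ge> 1" unfolding u_def using t1 assms by (simp add: ge_one_powr_ge_zero)
    have "1 \<le> t\<^sup>2" using t1 abs_le_square_iff[of 1 t] by simp
    then have "(1 + t\<^sup>2)\<^sup>2 \<le> (2 * t\<^sup>2)\<^sup>2" by (intro power_mono) auto
    also have "(2 * t\<^sup>2)\<^sup>2 = 4 * \<bar>t\<bar> ^ 4" by (simp add: power_mult_distrib flip: power_mult)
    also have "\<bar>t\<bar> ^ 4 = \<bar>t\<bar> powr 4" using t1 by (subst powr_numeral) auto
    also have "\<bar>t\<bar> powr 4 = u powr (4 / \<gamma>)" unfolding u_def using assms by (simp add: powr_powr)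
    also have "u powr (4 / \<gamma>) \<le> u powr real m" by (rule powr_mono[OF m(1) u1])
    also have "u powr real m = u ^ m" using u1 by (simp add: powr_realpow)
    also have "u ^ m \<le> (4 * real m) ^ m * exp (u / 4)"
    proof -
      have "u ^ m = (4 * real m) ^ m * (u / 4 / real m) ^ m"
        using m by (simp add: power_mult_distrib power_divide)
      also have "(u / 4 / real m) ^ m \<le> (1 + (u / 4) / real m) ^ m"
        using u1 by (intro power_mono) auto
      also have "\<dots> \<le> exp (u / 4)"
        using u1 m by (intro exp_ge_one_plus_x_over_n_power_n) auto
      finally show ?thesis by (simp add: mult_left_mono)
    qed
    finally have "(1 + t\<^sup>2)\<^sup>2 \<le> 4 * ((4 * real m) ^ m * exp (u / 4))" by simp
    then have "(1 + t\<^sup>2)\<^sup>2 * exp (- u / 4) \<le> 4 * ((4 * real m) ^ m * exp (u / 4)) * exp (- u / 4)"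
      by (rule mult_right_mono) simp
    also have "\<dots> = 4 * (4 * real m) ^ m" by (simp add: exp_minus)
    finally show ?thesis by (simp add: B_def u_def)
  qed
  moreover have "B > 0" by (simp add: B_def add_pos_nonneg)
  ultimately show ?thesis by blast
qed

lemma nn_integral_inverse_one_plus_square_le:
  "(\<integral>\<^sup>+x. ennreal (inverse (1 + x\<^sup>2)) \<partial>lborel) \<le> ennreal pi"
proof -
  let ?f = "\<lambda>x::real. ennreal (inverse (1 + x\<^sup>2))"
  have pos: "(\<integral>\<^sup>+x. ?f x * indicator {0..} x \<partial>lborel) = ennreal (pi / 2)"
    by (subst nn_integral_FTC_atLeast[where F = arctan and T = "pi / 2"])
      (auto intro!: DERIV_arctan tendsto_arctan_at_top)
  have "(\<integral>\<^sup>+x. ?f x \<partial>lborel) \<le> (\<integral>\<^sup>+x. ?f x * indicator {0..} x + ?f x * indicator {..0} x \<partial>lborel)"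
    by (rule nn_integral_mono) (auto simp: indicator_def)
  also have "\<dots> = (\<integral>\<^sup>+x. ?f x * indicator {0..} x \<partial>lborel) + (\<integral>\<^sup>+x. ?f x * indicator {..0} x \<partial>lborel)"
    by (rule nn_integral_add) auto
  also have "(\<integral>\<^sup>+x. ?f x * indicator {..0} x \<partial>lborel) = (\<integral>\<^sup>+x. ?f x * indicator {0..} x \<partial>lborel)"
    by (subst nn_integral_real_affine[where c = "-1" and t = 0])
      (auto intro!: nn_integral_cong simp: indicator_def)
  also note pos
  also have "ennreal (pi / 2) + ennreal (pi / 2) = ennreal pi" by (simp flip: ennreal_plus)
  finally show ?thesis .
qed

section \<open>The one-dimensional projection law: normalisation, exponential moment and
  tails\<close>

definition gg_mass :: "real \<Rightarrow> ennreal" where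
  "gg_mass \<gamma> = (\<integral>\<^sup>+t. ennreal (exp (- (\<bar>t\<bar> powr \<gamma>) / 2)) \<partial>lborel)"

definition gg_const :: "real \<Rightarrow> real" where
  "gg_const \<gamma> = 1 / enn2real (gg_mass \<gamma>)"

definition gg_density :: "real \<Rightarrow> real \<Rightarrow> real" where
  "gg_density \<gamma> t = gg_const \<gamma> * exp (- (\<bar>t\<bar> powr \<gamma>) / 2)"

definition gg_law :: "real \<Rightarrow> real measure" where
  "gg_law \<gamma> = density lborel (\<lambda>t. ennreal (gg_density \<gamma> t))"

definition gg_tail :: "real \<Rightarrow> real \<Rightarrow> real" where
  "gg_tail \<gamma> t = measure (gg_law \<gamma>) {s. t \<le> \<bar>s\<bar>}"

lemma borel_measurable_gg_density [measurable]: "gg_density \<gamma> \<in> borel_measurable borel"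
  unfolding gg_density_def by measurable

lemma sets_gg_law [simp, measurable_cong]: "sets (gg_law \<gamma>) = sets borel"
  and space_gg_law [simp]: "space (gg_law \<gamma>) = UNIV"
  by (auto simp: gg_law_def)

lemma log_factor_ge_1:
  assumes "n \<ge> 1" "p \<ge> 1"
  shows "log_factor n p \<epsilon> \<ge> 1"
proof -
  have "ln (exp 1) \<le> ln (real n * \<epsilon>\<^sup>2 / real p + exp (1::real))"
    by (subst ln_le_cancel_iff) (auto simp: add_nonneg_pos)
  then show ?thesis by (simp add: log_factor_def)
qed

context
  fixes \<gamma> :: real
  assumes \<gamma>: "\<gamma> > 0"
begin

lemma gg_normalizer:
  "0 < gg_mass \<gamma>"
  "gg_mass \<gamma> < \<infinity>"
proof -
  have "0 < ennreal (exp (- 1 / 2)) * emeasure lborel {0..1::real}" by (simp add: ennreal_zero_less_mult_iff)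
  also have "\<dots> = (\<integral>\<^sup>+t. ennreal (exp (- 1 / 2)) * indicator {0..1::real} t \<partial>lborel)"
    by (simp add: nn_integral_cmult)
  also have "\<dots> \<le> gg_mass \<gamma>"
    unfolding gg_mass_def
  proof (rule nn_integral_mono)
    fix t :: real
    show "ennreal (exp (- 1 / 2)) * indicator {0..1} t \<le> ennreal (exp (- (\<bar>t\<bar> powr \<gamma>) / 2))"
    proof (cases "t \<in> {0..1}")
      case True
      then have "\<bar>t\<bar> powr \<gamma> \<le> 1 powr \<gamma>" using \<gamma> by (intro powr_mono2) auto
      then show ?thesis using True by (simp add: ennreal_leI)
    qed auto
  qed
  finally show "0 < gg_mass \<gamma>" .
  obtain B where B: "B > 0" "\<And>t. (1 + t\<^sup>2)\<^sup>2 * exp (- (\<bar>t\<bar> powr \<gamma>) / 4) \<le> B"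
    using ex_poly_exp_bound[OF \<gamma>] by blast
  have "gg_mass \<gamma> \<le> (\<integral>\<^sup>+t. ennreal B * ennreal (inverse (1 + t\<^sup>2)) \<partial>lborel)"
    unfolding gg_mass_def
  proof (rule nn_integral_mono)
    fix t :: real
    have "(1 + t\<^sup>2) * exp (- (\<bar>t\<bar> powr \<gamma>) / 2) \<le> (1 + t\<^sup>2)\<^sup>2 * exp (- (\<bar>t\<bar> powr \<gamma>) / 4)"
      by (intro mult_mono) (auto simp: power2_eq_square mult_le_cancel_left1)
    also note B(2)[of t]
    finally show "ennreal (exp (- (\<bar>t\<bar> powr \<gamma>) / 2)) \<le> ennreal B * ennreal (inverse (1 + t\<^sup>2))"
      using B(1) by (subst ennreal_mult[symmetric]) (auto intro!: ennreal_leI simp: field_simps add_pos_nonneg)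
  qed
  also have "\<dots> = ennreal B * (\<integral>\<^sup>+t. ennreal (inverse (1 + t\<^sup>2)) \<partial>lborel)" by (rule nn_integral_cmult) auto
  also have "\<dots> \<le> ennreal B * ennreal pi" by (intro mult_left_mono nn_integral_inverse_one_plus_square_le) auto
  also have "\<dots> < \<infinity>" by (simp add: ennreal_mult_less_top)
  finally show "gg_mass \<gamma> < \<infinity>" .
qed

lemma gg_const_pos: "gg_const \<gamma> > 0"
  using gg_normalizer by (simp add: gg_const_def enn2real_positive_iff)

lemma gg_density_nonneg: "gg_density \<gamma> t \<ge> 0"
  and gg_density_le: "gg_density \<gamma> t \<le> gg_const \<gamma>"
  using gg_const_pos by (auto simp: gg_density_def mult_le_cancel_left2)

lemma prob_space_gg_law: "prob_space (gg_law \<gamma>)"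
proof
  define Z where "Z = gg_mass \<gamma>"
  have Z: "ennreal (enn2real Z) = Z" "enn2real Z > 0"
    using gg_normalizer by (auto simp: Z_def enn2real_positive_iff)
  have "emeasure (gg_law \<gamma>) UNIV = (\<integral>\<^sup>+t. ennreal (gg_density \<gamma> t) \<partial>lborel)"
    by (simp add: gg_law_def emeasure_density)
  also have "\<dots> = (\<integral>\<^sup>+t. ennreal (gg_const \<gamma>) * ennreal (exp (- (\<bar>t\<bar> powr \<gamma>) / 2)) \<partial>lborel)"
    using gg_const_pos by (intro nn_integral_cong) (simp add: gg_density_def ennreal_mult')
  also have "\<dots> = ennreal (gg_const \<gamma>) * Z" unfolding Z_def gg_mass_def by (rule nn_integral_cmult) auto
  also have "\<dots> = ennreal (1 / enn2real Z) * ennreal (enn2real Z)" by (simp only: Z gg_const_def Z_def[symmetric])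
  also have "\<dots> = 1" using Z(2) by (simp flip: ennreal_mult)
  finally show "emeasure (gg_law \<gamma>) (space (gg_law \<gamma>)) = 1" by simp
qed

interpretation G: prob_space "gg_law \<gamma>" by (rule prob_space_gg_law)

lemma nn_integral_gg_law:
  "f \<in> borel_measurable borel \<Longrightarrow> (\<integral>\<^sup>+t. f t \<partial>gg_law \<gamma>) = (\<integral>\<^sup>+t. ennreal (gg_density \<gamma> t) * f t \<partial>lborel)"
  unfolding gg_law_def by (rule nn_integral_density) auto

text \<open>Used for the lower bound: the exponential weight is there to compensate the factor n
  \<epsilon>^2 / p in the far tail, and t^2 is the squared signal.\<close>

lemma gg_moment_finite: "(\<integral>\<^sup>+t. ennreal (t\<^sup>2 * exp (\<bar>t\<bar> powr \<gamma> / 4)) \<partial>gg_law \<gamma>) < \<infinity>"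
proof -
  obtain B where B: "B > 0" "\<And>t. (1 + t\<^sup>2)\<^sup>2 * exp (- (\<bar>t\<bar> powr \<gamma>) / 4) \<le> B"
    using ex_poly_exp_bound[OF \<gamma>] by blast
  have "(\<integral>\<^sup>+t. ennreal (t\<^sup>2 * exp (\<bar>t\<bar> powr \<gamma> / 4)) \<partial>gg_law \<gamma>)
      = (\<integral>\<^sup>+t. ennreal (gg_density \<gamma> t) * ennreal (t\<^sup>2 * exp (\<bar>t\<bar> powr \<gamma> / 4)) \<partial>lborel)"
    by (rule nn_integral_gg_law) measurable
  also have "\<dots> \<le> (\<integral>\<^sup>+t. ennreal (gg_const \<gamma> * B) * ennreal (inverse (1 + t\<^sup>2)) \<partial>lborel)"
  proof (rule nn_integral_mono)
    fix t :: real
    define u where "u = \<bar>t\<bar> powr \<gamma>"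
    have e: "exp (- u / 2) * exp (u / 4) = exp (- u / 4)" by (simp flip: exp_add)
    have "t\<^sup>2 * exp (- u / 4) * (1 + t\<^sup>2) \<le> (1 + t\<^sup>2) * exp (- u / 4) * (1 + t\<^sup>2)"
      by (intro mult_right_mono) auto
    also have "\<dots> = (1 + t\<^sup>2)\<^sup>2 * exp (- u / 4)" by (simp add: power2_eq_square algebra_simps)
    also have "\<dots> \<le> B" using B(2)[of t] by (simp add: u_def)
    finally have "t\<^sup>2 * exp (- u / 4) \<le> B * inverse (1 + t\<^sup>2)"
      by (simp add: field_simps add_pos_nonneg)
    then have "gg_const \<gamma> * (t\<^sup>2 * exp (- u / 4)) \<le> gg_const \<gamma> * (B * inverse (1 + t\<^sup>2))"
      using gg_const_pos by (intro mult_left_mono) auto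
    moreover have "gg_density \<gamma> t * (t\<^sup>2 * exp (u / 4)) = gg_const \<gamma> * (t\<^sup>2 * exp (- u / 4))"
      unfolding e[symmetric] by (simp add: gg_density_def u_def)
    ultimately have "gg_density \<gamma> t * (t\<^sup>2 * exp (u / 4)) \<le> gg_const \<gamma> * B * inverse (1 + t\<^sup>2)"
      by (simp only: mult.assoc)
    then show "ennreal (gg_density \<gamma> t) * ennreal (t\<^sup>2 * exp (\<bar>t\<bar> powr \<gamma> / 4))
        \<le> ennreal (gg_const \<gamma> * B) * ennreal (inverse (1 + t\<^sup>2))"
      using gg_density_nonneg gg_const_pos B(1)
      by (simp add: u_def ennreal_leI flip: ennreal_mult)
  qed
  also have "\<dots> = ennreal (gg_const \<gamma> * B) * (\<integral>\<^sup>+t. ennreal (inverse (1 + t\<^sup>2)) \<partial>lborel)" by (rule nn_integral_cmult) auto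
  also have "\<dots> \<le> ennreal (gg_const \<gamma> * B) * ennreal pi" by (intro mult_left_mono nn_integral_inverse_one_plus_square_le) auto
  also have "\<dots> < \<infinity>" by (simp add: ennreal_mult_less_top)
  finally show ?thesis .
qed

text \<open>The proportionality factor in \<open>generalized_gaussian\<close> may a priori vary with
  the direction. Total mass one forces it to be \<open>gg_const \<gamma>\<close>, so every constant
  derived from \<open>gg_law\<close> depends on \<gamma> alone and not on p, the direction or
  \<mu>.\<close>

lemma distr_generalized_gaussian:
  assumes \<mu>: "generalized_gaussian \<gamma> p \<mu>" and v: "v \<in> unit_sphere p"
  shows "distr \<mu> borel (dot p v) = gg_law \<gamma>" "dot p v \<in> borel_measurable \<mu>"
proof -
  obtain k where k: "k > 0" "distributed \<mu> lborel (dot p v) (\<lambda>t. ennreal (k * exp (- (\<bar>t\<bar> powr \<gamma>) / 2)))"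
    using \<mu> v by (auto simp: generalized_gaussian_def)
  have prob: "prob_space \<mu>" using \<mu> by (simp add: generalized_gaussian_def)
  define Z where "Z = gg_mass \<gamma>"
  have Z: "ennreal (enn2real Z) = Z" "enn2real Z > 0"
    using gg_normalizer by (auto simp: Z_def enn2real_positive_iff)
  have "1 = (\<integral>\<^sup>+x. 1 \<partial>\<mu>)" using prob_space.emeasure_space_1[OF prob] by simp
  also have "\<dots> = (\<integral>\<^sup>+t. ennreal (k * exp (- (\<bar>t\<bar> powr \<gamma>) / 2)) * 1 \<partial>lborel)"
    by (rule distributed_nn_integral[OF k(2), symmetric]) simp
  also have "\<dots> = (\<integral>\<^sup>+t. ennreal k * ennreal (exp (- (\<bar>t\<bar> powr \<gamma>) / 2)) \<partial>lborel)"
    using k(1) by (intro nn_integral_cong) (simp add: ennreal_mult')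
  also have "\<dots> = ennreal k * Z" unfolding Z_def gg_mass_def by (rule nn_integral_cmult) auto
  also have "\<dots> = ennreal (k * enn2real Z)" using Z k(1) by (simp add: ennreal_mult')
  finally have "k * enn2real Z = 1" by (metis ennreal_1 ennreal_inj Z(2) k(1) mult_nonneg_nonneg less_imp_le zero_le_one)
  then have "k = gg_const \<gamma>" using Z(2) by (simp add: gg_const_def Z_def field_simps)
  with distributed_distr_eq_density[OF k(2)] have "distr \<mu> lborel (dot p v) = gg_law \<gamma>"
    by (simp add: gg_law_def gg_density_def)
  moreover have "distr \<mu> lborel (dot p v) = distr \<mu> borel (dot p v)"
    by (rule distr_cong) auto
  ultimately show "distr \<mu> borel (dot p v) = gg_law \<gamma>" by simp
  show "dot p v \<in> borel_measurable \<mu>" using k(2) by (auto simp: distributed_def)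
qed

lemma nn_integral_generalized_gaussian:
  assumes \<mu>: "generalized_gaussian \<gamma> p \<mu>" and v: "v \<in> unit_sphere p" and f: "f \<in> borel_measurable borel"
  shows "(\<integral>\<^sup>+x. f (dot p v x) \<partial>\<mu>) = (\<integral>\<^sup>+t. f t \<partial>gg_law \<gamma>)"
  unfolding distr_generalized_gaussian(1)[OF \<mu> v, symmetric]
  using distr_generalized_gaussian(2)[OF \<mu> v] f by (simp add: nn_integral_distr)

lemma measure_gg_law_Icc_le:
  assumes "a \<le> b"
  shows "measure (gg_law \<gamma>) {a..b} \<le> gg_const \<gamma> * (b - a)"
proof -
  have "emeasure (gg_law \<gamma>) {a..b} = (\<integral>\<^sup>+t. ennreal (gg_density \<gamma> t) * indicator {a..b} t \<partial>lborel)"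
    by (simp add: gg_law_def emeasure_density)
  also have "\<dots> \<le> (\<integral>\<^sup>+t. ennreal (gg_const \<gamma>) * indicator {a..b} t \<partial>lborel)"
    by (intro nn_integral_mono mult_right_mono ennreal_leI gg_density_le) auto
  also have "\<dots> = ennreal (gg_const \<gamma> * (b - a))"
    using assms gg_const_pos by (simp add: nn_integral_cmult ennreal_mult')
  finally show ?thesis using assms gg_const_pos by (simp add: G.emeasure_eq_measure)
qed

text \<open>The bounded density leaves no atoms; this reconciles the strict thresholds of depth
  events with the weak one in \<open>gg_tail\<close>.\<close>

lemma gg_tail_strict: "emeasure (gg_law \<gamma>) {s. t < \<bar>s\<bar>} = ennreal (gg_tail \<gamma> t)"
proof -
  have "measure (gg_law \<gamma>) {a} = 0" for a
    using measure_gg_law_Icc_le[of a a] by (simp add: measure_le_0_iff)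
  then have "measure (gg_law \<gamma>) {t, -t} \<le> 0"
    using measure_Un_le[of "{t}" "gg_law \<gamma>" "{-t}"] by (simp add: insert_commute)
  moreover have "gg_tail \<gamma> t \<le> measure (gg_law \<gamma>) ({s. t < \<bar>s\<bar>} \<union> {t, -t})"
    unfolding gg_tail_def by (rule G.finite_measure_mono) auto
  moreover have "\<dots> \<le> measure (gg_law \<gamma>) {s. t < \<bar>s\<bar>} + measure (gg_law \<gamma>) {t, -t}"
    by (rule measure_Un_le) auto
  moreover have "measure (gg_law \<gamma>) {s. t < \<bar>s\<bar>} \<le> gg_tail \<gamma> t"
    unfolding gg_tail_def by (rule G.finite_measure_mono) auto
  ultimately have "measure (gg_law \<gamma>) {s. t < \<bar>s\<bar>} = gg_tail \<gamma> t" by linarith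
  then show ?thesis by (simp add: G.emeasure_eq_measure)
qed

text \<open>The price of lowering the threshold, paid for by choosing the gap small compared with
  the sampling error.\<close>

lemma gg_tail_le:
  assumes "t' \<le> t"
  shows "gg_tail \<gamma> t' \<le> gg_tail \<gamma> t + 2 * gg_const \<gamma> * (t - t')"
proof -
  have "gg_tail \<gamma> t' \<le> measure (gg_law \<gamma>) ({s. t \<le> \<bar>s\<bar>} \<union> ({t'..t} \<union> {-t..-t'}))"
    unfolding gg_tail_def by (rule G.finite_measure_mono) auto
  also have "\<dots> \<le> gg_tail \<gamma> t + measure (gg_law \<gamma>) ({t'..t} \<union> {-t..-t'})"
    unfolding gg_tail_def by (rule measure_Un_le) auto
  also have "measure (gg_law \<gamma>) ({t'..t} \<union> {-t..-t'})
      \<le> measure (gg_law \<gamma>) {t'..t} + measure (gg_law \<gamma>) {-t..-t'}"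
    by (rule measure_Un_le) auto
  also have "\<dots> \<le> gg_const \<gamma> * (t - t') + gg_const \<gamma> * (- t' - - t)"
    using assms by (intro add_mono measure_gg_law_Icc_le) auto
  finally show ?thesis by (simp add: algebra_simps)
qed

lemma gg_tail_ge:
  assumes t: "t \<ge> 0"
  shows "gg_const \<gamma> * (2 powr (1 / \<gamma>) - 1) * t * exp (- (t powr \<gamma>)) \<le> gg_tail \<gamma> t"
proof -
  \<comment> \<open>The largest factor for which \<bar>s\<bar>^\<gamma> / 2 \<le> t^\<gamma>
    throughout [t, a t], so the density is at least
    \<open>gg_const \<gamma> * exp (- (t powr \<gamma>))\<close> there.\<close>
  define a where "a = 2 powr (1 / \<gamma>)"
  have a: "a \<ge> 1" "a powr \<gamma> = 2" using \<gamma> by (auto simp: a_def powr_powr ge_one_powr_ge_zero)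
  have ta: "t \<le> a * t" using a t by (simp add: mult_le_cancel_right1)
  have "ennreal (gg_const \<gamma> * exp (- (t powr \<gamma>)) * (a * t - t)) =
      (\<integral>\<^sup>+s. ennreal (gg_const \<gamma> * exp (- (t powr \<gamma>))) * indicator {t..a * t} s \<partial>lborel)"
    using ta gg_const_pos by (simp add: nn_integral_cmult ennreal_mult')
  also have "\<dots> \<le> (\<integral>\<^sup>+s. ennreal (gg_density \<gamma> s) * indicator {t..a * t} s \<partial>lborel)"
  proof (rule nn_integral_mono)
    fix s
    have "\<bar>s\<bar> powr \<gamma> / 2 \<le> t powr \<gamma>" if "s \<in> {t..a * t}"
    proof -
      have "\<bar>s\<bar> powr \<gamma> \<le> (a * t) powr \<gamma>" using that t \<gamma> by (intro powr_mono2) auto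
      also have "\<dots> = 2 * t powr \<gamma>" using a t by (simp add: powr_mult)
      finally show ?thesis by simp
    qed
    then show "ennreal (gg_const \<gamma> * exp (- (t powr \<gamma>))) * indicator {t..a * t} s
        \<le> ennreal (gg_density \<gamma> s) * indicator {t..a * t} s"
      using gg_const_pos by (auto simp: indicator_def gg_density_def intro!: ennreal_leI)
  qed
  also have "\<dots> = emeasure (gg_law \<gamma>) {t..a * t}" by (simp add: gg_law_def emeasure_density)
  also have "\<dots> \<le> emeasure (gg_law \<gamma>) {s. t \<le> \<bar>s\<bar>}" by (rule emeasure_mono) (use t in auto)
  also have "\<dots> = ennreal (gg_tail \<gamma> t)" by (simp add: gg_tail_def G.emeasure_eq_measure)
  finally have "gg_const \<gamma> * exp (- (t powr \<gamma>)) * (a * t - t) \<le> gg_tail \<gamma> t"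
    by (simp add: gg_tail_def)
  then show ?thesis by (simp add: a_def algebra_simps)
qed

lemma emeasure_generalized_gaussian_tail:
  assumes "generalized_gaussian \<gamma> p \<mu>" "v \<in> unit_sphere p"
  shows "(\<integral>\<^sup>+x. indicator {s. t < \<bar>s\<bar>} (dot p v x) \<partial>\<mu>) = ennreal (gg_tail \<gamma> t)"
  using assms by (subst nn_integral_generalized_gaussian) (auto simp: gg_tail_strict)

lemma truncation_level_ge:
  assumes "n \<ge> 1" "p \<ge> 1"
  shows "truncation_level \<gamma> n p \<epsilon> = (1 / 3) powr (1 / \<gamma>) * log_factor n p \<epsilon> powr (1 / \<gamma>)"
    and "truncation_level \<gamma> n p \<epsilon> \<ge> (1 / 3) powr (1 / \<gamma>)"
proof -
  have L: "log_factor n p \<epsilon> \<ge> 1" by (rule log_factor_ge_1[OF assms])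
  show eq: "truncation_level \<gamma> n p \<epsilon> = (1 / 3) powr (1 / \<gamma>) * log_factor n p \<epsilon> powr (1 / \<gamma>)"
    unfolding truncation_level_def using L by (subst powr_mult[symmetric]) auto
  have "log_factor n p \<epsilon> powr (1 / \<gamma>) \<ge> 1" using L \<gamma> by (simp add: ge_one_powr_ge_zero)
  then show "truncation_level \<gamma> n p \<epsilon> \<ge> (1 / 3) powr (1 / \<gamma>)" unfolding eq by (simp add: mult_le_cancel_left1)
qed

text \<open>
  The factor 1/3 in the truncation level makes the tail probability at least of the order of
  \<open>(n \<epsilon>\<^sup>2 / p + e)\<^sup>-\<^sup>1\<^sup>/\<^sup>3\<close>, hence the sampling error divided by it is at most of order \<open>\<epsilon> + sqrt (p / n)\<close>.
\<close>

lemma ex_gg_tail_truncation_ge: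
  "\<exists>\<kappa>>0. \<forall>n p \<epsilon>. n \<ge> 1 \<longrightarrow> p \<ge> 1 \<longrightarrow> \<epsilon> \<ge> 0 \<longrightarrow>
    \<kappa> * sqrt (real p / real n) \<le> gg_tail \<gamma> (truncation_level \<gamma> n p \<epsilon>) * (\<epsilon> + 2 * sqrt (real p / real n))"
proof -
  define t0 where "t0 = (1 / 3 :: real) powr (1 / \<gamma>)"
  define \<kappa> where "\<kappa> = gg_const \<gamma> * (2 powr (1 / \<gamma>) - 1) * t0"
  have two: "2 powr (1 / \<gamma>) > (1::real)" using \<gamma> by (simp add: gr_one_powr)
  then have k: "\<kappa> > 0" using gg_const_pos by (simp add: \<kappa>_def t0_def)
  moreover have "\<kappa> * sqrt (real p / real n) \<le> gg_tail \<gamma> (truncation_level \<gamma> n p \<epsilon>) * (\<epsilon> + 2 * sqrt (real p / real n))"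
    if np: "n \<ge> 1" "p \<ge> 1" and e: "\<epsilon> \<ge> 0" for n p \<epsilon>
  proof -
    define t where "t = truncation_level \<gamma> n p \<epsilon>"
    define x where "x = real n * \<epsilon>\<^sup>2 / real p"
    have x: "x \<ge> 0" by (simp add: x_def)
    have xe: "x + exp 1 > 0" "x + exp 1 \<ge> 1" using x exp_ge_add_one_self[of 1] by linarith+
    have t0: "t \<ge> t0" "t0 > 0" using truncation_level_ge(2)[OF np] by (auto simp: t_def t0_def)
    have L: "log_factor n p \<epsilon> = ln (x + exp 1)" by (simp add: log_factor_def x_def)
    have "t powr \<gamma> = log_factor n p \<epsilon> / 3"
      using log_factor_ge_1[OF np, of \<epsilon>] \<gamma> by (simp add: t_def truncation_level_def powr_powr)
    then have ex: "exp (- (t powr \<gamma>)) = (x + exp 1) powr (- 1 / 3)"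
      using xe by (simp add: L powr_def)
    have "\<kappa> * (x + exp 1) powr (- 1 / 3) \<le> gg_const \<gamma> * (2 powr (1 / \<gamma>) - 1) * t * exp (- (t powr \<gamma>))"
      unfolding ex \<kappa>_def using t0 gg_const_pos two by (intro mult_mono mult_nonneg_nonneg) auto
    also have "\<dots> \<le> gg_tail \<gamma> t" using t0 by (intro gg_tail_ge) auto
    finally have tail: "\<kappa> * (x + exp 1) powr (- 1 / 3) \<le> gg_tail \<gamma> t" .
    have "1 = (x + exp 1) powr (- 1 / 3) * (x + exp 1) powr (1 / 3)"
      using xe by (simp flip: powr_add)
    also have "(x + exp 1) powr (1 / 3) \<le> (x + exp 1) powr (1 / 2)"
      using xe by (intro powr_mono) auto
    also have "(x + exp 1) powr (1 / 2) = sqrt (x + exp 1)" using xe by (simp add: powr_half_sqrt)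
    finally have one: "1 \<le> (x + exp 1) powr (- 1 / 3) * sqrt (x + exp 1)" by (simp add: mult_left_mono)
    \<comment> \<open>Since x = n \<epsilon>^2 / p, multiplying by p / n turns x into \<epsilon>^2
      and e into the sampling term.\<close>
    have "sqrt (real p / real n) * sqrt (x + exp 1) = sqrt (\<epsilon>\<^sup>2 + exp 1 * (real p / real n))"
      unfolding real_sqrt_mult[symmetric] using np by (simp add: x_def field_simps)
    also have "\<dots> \<le> sqrt (\<epsilon>\<^sup>2) + sqrt (exp 1 * (real p / real n))"
      by (rule sqrt_add_le_add_sqrt) auto
    also have "\<dots> = \<epsilon> + sqrt (exp 1) * sqrt (real p / real n)"
      unfolding real_sqrt_mult using e by simp
    also have "sqrt (exp 1) \<le> 2" using exp_le by (intro real_le_lsqrt) auto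
    finally have root: "sqrt (real p / real n) * sqrt (x + exp 1) \<le> \<epsilon> + 2 * sqrt (real p / real n)"
      by (simp add: mult_right_mono)
    have "\<kappa> * sqrt (real p / real n) * 1 \<le> \<kappa> * sqrt (real p / real n) * ((x + exp 1) powr (- 1 / 3) * sqrt (x + exp 1))"
      using one k by (intro mult_left_mono) auto
    also have "\<dots> = (\<kappa> * (x + exp 1) powr (- 1 / 3)) * (sqrt (real p / real n) * sqrt (x + exp 1))"
      by (simp add: mult_ac)
    also have "\<dots> \<le> gg_tail \<gamma> t * (\<epsilon> + 2 * sqrt (real p / real n))"
      using tail root x xe k by (intro mult_mono) (auto simp: gg_tail_def)
    finally show ?thesis by (simp add: t_def)
  qed
  ultimately show ?thesis by blast
qed

end

section \<open>Depth events\<close>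

lemma dot_scale: "dot p v (\<lambda>j. c * x j) = c * dot p v x"
  by (simp add: dot_def sum_distrib_left mult_ac)

lemma dot_measurable [measurable]: "dot p v \<in> borel_measurable (Rp p)"
  unfolding dot_def by measurable

lemma continuous_on_dot: "continuous_on UNIV (\<lambda>w. dot p w x)"
  unfolding dot_def by (intro continuous_intros continuous_on_product_coordinates)

text \<open>For t \<ge> 0 this is the strict form of the depth indicator at the candidate \<beta> +
  r v, split by the sign of v \<bullet> x. Each inequality is affine in v, which gives half-spaces
  for the counting, and strictness makes the condition open in v.\<close>

definition depth_event ::
  "nat \<Rightarrow> (nat \<Rightarrow> real) \<Rightarrow> real \<Rightarrow> real \<Rightarrow> (nat \<Rightarrow> real) \<Rightarrow> ((nat \<Rightarrow> real) \<times> real) set" where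
  "depth_event p \<beta> r t v = {z \<in> space (Rp p \<Otimes>\<^sub>M borel).
     (t < dot p v (fst z) \<and> r * dot p v (fst z) < snd z - dot p (fst z) \<beta>) \<or>
     (t < - dot p v (fst z) \<and> snd z - dot p (fst z) \<beta> < r * dot p v (fst z))}"

lemma sets_depth_event: "depth_event p \<beta> r t v \<in> sets (Rp p \<Otimes>\<^sub>M borel)"
  unfolding depth_event_def by measurable

text \<open>Four half-spaces per observation: their joint pattern determines the pattern of depth
  events, so the latter are no more numerous. The index set has \<open>4 * card J\<close>
  elements.\<close>

lemma depth_event_growth:
  fixes z :: "nat \<Rightarrow> (nat \<Rightarrow> real) \<times> real"
  assumes J: "finite J"
  shows "real (card ((\<lambda>v. {i\<in>J. z i \<in> depth_event p \<beta> r t v}) ` V))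
    \<le> (exp 1 * (1 + 4 * real (card J) / real (Suc p))) ^ Suc p"
proof -
  define e where "e i = snd (z i) - dot p (fst (z i)) \<beta>" for i
  \<comment> \<open>For k = 0, ..., 3 the closed half-spaces are the negations of the four strict
    inequalities in \<open>depth_event\<close>, in order; this is why \<open>\<Phi>\<close> tests
    non-membership.\<close>
  define a where "a = (\<lambda>(i, k::nat) j. ([-1, r, 1, -r] ! k) * fst (z i) j)"
  have dot_a: "dot p v (a (i, k)) = ([-1, r, 1, -r] ! k) * dot p v (fst (z i))" for v i k
    unfolding a_def prod.case by (rule dot_scale)
  define b where "b = (\<lambda>(i, k::nat). [t, - e i, t, e i] ! k)"
  define \<F> where "\<F> = (\<lambda>v. {q\<in>J \<times> {..<4}. 0 \<le> dot p v (a q) + b q}) ` V"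
  define \<Phi> where "\<Phi> S = {i\<in>J. z i \<in> space (Rp p \<Otimes>\<^sub>M borel) \<and>
      ((i, 0::nat) \<notin> S \<and> (i, 1) \<notin> S \<or> (i, 2) \<notin> S \<and> (i, 3) \<notin> S)}" for S
  have "(\<lambda>v. {i\<in>J. z i \<in> depth_event p \<beta> r t v}) ` V = \<Phi> ` \<F>"
    unfolding \<F>_def image_image
  proof (rule image_cong[OF refl])
    fix v
    show "{i\<in>J. z i \<in> depth_event p \<beta> r t v} = \<Phi> {q\<in>J \<times> {..<4}. 0 \<le> dot p v (a q) + b q}"
      unfolding \<Phi>_def depth_event_def b_def by (auto simp: dot_a e_def not_le)
  qed
  moreover have "finite \<F>"
    by (rule finite_subset[of _ "Pow (J \<times> {..<4})"]) (use J in \<open>auto simp: \<F>_def\<close>)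
  ultimately have "card ((\<lambda>v. {i\<in>J. z i \<in> depth_event p \<beta> r t v}) ` V) \<le> card \<F>"
    by (simp add: card_image_le)
  also have "real (card \<F>) \<le> (exp 1 * (1 + real (card (J \<times> {..<4::nat})) / real (Suc p))) ^ Suc p"
    unfolding \<F>_def by (rule card_halfspace_patterns_le) (use J in simp)
  finally show ?thesis by (simp add: card_cartesian_product mult.commute)
qed

text \<open>Density is in the product topology on functions. This suffices because
  \<open>dot p\<close> depends on finitely many coordinates and is continuous there.\<close>

lemma unit_sphere_dense_countable:
  assumes "p \<ge> 1"
  obtains S where "countable S" "S \<noteq> {}" "S \<subseteq> unit_sphere p"
    "\<And>U v. open U \<Longrightarrow> v \<in> U \<Longrightarrow> v \<in> unit_sphere p \<Longrightarrow> \<exists>w\<in>S. w \<in> U"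
proof -
  obtain S where S: "countable S" "S \<subseteq> unit_sphere p" "unit_sphere p \<subseteq> closure S"
    using separable[of "unit_sphere p"] by metis
  have dense: "\<exists>w\<in>S. w \<in> U" if "open U" "v \<in> U" "v \<in> unit_sphere p" for U v
    using S(3) that by (meson closure_iff_nhds_not_empty disjoint_iff subsetD subset_refl)
  \<comment> \<open>The first basis vector shows that the sphere is nonempty; it exists because
    \<open>p \<ge> 1\<close>.\<close>
  define v :: "nat \<Rightarrow> real" where "v = (\<lambda>j\<in>{..<p}. of_bool (j = 0))"
  have "L2_set v {..<p} = L2_set (\<lambda>j. of_bool (j = 0)) {..<p}"
    by (rule L2_set_cong) (auto simp: v_def)
  also have "\<dots> = sqrt (\<Sum>j<p. if j = 0 then 1 else 0)"
    unfolding L2_set_def by (intro arg_cong[where f = sqrt] sum.cong) auto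
  also have "\<dots> = 1" using assms by simp
  finally have "v \<in> unit_sphere p" by (auto simp: unit_sphere_def space_PiM v_def)
  then have "S \<noteq> {}" using dense[of UNIV v] by auto
  then show thesis using that S(1,2) dense by blast
qed

section \<open>Normal tails and the probabilities of depth events\<close>

abbreviation normal_law :: "real \<Rightarrow> real \<Rightarrow> real measure" where
  "normal_law m \<sigma> \<equiv> density lborel (normal_density m \<sigma>)"

definition normal_tail :: "real \<Rightarrow> real \<Rightarrow> real" where
  "normal_tail \<sigma> c = measure (normal_law 0 \<sigma>) {c<..}"

context
  fixes \<sigma> :: real
  assumes \<sigma>: "\<sigma> > 0"
begin

interpretation N: prob_space "normal_law 0 \<sigma>"
  by (rule prob_space_normal_density[OF \<sigma>])

lemma emeasure_normal_greater:
  "emeasure (normal_law m \<sigma>) {y. c < y - m} = ennreal (normal_tail \<sigma> c)"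
proof -
  have "emeasure (normal_law m \<sigma>) {y. c < y - m}
      = (\<integral>\<^sup>+y. ennreal (normal_density m \<sigma> y) * indicator {y. c < y - m} y \<partial>lborel)"
    by (rule emeasure_density) auto
  also have "\<dots> = (\<integral>\<^sup>+y. ennreal (normal_density 0 \<sigma> y) * indicator {c<..} y \<partial>lborel)"
    by (subst nn_integral_real_affine[where c = 1 and t = m])
      (auto intro!: nn_integral_cong simp: normal_density_def indicator_def)
  also have "\<dots> = emeasure (normal_law 0 \<sigma>) {c<..}"
    by (rule emeasure_density[symmetric]) auto
  finally show ?thesis by (simp add: normal_tail_def N.emeasure_eq_measure)
qed

lemma emeasure_normal_less:
  "emeasure (normal_law m \<sigma>) {y. y - m < - c} = ennreal (normal_tail \<sigma> c)"
proof -
  have "emeasure (normal_law m \<sigma>) {y. y - m < - c}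
      = (\<integral>\<^sup>+y. ennreal (normal_density m \<sigma> y) * indicator {y. y - m < - c} y \<partial>lborel)"
    by (rule emeasure_density) auto
  also have "\<dots> = (\<integral>\<^sup>+y. ennreal (normal_density 0 \<sigma> y) * indicator {c<..} y \<partial>lborel)"
    by (subst nn_integral_real_affine[where c = "-1" and t = m])
      (auto intro!: nn_integral_cong simp: normal_density_def indicator_def)
  also have "\<dots> = emeasure (normal_law 0 \<sigma>) {c<..}"
    by (rule emeasure_density[symmetric]) auto
  finally show ?thesis by (simp add: normal_tail_def N.emeasure_eq_measure)
qed

lemma normal_tail_antimono: "c \<le> c' \<Longrightarrow> normal_tail \<sigma> c' \<le> normal_tail \<sigma> c"
  unfolding normal_tail_def by (rule N.finite_measure_mono) auto

lemma normal_tail_nonneg: "normal_tail \<sigma> c \<ge> 0"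
  by (simp add: normal_tail_def)

lemma normal_tail_0: "normal_tail \<sigma> 0 = 1 / 2"
proof -
  let ?N = "normal_law 0 \<sigma>"
  have n: "measure ?N {..<0} = normal_tail \<sigma> 0"
    using emeasure_normal_less[of 0 0] normal_tail_nonneg by (simp add: N.emeasure_eq_measure lessThan_def)
  have "emeasure ?N {0} = 0"
    by (simp add: emeasure_density nn_integral_0_iff_AE)
  then have z: "measure ?N {0} = 0" by (simp add: measure_def)
  have "UNIV = {..<0::real} \<union> ({0} \<union> {0<..})" by auto
  then have "1 = measure ?N ({..<0} \<union> ({0} \<union> {0<..}))" using N.prob_space by simp
  also have "\<dots> = measure ?N {..<0} + measure ?N ({0} \<union> {0<..})"
    by (rule N.finite_measure_Union) auto
  also have "measure ?N ({0} \<union> {0<..}) = measure ?N {0} + measure ?N {0<..}"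
    by (rule N.finite_measure_Union) auto
  finally show ?thesis using n z by (simp add: normal_tail_def)
qed

lemma normal_tail_le:
  assumes s: "0 \<le> s" "s \<le> 1"
  shows "normal_tail \<sigma> (s * \<sigma>) \<le> 1 / 2 - s / 5"
proof -
  let ?N = "normal_law 0 \<sigma>"
  have c: "0 \<le> s * \<sigma>" "s * \<sigma> \<le> \<sigma>" using s \<sigma> by (auto simp: mult_le_cancel_right1)
  have dens: "1 / (5 * \<sigma>) \<le> normal_density 0 \<sigma> y" if "y \<in> {0<..s * \<sigma>}" for y
  proof -
    have "y\<^sup>2 \<le> \<sigma>\<^sup>2" using that c by (intro power_mono) auto
    then have "y\<^sup>2 / (2 * \<sigma>\<^sup>2) \<le> 1 / 2" using \<sigma> by (simp add: field_simps)
    then have e: "exp (- 1 / 2) \<le> exp (- (y\<^sup>2 / (2 * \<sigma>\<^sup>2)))" by simp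
    \<comment> \<open>On [0, \<sigma>] the normal density is at least exp(-1/2) / (\<sigma> sqrt(2
      pi)), and 2 pi e \<le> 24 < 25 yields the slope 1/5 in the conclusion.\<close>
    have "sqrt (2 * pi) * exp (1 / 2) \<le> 5"
    proof -
      have "exp (1 / 2 :: real) = sqrt (exp 1)"
        by (rule real_sqrt_unique[symmetric]) (auto simp: power2_eq_square simp flip: exp_add)
      then have "sqrt (2 * pi) * exp (1 / 2) = sqrt (2 * pi * exp 1)" by (simp add: real_sqrt_mult)
      also have "2 * pi * exp 1 \<le> 2 * 4 * (3::real)"
        using pi_less_4 exp_le by (intro mult_mono) auto
      then have "sqrt (2 * pi * exp 1) \<le> sqrt 25" by (intro real_sqrt_le_mono) simp
      finally show ?thesis by simp
    qed
    then have "1 / 5 \<le> exp (- 1 / 2) / sqrt (2 * pi)"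
      by (simp add: exp_minus field_simps)
    then have "1 / (5 * \<sigma>) \<le> 1 / (sqrt (2 * pi) * \<sigma>) * exp (- 1 / 2)"
      using \<sigma> by (simp add: field_simps)
    also have "\<dots> \<le> 1 / (sqrt (2 * pi) * \<sigma>) * exp (- (y\<^sup>2 / (2 * \<sigma>\<^sup>2)))"
      using e \<sigma> by (intro mult_left_mono) auto
    finally show ?thesis using \<sigma> by (simp add: normal_density_def real_sqrt_mult)
  qed
  have "ennreal (s / 5) = (\<integral>\<^sup>+y. ennreal (1 / (5 * \<sigma>)) * indicator {0<..s * \<sigma>} y \<partial>lborel)"
    using c \<sigma> s by (simp add: nn_integral_cmult flip: ennreal_mult)
  also have "\<dots> \<le> (\<integral>\<^sup>+y. ennreal (normal_density 0 \<sigma> y) * indicator {0<..s * \<sigma>} y \<partial>lborel)"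
    using dens by (intro nn_integral_mono) (auto simp: indicator_def intro!: ennreal_leI)
  also have "\<dots> = emeasure ?N {0<..s * \<sigma>}" by (rule emeasure_density[symmetric]) auto
  finally have "s / 5 \<le> measure ?N {0<..s * \<sigma>}" by (simp add: N.emeasure_eq_measure)
  moreover have "measure ?N ({0<..s * \<sigma>} \<union> {s * \<sigma><..}) = measure ?N {0<..s * \<sigma>} + normal_tail \<sigma> (s * \<sigma>)"
    unfolding normal_tail_def by (rule N.finite_measure_Union) auto
  moreover have "{0<..s * \<sigma>} \<union> {s * \<sigma><..} = {0<..}" using c by auto
  ultimately show ?thesis using normal_tail_0 by (simp add: normal_tail_def)
qed

context
  fixes \<gamma> \<epsilon> :: real and p :: nat and \<mu> :: "(nat \<Rightarrow> real) measure" and \<beta> :: "nat \<Rightarrow> real" and Q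
  assumes \<gamma>: "\<gamma> > 0" and \<epsilon>: "0 \<le> \<epsilon>" "\<epsilon> \<le> 1" and \<mu>: "generalized_gaussian \<gamma> p \<mu>"
    and Q: "Q \<in> contamination_kernels p"
begin

lemma generalized_gaussian_prob: "prob_space \<mu>" "sets \<mu> = sets (Rp p)"
  using \<mu> by (auto simp: generalized_gaussian_def)

lemma emeasure_observation_depth_event:
  "emeasure (observation_law p \<mu> \<epsilon> \<sigma> \<beta> Q) (depth_event p \<beta> r t v) =
    (\<integral>\<^sup>+x. ennreal (1 - \<epsilon>) * emeasure (normal_law (dot p x \<beta>) \<sigma>) (Pair x -` depth_event p \<beta> r t v)
      + ennreal \<epsilon> * emeasure (Q x) (Pair x -` depth_event p \<beta> r t v) \<partial>\<mu>)"
  unfolding emeasure_observation_law[OF \<epsilon> \<sigma> Q generalized_gaussian_prob sets_depth_event]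
proof (rule nn_integral_cong)
  fix x assume "x \<in> space \<mu>"
  then have x: "x \<in> space (Rp p)" using sets_eq_imp_space_eq[OF generalized_gaussian_prob(2)] by simp
  have "Pair x -` depth_event p \<beta> r t v \<in> sets borel"
    by (rule sets_Pair1[OF sets_depth_event])
  then show "emeasure (response_law p \<epsilon> \<sigma> \<beta> Q x) (Pair x -` depth_event p \<beta> r t v) =
      ennreal (1 - \<epsilon>) * emeasure (normal_law (dot p x \<beta>) \<sigma>) (Pair x -` depth_event p \<beta> r t v)
      + ennreal \<epsilon> * emeasure (Q x) (Pair x -` depth_event p \<beta> r t v)"
    by (rule emeasure_response_law[OF \<epsilon> \<sigma> Q x])
qed

text \<open>\<open>t \<ge> 0\<close> makes the two cases exclusive. The doubly negated form in the
  second case is the one that \<open>emeasure_normal_less\<close> matches.\<close>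

lemma section_depth_event:
  assumes "x \<in> space (Rp p)" "t \<ge> 0"
  shows "Pair x -` depth_event p \<beta> r t v =
    (if t < dot p v x then {y. r * dot p v x < y - dot p x \<beta>}
     else if t < - dot p v x then {y. y - dot p x \<beta> < - (r * - dot p v x)} else {})"
  using assms by (auto simp: depth_event_def space_pair_measure)

text \<open>At the true vector the normal part alone gives exactly half of the tail mass;
  contamination can only add.\<close>

lemma measure_depth_event_ge:
  assumes v: "v \<in> unit_sphere p" and t: "t \<ge> 0"
  shows "(1 - \<epsilon>) / 2 * gg_tail \<gamma> t \<le> measure (observation_law p \<mu> \<epsilon> \<sigma> \<beta> Q) (depth_event p \<beta> 0 t v)"
proof -
  interpret O: prob_space "observation_law p \<mu> \<epsilon> \<sigma> \<beta> Q"
    by (rule prob_space_observation_law[OF \<epsilon> \<sigma> Q generalized_gaussian_prob])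
  have "ennreal ((1 - \<epsilon>) / 2 * gg_tail \<gamma> t) = ennreal ((1 - \<epsilon>) / 2) * (\<integral>\<^sup>+x. indicator {s. t < \<bar>s\<bar>} (dot p v x) \<partial>\<mu>)"
    unfolding emeasure_generalized_gaussian_tail[OF \<gamma> \<mu> v] using \<epsilon> by (intro ennreal_mult) (auto simp: gg_tail_def)
  also have "\<dots> = (\<integral>\<^sup>+x. ennreal ((1 - \<epsilon>) / 2) * indicator {s. t < \<bar>s\<bar>} (dot p v x) \<partial>\<mu>)"
  proof (rule nn_integral_cmult[symmetric])
    show "(\<lambda>x. indicator {s. t < \<bar>s\<bar>} (dot p v x)) \<in> borel_measurable \<mu>"
      using distr_generalized_gaussian(2)[OF \<gamma> \<mu> v] by measurable
  qed
  also have "\<dots> \<le> emeasure (observation_law p \<mu> \<epsilon> \<sigma> \<beta> Q) (depth_event p \<beta> 0 t v)"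
    unfolding emeasure_observation_depth_event
  proof (rule nn_integral_mono)
    fix x assume "x \<in> space \<mu>"
    then have x: "x \<in> space (Rp p)" using sets_eq_imp_space_eq[OF generalized_gaussian_prob(2)] by simp
    have half: "ennreal ((1 - \<epsilon>) / 2) = ennreal (1 - \<epsilon>) * ennreal (1 / 2)" using \<epsilon> by (subst ennreal_mult[symmetric]) auto
    have "ennreal ((1 - \<epsilon>) / 2) * indicator {s. t < \<bar>s\<bar>} (dot p v x)
      \<le> ennreal (1 - \<epsilon>) * emeasure (normal_law (dot p x \<beta>) \<sigma>) (Pair x -` depth_event p \<beta> 0 t v)"
      unfolding section_depth_event[OF x t] half mult.assoc
      using emeasure_normal_greater[of "dot p x \<beta>" 0] emeasure_normal_less[of "dot p x \<beta>" 0]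
      by (intro mult_left_mono) (auto simp: indicator_def normal_tail_0)
    then show "ennreal ((1 - \<epsilon>) / 2) * indicator {s. t < \<bar>s\<bar>} (dot p v x)
      \<le> ennreal (1 - \<epsilon>) * emeasure (normal_law (dot p x \<beta>) \<sigma>) (Pair x -` depth_event p \<beta> 0 t v)
      + ennreal \<epsilon> * emeasure (Q x) (Pair x -` depth_event p \<beta> 0 t v)"
      by (rule order_trans) simp
  qed
  finally show ?thesis by (simp add: O.emeasure_eq_measure)
qed

text \<open>The benefit of truncation: the residual must exceed r \<bar>v \<bullet> x\<bar> \<ge> r
  t in the direction of the signal, while contamination acts only where \<bar>v \<bullet> x\<bar> >
  t. The tail mass is therefore a common factor of both contributions and cancels against the lower
  bound at \<beta>.\<close>

lemma measure_depth_event_le: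
  assumes v: "v \<in> unit_sphere p" and t: "t \<ge> 0" and r: "r \<ge> 0"
  shows "measure (observation_law p \<mu> \<epsilon> \<sigma> \<beta> Q) (depth_event p \<beta> r t v)
    \<le> ((1 - \<epsilon>) * normal_tail \<sigma> (r * t) + \<epsilon>) * gg_tail \<gamma> t"
proof -
  interpret O: prob_space "observation_law p \<mu> \<epsilon> \<sigma> \<beta> Q"
    by (rule prob_space_observation_law[OF \<epsilon> \<sigma> Q generalized_gaussian_prob])
  define K where "K = (1 - \<epsilon>) * normal_tail \<sigma> (r * t) + \<epsilon>"
  have K: "K \<ge> 0" using \<epsilon> normal_tail_nonneg by (simp add: K_def)
  have "emeasure (observation_law p \<mu> \<epsilon> \<sigma> \<beta> Q) (depth_event p \<beta> r t v)
      \<le> (\<integral>\<^sup>+x. ennreal K * indicator {s. t < \<bar>s\<bar>} (dot p v x) \<partial>\<mu>)"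
    unfolding emeasure_observation_depth_event
  proof (rule nn_integral_mono)
    fix x assume "x \<in> space \<mu>"
    then have x: "x \<in> space (Rp p)" using sets_eq_imp_space_eq[OF generalized_gaussian_prob(2)] by simp
    let ?A = "Pair x -` depth_event p \<beta> r t v"
    let ?ind = "indicator {s. t < \<bar>s\<bar>} (dot p v x) :: ennreal"
    have "prob_space (Q x)"
      using measurable_space[OF Q x] by (auto simp: space_prob_algebra)
    then have "emeasure (Q x) ?A \<le> ?ind"
      using section_depth_event[OF x t, of r v] by (auto simp: indicator_def intro: prob_space.emeasure_le_1)
    moreover have "emeasure (normal_law (dot p x \<beta>) \<sigma>) ?A \<le> ennreal (normal_tail \<sigma> (r * t)) * ?ind"
    proof -
      have "r * t \<le> r * dot p v x" if "t < dot p v x" using that r by (intro mult_left_mono) auto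
      moreover have "r * t \<le> r * - dot p v x" if "t < - dot p v x" using that r by (intro mult_left_mono) auto
      moreover have "ennreal (normal_tail \<sigma> c) \<le> ennreal (normal_tail \<sigma> (r * t))" if "r * t \<le> c" for c
        using that by (intro ennreal_leI normal_tail_antimono)
      ultimately show ?thesis
        using t unfolding section_depth_event[OF x t]
        by (simp only: emeasure_normal_greater emeasure_normal_less indicator_def split: if_splits) auto
    qed
    ultimately have "ennreal (1 - \<epsilon>) * emeasure (normal_law (dot p x \<beta>) \<sigma>) ?A + ennreal \<epsilon> * emeasure (Q x) ?A
      \<le> ennreal (1 - \<epsilon>) * (ennreal (normal_tail \<sigma> (r * t)) * ?ind) + ennreal \<epsilon> * ?ind"
      by (intro add_mono mult_left_mono) auto
    also have "\<dots> = ennreal K * ?ind"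
      using \<epsilon> normal_tail_nonneg
      by (simp add: K_def ennreal_plus ennreal_mult distrib_right mult.assoc)
    finally show "ennreal (1 - \<epsilon>) * emeasure (normal_law (dot p x \<beta>) \<sigma>) ?A
      + ennreal \<epsilon> * emeasure (Q x) ?A \<le> ennreal K * ?ind" .
  qed
  also have "\<dots> = ennreal K * (\<integral>\<^sup>+x. indicator {s. t < \<bar>s\<bar>} (dot p v x) \<partial>\<mu>)"
  proof (rule nn_integral_cmult)
    show "(\<lambda>x. indicator {s. t < \<bar>s\<bar>} (dot p v x)) \<in> borel_measurable \<mu>"
      using distr_generalized_gaussian(2)[OF \<gamma> \<mu> v] by measurable
  qed
  also have "\<dots> = ennreal (K * gg_tail \<gamma> t)"
    using K by (simp add: emeasure_generalized_gaussian_tail[OF \<gamma> \<mu> v] ennreal_mult gg_tail_def)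
  finally show ?thesis using K by (simp add: O.emeasure_eq_measure K_def gg_tail_def)
qed

end

end

section \<open>The upper bound\<close>

lemma truncated_depth_nonneg: "0 \<le> 1 / real n *
    (\<Sum>i<n. let (x, y) = d i in of_bool (dot p v x * (y - dot p x b) \<ge> 0 \<and> \<bar>dot p v x\<bar> \<ge> t))"
  by (intro mult_nonneg_nonneg sum_nonneg) (auto simp: Let_def split: prod.splits)

lemma truncated_depth_le:
  assumes "v \<in> unit_sphere p"
  shows "truncated_depth n p d t b \<le> 1 / real n *
    (\<Sum>i<n. let (x, y) = d i in of_bool (dot p v x * (y - dot p x b) \<ge> 0 \<and> \<bar>dot p v x\<bar> \<ge> t))"
  unfolding truncated_depth_def
  by (rule cINF_lower[OF _ assms]) (intro bdd_belowI2[where m = 0] truncated_depth_nonneg)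

text \<open>For each of the finitely many observations that fail at \<open>v\<close>, failing is an
  open condition on the direction. A nearby \<open>w\<close> in \<open>S\<close> therefore satisfies
  no observation that \<open>v\<close> does not, and the bound at \<open>w\<close> carries over to
  \<open>v\<close>.\<close>

lemma truncated_depth_true_ge:
  assumes S: "S \<noteq> {}" "S \<subseteq> unit_sphere p"
      "\<And>U v. open U \<Longrightarrow> v \<in> U \<Longrightarrow> v \<in> unit_sphere p \<Longrightarrow> \<exists>w\<in>S. w \<in> U"
    and t: "t > 0"
    and m: "\<And>w. w \<in> S \<Longrightarrow> m \<le> 1 / real n * (\<Sum>i<n. indicator (depth_event p \<beta> 0 t w) (d i))"
  shows "m \<le> truncated_depth n p d t \<beta>"
  unfolding truncated_depth_def
proof (rule cINF_greatest)
  show "unit_sphere p \<noteq> {}" using S by auto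
  fix v assume v: "v \<in> unit_sphere p"
  define c where "c w i \<longleftrightarrow> dot p w (fst (d i)) * (snd (d i) - dot p (fst (d i)) \<beta>) \<ge> 0 \<and> \<bar>dot p w (fst (d i))\<bar> \<ge> t" for w i
  define U where "U = (\<Inter>i\<in>{i\<in>{..<n}. \<not> c v i}. {w. \<not> c w i})"
  have "open U" unfolding U_def
  proof (rule open_INT)
    show "\<forall>i\<in>{i \<in> {..<n}. \<not> c v i}. open {w. \<not> c w i}"
      unfolding c_def de_Morgan_conj not_le
      by (intro ballI open_Collect_disj open_Collect_less continuous_intros continuous_on_dot)
  qed simp
  moreover have "v \<in> U" by (simp add: U_def)
  ultimately obtain w where w: "w \<in> S" "w \<in> U" using S(3) v by blast
  have "m \<le> 1 / real n * (\<Sum>i<n. indicator (depth_event p \<beta> 0 t w) (d i))" by (rule m[OF w(1)])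
  also have "\<dots> \<le> 1 / real n * (\<Sum>i<n. of_bool (c v i))"
  proof (intro mult_left_mono sum_mono)
    fix i assume "i \<in> {..<n}"
    then have "c w i \<Longrightarrow> c v i" using w(2) by (auto simp: U_def)
    moreover have "d i \<in> depth_event p \<beta> 0 t w \<Longrightarrow> c w i"
      using t by (auto simp: depth_event_def c_def zero_le_mult_iff)
    ultimately show "indicator (depth_event p \<beta> 0 t w) (d i) \<le> (of_bool (c v i) :: real)"
      by (auto simp: indicator_def)
  qed simp
  finally show "m \<le> 1 / real n * (\<Sum>i<n. let (x, y) = d i in
      of_bool (dot p v x * (y - dot p x \<beta>) \<ge> 0 \<and> \<bar>dot p v x\<bar> \<ge> t))"
    by (simp add: c_def case_prod_unfold Let_def)
qed

text \<open>
  Along the direction of \<open>b - \<beta>\<close> the depth indicator is monotone in the distance of \<open>b\<close> from \<open>\<beta>\<close>,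
  so only the fixed distance \<open>r\<close> has to be controlled.
\<close>

lemma truncated_depth_far_le:
  assumes S: "\<And>U v. open U \<Longrightarrow> v \<in> U \<Longrightarrow> v \<in> unit_sphere p \<Longrightarrow> \<exists>w\<in>S. w \<in> U"
    and t: "0 < t" "t' < t" and r: "r > 0" "l2_dist p b \<beta> > r"
    and d: "\<And>i. i < n \<Longrightarrow> d i \<in> space (Rp p \<Otimes>\<^sub>M borel)"
    and m: "\<And>w. w \<in> S \<Longrightarrow> 1 / real n * (\<Sum>i<n. indicator (depth_event p \<beta> r t' w) (d i)) \<le> m"
  shows "truncated_depth n p d t b \<le> m"
proof -
  define \<rho> where "\<rho> = l2_dist p b \<beta>"
  have \<rho>: "\<rho> > r" "\<rho> > 0" using r by (auto simp: \<rho>_def)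
  define v where "v = (\<lambda>j\<in>{..<p}. (b j - \<beta> j) / \<rho>)"
  have "L2_set v {..<p} = L2_set (\<lambda>j. (1 / \<rho>) * (b j - \<beta> j)) {..<p}"
    by (rule L2_set_cong) (auto simp: v_def)
  also have "\<dots> = (1 / \<rho>) * l2_dist p b \<beta>"
    unfolding l2_dist_def by (rule L2_set_right_distrib[symmetric]) (use \<rho> in auto)
  also have "\<dots> = 1" using \<rho> by (simp add: \<rho>_def)
  finally have v: "v \<in> unit_sphere p" by (auto simp: unit_sphere_def space_PiM v_def)
  have dotv: "dot p x b = dot p x \<beta> + \<rho> * dot p v x" for x
  proof -
    have "\<rho> * dot p v x = (\<Sum>j<p. x j * b j - x j * \<beta> j)"
      unfolding dot_def sum_distrib_left using \<rho> by (intro sum.cong) (auto simp: v_def field_simps)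
    then show ?thesis by (simp add: dot_def sum_subtractf)
  qed
  define c where "c i \<longleftrightarrow> dot p v (fst (d i)) * (snd (d i) - dot p (fst (d i)) b) \<ge> 0 \<and> \<bar>dot p v (fst (d i))\<bar> \<ge> t" for i
  \<comment> \<open>The dual transfer: \<open>t' < t\<close> and \<open>r < \<rho>\<close> turn the
    weak inequalities at \<open>v\<close> into strict ones, which persist for nearby
    directions.\<close>
  define W where "W i = {w. (t' < dot p w (fst (d i)) \<and> r * dot p w (fst (d i)) < snd (d i) - dot p (fst (d i)) \<beta>) \<or>
     (t' < - dot p w (fst (d i)) \<and> snd (d i) - dot p (fst (d i)) \<beta> < r * dot p w (fst (d i)))}" for i
  define U where "U = (\<Inter>i\<in>{i\<in>{..<n}. c i}. W i)"
  have "open U" unfolding U_def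
  proof (rule open_INT)
    show "\<forall>i\<in>{i \<in> {..<n}. c i}. open (W i)"
      unfolding W_def
      by (intro ballI open_Collect_disj open_Collect_conj open_Collect_less continuous_intros continuous_on_dot)
  qed simp
  moreover have "v \<in> U" unfolding U_def
  proof (rule INT_I)
    fix i assume "i \<in> {i \<in> {..<n}. c i}"
    then have c: "0 \<le> dot p v (fst (d i)) * (snd (d i) - dot p (fst (d i)) b)" "\<bar>dot p v (fst (d i))\<bar> \<ge> t"
      by (auto simp: c_def)
    define z where "z = dot p v (fst (d i))"
    define e where "e = snd (d i) - dot p (fst (d i)) \<beta>"
    have ze: "0 \<le> z * (e - \<rho> * z)" "t \<le> \<bar>z\<bar>" using c by (simp_all add: z_def e_def dotv algebra_simps)
    have "(t' < z \<and> r * z < e) \<or> (t' < - z \<and> e < r * z)"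
    proof (cases "z > 0")
      case True
      then have "r * z < \<rho> * z" using \<rho> by simp
      moreover have "\<rho> * z \<le> e" using True ze(1) by (simp add: zero_le_mult_iff)
      ultimately have "r * z < e" by linarith
      then show ?thesis using True ze(2) t by auto
    next
      case False
      then have "z < 0" using ze t by auto
      then have "\<rho> * z < r * z" using \<rho> by simp
      moreover have "e \<le> \<rho> * z" using \<open>z < 0\<close> ze(1) by (simp add: zero_le_mult_iff)
      ultimately have "e < r * z" by linarith
      then show ?thesis using \<open>z < 0\<close> ze(2) t by auto
    qed
    then show "v \<in> W i" by (simp add: W_def z_def e_def)
  qed
  ultimately obtain w where w: "w \<in> S" "w \<in> U" using S v by blast
  have "truncated_depth n p d t b \<le> 1 / real n * (\<Sum>i<n. let (x, y) = d i in
      of_bool (dot p v x * (y - dot p x b) \<ge> 0 \<and> \<bar>dot p v x\<bar> \<ge> t))"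
    by (rule truncated_depth_le[OF v])
  also have "\<dots> = 1 / real n * (\<Sum>i<n. of_bool (c i))"
    by (simp add: c_def case_prod_unfold Let_def)
  also have "\<dots> \<le> 1 / real n * (\<Sum>i<n. indicator (depth_event p \<beta> r t' w) (d i))"
  proof (intro mult_left_mono sum_mono)
    fix i assume i: "i \<in> {..<n}"
    have "d i \<in> depth_event p \<beta> r t' w" if "c i"
    proof -
      have "w \<in> W i" using w(2) i that by (auto simp: U_def)
      then show ?thesis using d i by (auto simp: depth_event_def W_def)
    qed
    then show "(of_bool (c i) :: real) \<le> indicator (depth_event p \<beta> r t' w) (d i)"
      by (auto simp: indicator_def)
  qed simp
  also have "\<dots> \<le> m" by (rule m[OF w(1)])
  finally show ?thesis .
qed

text \<open>Here \<tau> and \<tau>' are the tail masses at the two thresholds, q is sqrt(p / n), c q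
  the deviation bound and g the normal tail at the far candidate. The loss, of order s \<tau>, would
  have to be covered by the contamination \<epsilon> \<tau> and by sampling errors of order q;
  \<open>tail\<close> converts q into a multiple of \<tau>, so that \<tau> cancels.\<close>

lemma depth_gap_contradiction:
  fixes \<epsilon> \<tau> \<tau>' q s c \<kappa> g \<delta> :: real
  assumes \<epsilon>: "0 \<le> \<epsilon>" "\<epsilon> < 1 / 2" and q: "q > 0" and \<kappa>: "\<kappa> > 0" and c: "c \<ge> 0"
    and tail: "\<kappa> * q \<le> \<tau> * (\<epsilon> + 2 * q)" and \<tau>': "\<tau>' \<le> \<tau> + q" "\<tau>' \<ge> 0" and g: "0 \<le> g" "g \<le> 1 / 2 - s / 5"
    and s: "s = 11 * (1 + 2 * (1 + 2 * c) / \<kappa>) * (\<epsilon> + q)" and s1: "s \<le> 1"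
    and le: "(1 - \<epsilon>) / 2 * \<tau> - c * q \<le> ((1 - \<epsilon>) * g + \<epsilon>) * \<tau>' + c * q"
  shows False
proof -
  define K where "K = 1 + 2 * (1 + 2 * c) / \<kappa>"
  have K: "K > 0" using \<kappa> c by (simp add: K_def add_pos_nonneg)
  have sK: "s = 11 * K * (\<epsilon> + q)" using s by (simp add: K_def)
  have s0: "s > 0" using K \<epsilon> q by (simp add: sK)
  have "0 < \<kappa> * q" using \<kappa> q by simp
  then have "0 < \<tau> * (\<epsilon> + 2 * q)" using tail by linarith
  then have \<tau>: "\<tau> > 0" using \<epsilon> q by (simp add: zero_less_mult_iff)
  define B where "B = (1 - \<epsilon>) * (1 / 2 - s / 5) + \<epsilon>"
  have "(1 - \<epsilon>) * (1 / 2 - s / 5) \<le> (1 - \<epsilon>) * 1" using \<epsilon> s0 by (intro mult_left_mono) auto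
  then have B1: "B \<le> 1" by (simp add: B_def)
  have "(1 - \<epsilon>) * g \<le> (1 - \<epsilon>) * (1 / 2 - s / 5)" using \<epsilon> g by (intro mult_left_mono) auto
  then have gB: "(1 - \<epsilon>) * g + \<epsilon> \<le> B" by (simp add: B_def)
  have "0 \<le> (1 - \<epsilon>) * g + \<epsilon>" using g \<epsilon> by (intro add_nonneg_nonneg mult_nonneg_nonneg) auto
  then have B0: "B \<ge> 0" using gB by linarith
  have "((1 - \<epsilon>) * g + \<epsilon>) * \<tau>' \<le> B * (\<tau> + q)" using gB \<tau>' B0 by (intro mult_mono) auto
  also have "\<dots> \<le> B * \<tau> + q" using B1 q by (simp add: distrib_left)
  finally have upper: "((1 - \<epsilon>) * g + \<epsilon>) * \<tau>' \<le> B * \<tau> + q" .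
  have "(1 + 2 * c) * q = q + c * q + c * q" by (simp add: distrib_right)
  with upper le have "(1 - \<epsilon>) / 2 * \<tau> \<le> B * \<tau> + (1 + 2 * c) * q" by linarith
  moreover have "B * \<tau> = (1 - \<epsilon>) / 2 * \<tau> - (1 - \<epsilon>) * (s / 5) * \<tau> + \<epsilon> * \<tau>"
    by (simp add: B_def algebra_simps)
  ultimately have 1: "(1 - \<epsilon>) * (s / 5) * \<tau> \<le> \<epsilon> * \<tau> + (1 + 2 * c) * q" by linarith
  have "q \<le> \<tau> * (\<epsilon> + 2 * q) / \<kappa>" using tail \<kappa> by (simp add: field_simps)
  then have "(1 + 2 * c) * q \<le> (1 + 2 * c) * (\<tau> * (\<epsilon> + 2 * q) / \<kappa>)" using c by (intro mult_left_mono) auto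
  also have "\<dots> \<le> (1 + 2 * c) * (\<tau> * (2 * (\<epsilon> + q)) / \<kappa>)"
    using c \<tau> \<epsilon> \<kappa> by (intro mult_left_mono divide_right_mono) auto
  also have "\<dots> = (K - 1) * (\<epsilon> + q) * \<tau>" by (simp add: K_def field_simps)
  finally have 2: "(1 + 2 * c) * q \<le> (K - 1) * (\<epsilon> + q) * \<tau>" .
  have "\<epsilon> * \<tau> \<le> (\<epsilon> + q) * \<tau>" using \<tau> q by (intro mult_right_mono) auto
  then have "(1 - \<epsilon>) * (s / 5) * \<tau> \<le> K * (\<epsilon> + q) * \<tau>" using 1 2 by (simp add: algebra_simps)
  then have 3: "(1 - \<epsilon>) * (s / 5) \<le> K * (\<epsilon> + q)" using \<tau> by (simp only: mult_le_cancel_right_pos)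
  have "1 / 2 * (s / 5) \<le> (1 - \<epsilon>) * (s / 5)" using \<epsilon> s0 by (intro mult_right_mono) auto
  \<comment> \<open>The 10 comes from 1 - \<epsilon> \<ge> 1/2 and the slope 1/5 of the normal tail;
    the 11 in the definition of \<open>s\<close> makes the contradiction strict.\<close>
  then have "s \<le> 10 * (K * (\<epsilon> + q))" using 3 by linarith
  moreover have "K * (\<epsilon> + q) > 0" using K \<epsilon> q by simp
  ultimately show False using sK by simp
qed

theorem truncated_depth_upper_bound:
  fixes \<gamma> \<alpha> :: real
  assumes \<gamma>: "\<gamma> > 0" and \<alpha>: "0 < \<alpha>"
  shows "\<exists>C c :: real. C > 0 \<and> c > 0 \<and>
         (\<forall>(n::nat) (p::nat) (\<epsilon>::real) (\<sigma>::real) \<mu> \<beta> Q \<beta>hat.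
            n \<ge> 1 \<longrightarrow> p \<ge> 1 \<longrightarrow> 0 \<le> \<epsilon> \<longrightarrow> \<epsilon> < 1 / 2 \<longrightarrow> \<sigma> > 0 \<longrightarrow>
            generalized_gaussian \<gamma> p \<mu> \<longrightarrow>
            \<beta> \<in> space (Rp p) \<longrightarrow>
            Q \<in> contamination_kernels p \<longrightarrow>
            sqrt (real p / real n) + \<epsilon> \<le> c \<longrightarrow>
            (\<forall>d \<in> space (sample_space n p).
               is_arg_max (truncated_depth n p d (truncation_level \<gamma> n p \<epsilon>))
                 (\<lambda>b. b \<in> space (Rp p)) (\<beta>hat d)) \<longrightarrow>
            (\<exists>A \<in> sets (sample_law n p \<mu> \<epsilon> \<sigma> \<beta> Q).
               measure (sample_law n p \<mu> \<epsilon> \<sigma> \<beta> Q) A \<ge> 1 - \<alpha> \<and>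
               (\<forall>d \<in> A. l2_dist p (\<beta>hat d) \<beta> \<le> C * \<sigma> * rate \<gamma> n p \<epsilon>)))"
proof -
  obtain \<kappa> where \<kappa>: "\<kappa> > 0" and tail: "\<And>n p \<epsilon>. n \<ge> 1 \<Longrightarrow> p \<ge> 1 \<Longrightarrow> \<epsilon> \<ge> 0 \<Longrightarrow>
      \<kappa> * sqrt (real p / real n) \<le> gg_tail \<gamma> (truncation_level \<gamma> n p \<epsilon>) * (\<epsilon> + 2 * sqrt (real p / real n))"
    using ex_gg_tail_truncation_ge[OF \<gamma>] by blast
  define t0 where "t0 = (1 / 3 :: real) powr (1 / \<gamma>)"
  \<comment> \<open>\<open>cd\<close> is the deviation constant when each of the two families may
    fail with probability \<alpha> / 2, and \<open>K\<close> is the factor demanded by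
    \<open>depth_gap_contradiction\<close>. The smallness threshold 1 / K keeps \<open>s\<close>
    within the range of \<open>normal_tail_le\<close>.\<close>
  define cd where "cd = 200 / \<alpha>"
  define K where "K = 11 * (1 + 2 * (1 + 2 * cd) / \<kappa>)"
  have t0: "t0 > 0" by (simp add: t0_def)
  have cd: "cd \<ge> 0" using \<alpha> by (simp add: cd_def)
  have K: "K > 0" using \<kappa> cd by (simp add: K_def add_pos_nonneg)
  have main: "\<exists>A \<in> sets (sample_law n p \<mu> \<epsilon> \<sigma> \<beta> Q).
               measure (sample_law n p \<mu> \<epsilon> \<sigma> \<beta> Q) A \<ge> 1 - \<alpha> \<and>
               (\<forall>d \<in> A. l2_dist p (\<beta>hat d) \<beta> \<le> 2 * K / t0 * \<sigma> * rate \<gamma> n p \<epsilon>)"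
    if np: "n \<ge> 1" "p \<ge> 1" and \<epsilon>: "0 \<le> \<epsilon>" "\<epsilon> < 1 / 2" and \<sigma>: "\<sigma> > 0" and \<mu>: "generalized_gaussian \<gamma> p \<mu>"
      and \<beta>: "\<beta> \<in> space (Rp p)" and Q: "Q \<in> contamination_kernels p" and small: "sqrt (real p / real n) + \<epsilon> \<le> 1 / K"
      and argmax: "\<And>d. d \<in> space (sample_space n p) \<Longrightarrow>
               is_arg_max (truncated_depth n p d (truncation_level \<gamma> n p \<epsilon>)) (\<lambda>b. b \<in> space (Rp p)) (\<beta>hat d)"
    for n p :: nat and \<epsilon> \<sigma> \<mu> \<beta> Q and \<beta>hat :: "(nat \<Rightarrow> (nat \<Rightarrow> real) \<times> real) \<Rightarrow> nat \<Rightarrow> real"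
  proof -
    have \<epsilon>1: "\<epsilon> \<le> 1" using \<epsilon> by simp
    have mu: "prob_space \<mu>" "sets \<mu> = sets (Rp p)" using \<mu> by (auto simp: generalized_gaussian_def)
    let ?O = "observation_law p \<mu> \<epsilon> \<sigma> \<beta> Q"
    let ?P = "Pi\<^sub>M {..<n} (\<lambda>_. ?O)"
    interpret O: prob_space ?O by (rule prob_space_observation_law[OF \<epsilon>(1) \<epsilon>1 \<sigma> Q mu])
    interpret P: prob_space ?P by (rule prob_space_PiM) (rule O.prob_space_axioms)
    have setsO: "sets ?O = sets (Rp p \<Otimes>\<^sub>M borel)" by (rule sets_observation_law[OF \<epsilon>(1) \<epsilon>1 \<sigma> Q mu])
    have spaceP: "space ?P = space (sample_space n p)"
      by (intro sets_eq_imp_space_eq sets_PiM_cong refl setsO)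
    define q where "q = sqrt (real p / real n)"
    have q: "q > 0" using np by (simp add: q_def)
    define t where "t = truncation_level \<gamma> n p \<epsilon>"
    have "t \<ge> t0" using truncation_level_ge(2)[OF \<gamma> np, of \<epsilon>] by (simp add: t_def t0_def)
    with t0 have t: "t \<ge> t0" "t > 0" by linarith+
    define k where "k = gg_const \<gamma>"
    have k: "k > 0" using gg_const_pos[OF \<gamma>] by (simp add: k_def)
    \<comment> \<open>The first bound keeps \<open>t'\<close> above t / 2, which costs a factor 2 in
      the radius; the second keeps the additional tail mass below the sampling error
      \<open>q\<close>.\<close>
    define \<eta> where "\<eta> = min (t / 2) (q / (2 * k))"
    have \<eta>: "\<eta> > 0" "\<eta> \<le> t / 2" "2 * k * \<eta> \<le> q" using t q k by (auto simp: \<eta>_def min_def field_simps)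
    define t' where "t' = t - \<eta>"
    have t': "t' < t" "t' \<ge> t / 2" "t' > 0" using \<eta> t by (auto simp: t'_def)
    define s where "s = K * (\<epsilon> + q)"
    have s: "0 < s" "s \<le> 1" using K q \<epsilon> small by (auto simp: s_def q_def field_simps add_nonneg_pos)
    define r where "r = s * \<sigma> / t'"
    have r: "r > 0" "r * t' = s * \<sigma>" using s \<sigma> t' by (auto simp: r_def)
    obtain S where S: "countable S" "S \<noteq> {}" "S \<subseteq> unit_sphere p"
      "\<And>U v. open U \<Longrightarrow> v \<in> U \<Longrightarrow> v \<in> unit_sphere p \<Longrightarrow> \<exists>w\<in>S. w \<in> U"
      using unit_sphere_dense_countable[OF np(2)] by metis
    define G where "G r' u = {d\<in>space ?P. \<forall>v\<in>S. deviation n ?O (depth_event p \<beta> r' u v) d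
        < 68 * sqrt (real n * real (Suc p)) / (\<alpha> / 2)}" for r' u
    have G: "G r' u \<in> sets ?P" "measure ?P (G r' u) \<ge> 1 - \<alpha> / 2" for r' u
    proof -
      have ev: "depth_event p \<beta> r' u v \<in> sets ?O" for v unfolding setsO by (rule sets_depth_event)
      show "G r' u \<in> sets ?P" "measure ?P (G r' u) \<ge> 1 - \<alpha> / 2" unfolding G_def
        by (rule O.uniform_deviation[OF np(1) ev S(1,2) _ depth_event_growth]; use \<alpha> in simp)+
    qed
    \<comment> \<open>The failure level \<alpha> / 2 doubles 68, and p + 1 \<le> 2p costs sqrt 2
      \<le> 25/17; 136 * 25/17 = 200 is the numerator of \<open>cd\<close>.\<close>
    have num: "68 * sqrt (real n * real (Suc p)) / (\<alpha> / 2) \<le> real n * (cd * q)"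
    proof -
      have "real n * real (Suc p) \<le> 2 * (real n * real p)" using np by simp
      then have "sqrt (real n * real (Suc p)) \<le> sqrt (2 * (real n * real p))" by (rule real_sqrt_le_mono)
      also have "\<dots> = sqrt 2 * sqrt (real n * real p)" by (rule real_sqrt_mult)
      also have "sqrt 2 \<le> 25 / (17::real)" by (rule real_le_lsqrt) (auto simp: power2_eq_square)
      finally have "sqrt (real n * real (Suc p)) \<le> 25 / 17 * sqrt (real n * real p)" by (simp add: mult_right_mono)
      then have "136 * sqrt (real n * real (Suc p)) \<le> 200 * sqrt (real n * real p)" by simp
      moreover have "sqrt (real n * real p) = real n * q"
        using np by (simp add: q_def real_sqrt_mult real_sqrt_divide field_simps)
      ultimately show ?thesis using \<alpha> by (simp add: cd_def field_simps)
    qed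
    have dev: "\<bar>1 / real n * (\<Sum>i<n. indicator (depth_event p \<beta> r' u v) (d i)) - measure ?O (depth_event p \<beta> r' u v)\<bar> \<le> cd * q"
      if "d \<in> G r' u" "v \<in> S" for d v r' u
    proof -
      have "deviation n ?O (depth_event p \<beta> r' u v) d \<le> real n * (cd * q)"
        using that num by (force simp: G_def)
      moreover have "deviation n ?O (depth_event p \<beta> r' u v) d
          = real n * \<bar>1 / real n * (\<Sum>i<n. indicator (depth_event p \<beta> r' u v) (d i)) - measure ?O (depth_event p \<beta> r' u v)\<bar>"
        (is "_ = _ * \<bar>?x\<bar>")
      proof -
        have "real n * \<bar>?x\<bar> = \<bar>real n * ?x\<bar>" by (simp add: abs_mult)
        then show ?thesis using np by (simp add: deviation_def right_diff_distrib)
      qed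
      ultimately show ?thesis using np by simp
    qed
    \<comment> \<open>Defined through deviations alone, so \<open>A\<close> is measurable whichever
      maximiser \<open>\<beta>hat\<close> selects.\<close>
    define A where "A = G 0 t \<inter> G r t'"
    have A: "A \<in> sets ?P" using G by (auto simp: A_def)
    have "measure ?P (space ?P - A) \<le> measure ?P ((space ?P - G 0 t) \<union> (space ?P - G r t'))"
      by (rule P.finite_measure_mono) (use G in \<open>auto simp: A_def\<close>)
    also have "\<dots> \<le> measure ?P (space ?P - G 0 t) + measure ?P (space ?P - G r t')"
      by (rule measure_Un_le) (use G in auto)
    also have "\<dots> \<le> \<alpha> / 2 + \<alpha> / 2"
      using G(2)[of 0 t] G(2)[of r t'] by (simp add: P.prob_compl[OF G(1)])
    finally have measA: "measure ?P A \<ge> 1 - \<alpha>" using P.prob_compl[OF A] by simp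
    have "l2_dist p (\<beta>hat d) \<beta> \<le> r" if d: "d \<in> A" for d
    proof (rule ccontr)
      assume "\<not> l2_dist p (\<beta>hat d) \<beta> \<le> r"
      then have far: "l2_dist p (\<beta>hat d) \<beta> > r" by simp
      have dsp: "d \<in> space (sample_space n p)" using d A sets.sets_into_space spaceP by blast
      have di: "d i \<in> space (Rp p \<Otimes>\<^sub>M borel)" if "i < n" for i
        using dsp that by (auto simp: space_PiM)
      have lower: "(1 - \<epsilon>) / 2 * gg_tail \<gamma> t - cd * q \<le> truncated_depth n p d t \<beta>"
      proof (rule truncated_depth_true_ge[OF S(2-4) t(2)])
        fix w assume w: "w \<in> S"
        have "(1 - \<epsilon>) / 2 * gg_tail \<gamma> t \<le> measure ?O (depth_event p \<beta> 0 t w)"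
          using measure_depth_event_ge[OF \<sigma> \<gamma> \<epsilon>(1) \<epsilon>1 \<mu> Q] w S(3) t by auto
        then show "(1 - \<epsilon>) / 2 * gg_tail \<gamma> t - cd * q \<le> 1 / real n * (\<Sum>i<n. indicator (depth_event p \<beta> 0 t w) (d i))"
          using dev[of d 0 t w] d w by (auto simp: A_def abs_le_iff)
      qed
      have "\<not> truncated_depth n p d t (\<beta>hat d) < truncated_depth n p d t \<beta>"
        using argmax[OF dsp] \<beta> by (auto simp: is_arg_max_def t_def)
      moreover have "truncated_depth n p d t (\<beta>hat d) \<le> ((1 - \<epsilon>) * normal_tail \<sigma> (s * \<sigma>) + \<epsilon>) * gg_tail \<gamma> t' + cd * q"
      proof (rule truncated_depth_far_le[OF S(4) t(2) t'(1) r(1) far di])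
        fix w assume w: "w \<in> S"
        have "measure ?O (depth_event p \<beta> r t' w) \<le> ((1 - \<epsilon>) * normal_tail \<sigma> (s * \<sigma>) + \<epsilon>) * gg_tail \<gamma> t'"
          using measure_depth_event_le[OF \<sigma> \<gamma> \<epsilon>(1) \<epsilon>1 \<mu> Q, of w t' r \<beta>] w S(3) t' r by auto
        then show "1 / real n * (\<Sum>i<n. indicator (depth_event p \<beta> r t' w) (d i))
            \<le> ((1 - \<epsilon>) * normal_tail \<sigma> (s * \<sigma>) + \<epsilon>) * gg_tail \<gamma> t' + cd * q"
          using dev[of d r t' w] d w by (auto simp: A_def abs_le_iff)
      qed
      ultimately have gap: "(1 - \<epsilon>) / 2 * gg_tail \<gamma> t - cd * q \<le> ((1 - \<epsilon>) * normal_tail \<sigma> (s * \<sigma>) + \<epsilon>) * gg_tail \<gamma> t' + cd * q"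
        using lower by linarith
      have "gg_tail \<gamma> t' \<le> gg_tail \<gamma> t + 2 * k * (t - t')"
        unfolding k_def by (rule gg_tail_le[OF \<gamma>]) (use t' in simp)
      then have "gg_tail \<gamma> t' \<le> gg_tail \<gamma> t + q" using \<eta> by (simp add: t'_def)
      then show False
        using depth_gap_contradiction[OF \<epsilon> q \<kappa> cd _ _ _ normal_tail_nonneg normal_tail_le _ s(2) gap]
          tail[OF np \<epsilon>(1)] \<sigma> s
        by (simp add: q_def t_def s_def K_def gg_tail_def)
    qed
    moreover have "r \<le> 2 * K / t0 * \<sigma> * rate \<gamma> n p \<epsilon>"
    proof -
      define Lg where "Lg = log_factor n p \<epsilon> powr (1 / \<gamma>)"
      have Lg: "Lg \<ge> 1" using log_factor_ge_1[OF np, of \<epsilon>] \<gamma> by (simp add: Lg_def ge_one_powr_ge_zero)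
      have tL: "t = t0 * Lg" using truncation_level_ge(1)[OF \<gamma> np, of \<epsilon>] by (simp add: t_def t0_def Lg_def)
      have "r \<le> s * \<sigma> / (t / 2)" unfolding r_def using t t' s \<sigma> by (intro divide_left_mono) auto
      also have "\<dots> = 2 * K / t0 * \<sigma> * ((\<epsilon> + q) / Lg)" by (simp add: s_def tL)
      also have "\<dots> \<le> 2 * K / t0 * \<sigma> * (q + \<epsilon> / Lg)"
      proof (rule mult_left_mono)
        \<comment> \<open>The radius is really of order (\<epsilon> + q) / t; the sampling part
          gives up its logarithmic gain.\<close>
        have "q / Lg \<le> q / 1" using Lg q by (intro divide_left_mono) auto
        then show "(\<epsilon> + q) / Lg \<le> q + \<epsilon> / Lg" by (simp add: add_divide_distrib)
      qed (use K t0 \<sigma> in simp)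
      finally show ?thesis by (simp add: rate_def q_def Lg_def)
    qed
    ultimately have "\<forall>d\<in>A. l2_dist p (\<beta>hat d) \<beta> \<le> 2 * K / t0 * \<sigma> * rate \<gamma> n p \<epsilon>"
      using order_trans by blast
    then show ?thesis using A measA unfolding sample_law_def by blast
  qed
  show ?thesis
  proof (intro exI conjI allI impI)
    show "2 * K / t0 > 0" "1 / K > 0" using K t0 by auto
  qed (rule main; blast)
qed

section \<open>Flattened normal responses\<close>

text \<open>The subtracted term is the projection of \<open>w\<close> onto [-b, b], so the absolute
  value is the distance to that interval.\<close>

definition soft_threshold :: "real \<Rightarrow> real \<Rightarrow> real" where
  "soft_threshold b w = w - max (- b) (min b w)"

lemma borel_measurable_soft_threshold [measurable]: "soft_threshold b \<in> borel_measurable borel"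
  unfolding soft_threshold_def by measurable

context
  fixes b :: real
  assumes b: "b \<ge> 0"
begin

lemma abs_soft_threshold: "\<bar>soft_threshold b w\<bar> = max 0 (\<bar>w\<bar> - b)"
  using b by (auto simp: soft_threshold_def max_def min_def)

text \<open>w + h differs by \<open>soft_threshold b w + h\<close> from the projection of w, which
  is a point of [-b, b]; its distance to the interval is no larger than that.\<close>

lemma abs_soft_threshold_add_le: "\<bar>soft_threshold b (w + h)\<bar> \<le> \<bar>soft_threshold b w + h\<bar>"
  using b by (auto simp: soft_threshold_def max_def min_def)

text \<open>\<open>y - soft_threshold b m\<close> equals y - m plus the projection of m, hence lies
  within \<bar>y - m\<bar> of [-b, b].\<close>

lemma abs_soft_threshold_diff_le: "\<bar>soft_threshold b (y - soft_threshold b m)\<bar> \<le> \<bar>y - m\<bar>"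
  using b by (auto simp: soft_threshold_def max_def min_def)

text \<open>Thresholding collapses [-b, b] to the point 0 and shifts the two outer half-lines
  together, losing only a null set. Integrals of flattened densities thus become exact.\<close>

lemma nn_integral_soft_threshold:
  fixes F :: "real \<Rightarrow> ennreal"
  assumes F [measurable]: "F \<in> borel_measurable borel"
  shows "(\<integral>\<^sup>+w. F (soft_threshold b w) \<partial>lborel) = ennreal (2 * b) * F 0 + (\<integral>\<^sup>+u. F u \<partial>lborel)"
proof -
  have "(\<integral>\<^sup>+w. F (soft_threshold b w) \<partial>lborel) =
      (\<integral>\<^sup>+w. F (soft_threshold b w) * indicator {..<-b} w + (F 0 * indicator {-b..b} w
        + F (soft_threshold b w) * indicator {b<..} w) \<partial>lborel)"
    using b by (intro nn_integral_cong) (auto simp: indicator_def soft_threshold_def)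
  also have "\<dots> = (\<integral>\<^sup>+w. F (soft_threshold b w) * indicator {..<-b} w \<partial>lborel) +
      ((\<integral>\<^sup>+w. F 0 * indicator {-b..b} w \<partial>lborel) + (\<integral>\<^sup>+w. F (soft_threshold b w) * indicator {b<..} w \<partial>lborel))"
    by (simp add: nn_integral_add)
  also have "(\<integral>\<^sup>+w. F 0 * indicator {-b..b} w \<partial>lborel) = ennreal (2 * b) * F 0"
    using b by (simp add: nn_integral_cmult mult.commute)
  also have "(\<integral>\<^sup>+w. F (soft_threshold b w) * indicator {..<-b} w \<partial>lborel) = (\<integral>\<^sup>+u. F u * indicator {..<0} u \<partial>lborel)"
    using b by (subst nn_integral_real_affine[where c = 1 and t = "-b"])
      (auto intro!: nn_integral_cong simp: indicator_def soft_threshold_def)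
  also have "(\<integral>\<^sup>+w. F (soft_threshold b w) * indicator {b<..} w \<partial>lborel) = (\<integral>\<^sup>+u. F u * indicator {0<..} u \<partial>lborel)"
    using b by (subst nn_integral_real_affine[where c = 1 and t = b])
      (auto intro!: nn_integral_cong simp: indicator_def soft_threshold_def)
  also have "(\<integral>\<^sup>+u. F u * indicator {..<0} u \<partial>lborel) + (ennreal (2 * b) * F 0 + (\<integral>\<^sup>+u. F u * indicator {0<..} u \<partial>lborel))
      = ennreal (2 * b) * F 0 + ((\<integral>\<^sup>+u. F u * indicator {..<0} u \<partial>lborel) + (\<integral>\<^sup>+u. F u * indicator {0<..} u \<partial>lborel))"
    by (simp add: ac_simps)
  also have "(\<integral>\<^sup>+u. F u * indicator {..<0} u \<partial>lborel) + (\<integral>\<^sup>+u. F u * indicator {0<..} u \<partial>lborel)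
      = (\<integral>\<^sup>+u. F u * indicator {..<0} u + F u * indicator {0<..} u \<partial>lborel)"
    by (simp add: nn_integral_add)
  also have "\<dots> = (\<integral>\<^sup>+u. F u \<partial>lborel)"
    using AE_lborel_singleton[of "0::real"] by (intro nn_integral_cong_AE) (auto simp: indicator_def elim!: eventually_mono)
  finally show ?thesis .
qed

end

text \<open>
  The normal density flattened on \<open>[-b, b]\<close>: after renormalisation it dominates \<open>1 - \<epsilon>\<close> times every
  normal density with mean in \<open>[-b, b]\<close> when \<open>b = \<sigma> \<epsilon>\<close>, so the contamination can hide such means.
\<close>

definition flat_normal :: "real \<Rightarrow> real \<Rightarrow> real \<Rightarrow> real" where
  "flat_normal \<sigma> b y = exp (- (soft_threshold b y)\<^sup>2 / (2 * \<sigma>\<^sup>2)) / (\<sigma> * sqrt (2 * pi) + 2 * b)"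

lemma borel_measurable_flat_normal [measurable]: "flat_normal \<sigma> b \<in> borel_measurable borel"
  unfolding flat_normal_def by measurable

lemma nn_integral_gaussian:
  assumes "\<sigma> > 0"
  shows "(\<integral>\<^sup>+u. ennreal (exp (- (u - h)\<^sup>2 / (2 * \<sigma>\<^sup>2))) \<partial>lborel) = ennreal (\<sigma> * sqrt (2 * pi))"
proof -
  interpret N: prob_space "normal_law h \<sigma>" by (rule prob_space_normal_density[OF assms])
  have "(\<integral>\<^sup>+u. ennreal (exp (- (u - h)\<^sup>2 / (2 * \<sigma>\<^sup>2))) \<partial>lborel)
      = (\<integral>\<^sup>+u. ennreal (\<sigma> * sqrt (2 * pi)) * ennreal (normal_density h \<sigma> u) \<partial>lborel)"
    using assms by (intro nn_integral_cong) (simp add: normal_density_def real_sqrt_mult flip: ennreal_mult)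
  also have "\<dots> = ennreal (\<sigma> * sqrt (2 * pi)) * (\<integral>\<^sup>+u. ennreal (normal_density h \<sigma> u) \<partial>lborel)"
    by (rule nn_integral_cmult) measurable
  also have "(\<integral>\<^sup>+u. ennreal (normal_density h \<sigma> u) \<partial>lborel) = 1"
    using N.emeasure_space_1 by (simp add: emeasure_density)
  finally show ?thesis by simp
qed

context
  fixes \<sigma> b :: real
  assumes \<sigma>: "\<sigma> > 0" and b: "b \<ge> 0"
begin

lemma flat_normal_normalizer_pos: "\<sigma> * sqrt (2 * pi) + 2 * b > 0"
  using \<sigma> b by (simp add: add_pos_nonneg)

lemma flat_normal_pos: "flat_normal \<sigma> b y > 0"
  using flat_normal_normalizer_pos by (simp add: flat_normal_def)

lemma nn_integral_flat_normal: "(\<integral>\<^sup>+y. ennreal (flat_normal \<sigma> b (y - h)) \<partial>lborel) = 1"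
proof -
  let ?Z = "\<sigma> * sqrt (2 * pi) + 2 * b"
  have "(\<integral>\<^sup>+y. ennreal (flat_normal \<sigma> b (y - h)) \<partial>lborel) = (\<integral>\<^sup>+y. ennreal (flat_normal \<sigma> b y) \<partial>lborel)"
    by (subst nn_integral_real_affine[where c = 1 and t = h]) auto
  also have "\<dots> = (\<integral>\<^sup>+y. ennreal (1 / ?Z) * ennreal (exp (- (soft_threshold b y - 0)\<^sup>2 / (2 * \<sigma>\<^sup>2))) \<partial>lborel)"
    using flat_normal_normalizer_pos by (intro nn_integral_cong) (simp add: flat_normal_def flip: ennreal_mult)
  also have "\<dots> = ennreal (1 / ?Z) * (\<integral>\<^sup>+y. ennreal (exp (- (soft_threshold b y - 0)\<^sup>2 / (2 * \<sigma>\<^sup>2))) \<partial>lborel)"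
    by (rule nn_integral_cmult) measurable
  also have "(\<integral>\<^sup>+y. ennreal (exp (- (soft_threshold b y - 0)\<^sup>2 / (2 * \<sigma>\<^sup>2))) \<partial>lborel) = ennreal (2 * b) * 1 + ennreal (\<sigma> * sqrt (2 * pi))"
    using nn_integral_soft_threshold[OF b, of "\<lambda>u. ennreal (exp (- (u - 0)\<^sup>2 / (2 * \<sigma>\<^sup>2)))"] nn_integral_gaussian[OF \<sigma>, of 0] by simp
  also have "\<dots> = ennreal ?Z" using b \<sigma> by (simp add: ac_simps flip: ennreal_plus)
  also have "ennreal (1 / ?Z) * ennreal ?Z = 1" using flat_normal_normalizer_pos by (simp flip: ennreal_mult)
  finally show ?thesis .
qed

text \<open>The right side is the value for unflattened normal densities. The exponents compare
  pointwise, and the remaining integral is at most the normalizer because the plateau contributes at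
  most 2b.\<close>

lemma flat_normal_chi_square:
  "(\<integral>\<^sup>+y. ennreal ((flat_normal \<sigma> b (y - h))\<^sup>2 / flat_normal \<sigma> b y) \<partial>lborel) \<le> ennreal (exp (h\<^sup>2 / \<sigma>\<^sup>2))"
proof -
  let ?Z = "\<sigma> * sqrt (2 * pi) + 2 * b"
  let ?D = "soft_threshold b"
  note Z = flat_normal_normalizer_pos
  have "(\<integral>\<^sup>+y. ennreal ((flat_normal \<sigma> b (y - h))\<^sup>2 / flat_normal \<sigma> b y) \<partial>lborel)
      = (\<integral>\<^sup>+w. ennreal ((flat_normal \<sigma> b w)\<^sup>2 / flat_normal \<sigma> b (w + h)) \<partial>lborel)"
    by (subst nn_integral_real_affine[where c = 1 and t = h]) (auto simp: add.commute)
  also have "\<dots> \<le> (\<integral>\<^sup>+w. ennreal (exp (h\<^sup>2 / \<sigma>\<^sup>2) / ?Z) * ennreal (exp (- (?D w - h)\<^sup>2 / (2 * \<sigma>\<^sup>2))) \<partial>lborel)"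
  proof (rule nn_integral_mono)
    fix w
    have "(?D (w + h))\<^sup>2 \<le> (?D w + h)\<^sup>2" using abs_soft_threshold_add_le[OF b] by (simp add: abs_le_square_iff)
    \<comment> \<open>Completing the square: -2 D^2 + (D + h)^2 = 2 h^2 - (D - h)^2.\<close>
    then have "- 2 * (?D w)\<^sup>2 + (?D (w + h))\<^sup>2 \<le> 2 * h\<^sup>2 - (?D w - h)\<^sup>2"
      by (simp add: power2_eq_square algebra_simps)
    then have "(- 2 * (?D w)\<^sup>2 + (?D (w + h))\<^sup>2) / (2 * \<sigma>\<^sup>2) \<le> (2 * h\<^sup>2 - (?D w - h)\<^sup>2) / (2 * \<sigma>\<^sup>2)"
      by (rule divide_right_mono) simp
    then have "exp ((- 2 * (?D w)\<^sup>2 + (?D (w + h))\<^sup>2) / (2 * \<sigma>\<^sup>2)) / ?Z \<le> exp ((2 * h\<^sup>2 - (?D w - h)\<^sup>2) / (2 * \<sigma>\<^sup>2)) / ?Z"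
      using Z by (intro divide_right_mono) auto
    also have "exp ((2 * h\<^sup>2 - (?D w - h)\<^sup>2) / (2 * \<sigma>\<^sup>2)) = exp (h\<^sup>2 / \<sigma>\<^sup>2) * exp (- (?D w - h)\<^sup>2 / (2 * \<sigma>\<^sup>2))"
      using \<sigma> by (simp add: diff_divide_distrib flip: exp_add)
    also have "exp ((- 2 * (?D w)\<^sup>2 + (?D (w + h))\<^sup>2) / (2 * \<sigma>\<^sup>2)) / ?Z = (flat_normal \<sigma> b w)\<^sup>2 / flat_normal \<sigma> b (w + h)"
    proof -
      have e: "exp ((- 2 * x\<^sup>2 + y\<^sup>2) / (2 * \<sigma>\<^sup>2)) = (exp (- x\<^sup>2 / (2 * \<sigma>\<^sup>2)))\<^sup>2 / exp (- y\<^sup>2 / (2 * \<sigma>\<^sup>2))" for x y :: real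
        using \<sigma> by (simp add: power2_eq_square[of "exp _"] field_simps flip: exp_add exp_diff)
      show ?thesis unfolding e flat_normal_def using Z by (simp add: power2_eq_square)
    qed
    finally show "ennreal ((flat_normal \<sigma> b w)\<^sup>2 / flat_normal \<sigma> b (w + h))
        \<le> ennreal (exp (h\<^sup>2 / \<sigma>\<^sup>2) / ?Z) * ennreal (exp (- (?D w - h)\<^sup>2 / (2 * \<sigma>\<^sup>2)))"
      using Z by (subst ennreal_mult[symmetric]) (auto intro!: ennreal_leI)
  qed
  also have "\<dots> = ennreal (exp (h\<^sup>2 / \<sigma>\<^sup>2) / ?Z) * (\<integral>\<^sup>+w. ennreal (exp (- (?D w - h)\<^sup>2 / (2 * \<sigma>\<^sup>2))) \<partial>lborel)"
    by (rule nn_integral_cmult) measurable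
  also have "(\<integral>\<^sup>+w. ennreal (exp (- (?D w - h)\<^sup>2 / (2 * \<sigma>\<^sup>2))) \<partial>lborel)
      = ennreal (2 * b) * ennreal (exp (- (0 - h)\<^sup>2 / (2 * \<sigma>\<^sup>2))) + ennreal (\<sigma> * sqrt (2 * pi))"
    using nn_integral_soft_threshold[OF b, of "\<lambda>u. ennreal (exp (- (u - h)\<^sup>2 / (2 * \<sigma>\<^sup>2)))"] nn_integral_gaussian[OF \<sigma>, of h] by simp
  also have "\<dots> \<le> ennreal (2 * b) * 1 + ennreal (\<sigma> * sqrt (2 * pi))"
    by (intro add_mono mult_left_mono) (auto simp: ennreal_le_1)
  also have "\<dots> = ennreal ?Z" using b \<sigma> by (simp add: ac_simps flip: ennreal_plus)
  also have "ennreal (exp (h\<^sup>2 / \<sigma>\<^sup>2) / ?Z) * ennreal ?Z = ennreal (exp (h\<^sup>2 / \<sigma>\<^sup>2))"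
    using Z by (simp flip: ennreal_mult)
  finally show ?thesis by (simp add: mult_left_mono)
qed

end

context
  fixes \<sigma> \<epsilon> :: real
  assumes \<sigma>: "\<sigma> > 0" and \<epsilon>: "0 \<le> \<epsilon>" "\<epsilon> \<le> 1"
begin

lemma sigma_eps_nonneg: "\<sigma> * \<epsilon> \<ge> 0" using \<sigma> \<epsilon> by simp

text \<open>This domination leaves a nonnegative remainder for the contamination to fill. The
  exponents compare because the shifted y is at most \<bar>y - m\<bar> away from the plateau, and
  the plateau raises the normalizer by only 2 \<sigma> \<epsilon>.\<close>

lemma normal_le_flat_normal:
  "(1 - \<epsilon>) * normal_density m \<sigma> y \<le> flat_normal \<sigma> (\<sigma> * \<epsilon>) (y - soft_threshold (\<sigma> * \<epsilon>) m)"
proof -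
  let ?d = "soft_threshold (\<sigma> * \<epsilon>) (y - soft_threshold (\<sigma> * \<epsilon>) m)"
  have "?d\<^sup>2 \<le> (y - m)\<^sup>2" using abs_soft_threshold_diff_le[OF sigma_eps_nonneg] by (simp add: abs_le_square_iff)
  then have e: "exp (- (y - m)\<^sup>2 / (2 * \<sigma>\<^sup>2)) \<le> exp (- ?d\<^sup>2 / (2 * \<sigma>\<^sup>2))"
    using \<sigma> by (simp add: divide_right_mono)
  define s where "s = sqrt (2 * pi)"
  \<comment> \<open>For \<epsilon> > 0 the normalizers compare exactly when 2 (1 - \<epsilon>) \<le>
    sqrt(2 pi); this is what permits the half-width \<sigma> \<epsilon>.\<close>
  have "2 \<le> s" unfolding s_def using pi_gt3 by (intro real_le_rsqrt) auto
  then have s: "s > 0" "(1 - \<epsilon>) * (s + 2 * \<epsilon>) \<le> s"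
  proof -
    have "2 * \<epsilon> * (1 - \<epsilon>) \<le> 2 * \<epsilon> * 1" using \<epsilon> by (intro mult_left_mono) auto
    also have "\<dots> \<le> s * \<epsilon>" using \<epsilon> \<open>2 \<le> s\<close> by (simp add: mult_right_mono)
    finally show "(1 - \<epsilon>) * (s + 2 * \<epsilon>) \<le> s" by (simp add: algebra_simps)
  qed (use \<open>2 \<le> s\<close> in simp)
  have "(1 - \<epsilon>) / (\<sigma> * s) \<le> 1 / (\<sigma> * s + 2 * (\<sigma> * \<epsilon>))"
  proof -
    have "(1 - \<epsilon>) / s \<le> 1 / (s + 2 * \<epsilon>)" using s \<epsilon> by (simp add: field_simps)
    then have "(1 - \<epsilon>) / s / \<sigma> \<le> 1 / (s + 2 * \<epsilon>) / \<sigma>" using \<sigma> by (intro divide_right_mono) auto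
    then show ?thesis by (simp add: distrib_left mult_ac)
  qed
  then have "(1 - \<epsilon>) / (\<sigma> * s) * exp (- (y - m)\<^sup>2 / (2 * \<sigma>\<^sup>2)) \<le> 1 / (\<sigma> * s + 2 * (\<sigma> * \<epsilon>)) * exp (- ?d\<^sup>2 / (2 * \<sigma>\<^sup>2))"
    using e \<sigma> s \<epsilon> by (intro mult_mono) auto
  then show ?thesis using \<sigma> by (simp add: normal_density_def flat_normal_def s_def real_sqrt_mult mult_ac)
qed

text \<open>Solves the mixture equation for the contamination. At \<epsilon> = 0 there is nothing to
  solve, and the normal density is a default that still gives a probability kernel.\<close>

definition hiding_density :: "real \<Rightarrow> real \<Rightarrow> real" where
  "hiding_density m y = (if \<epsilon> = 0 then normal_density m \<sigma> y else
     (flat_normal \<sigma> (\<sigma> * \<epsilon>) (y - soft_threshold (\<sigma> * \<epsilon>) m) - (1 - \<epsilon>) * normal_density m \<sigma> y) / \<epsilon>)"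

lemma hiding_density_nonneg: "hiding_density m y \<ge> 0"
  using normal_le_flat_normal[of m y] \<epsilon> by (auto simp: hiding_density_def)

text \<open>At \<epsilon> = 0 it rests on \<open>soft_threshold 0\<close> being the identity, so
  that the flat density is the normal one.\<close>

lemma hiding_density_mixture:
  "(1 - \<epsilon>) * normal_density m \<sigma> y + \<epsilon> * hiding_density m y
    = flat_normal \<sigma> (\<sigma> * \<epsilon>) (y - soft_threshold (\<sigma> * \<epsilon>) m)"
  using \<sigma> by (auto simp: hiding_density_def flat_normal_def normal_density_def soft_threshold_def real_sqrt_mult mult_ac)

lemma borel_measurable_hiding_density [measurable]:
  "(\<lambda>z. hiding_density (fst z) (snd z)) \<in> borel_measurable (borel \<Otimes>\<^sub>M borel)"
proof -
  have [measurable]: "(\<lambda>z. normal_density (fst z) \<sigma> (snd z)) \<in> borel_measurable (borel \<Otimes>\<^sub>M borel)"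
    unfolding normal_density_def by measurable
  show ?thesis unfolding hiding_density_def by measurable
qed

lemma borel_measurable_hiding_density1 [measurable]: "hiding_density m \<in> borel_measurable borel"
  unfolding hiding_density_def by measurable

lemma nn_integral_hiding_density: "(\<integral>\<^sup>+y. ennreal (hiding_density m y) \<partial>lborel) = 1"
proof (cases "\<epsilon> = 0")
  case True
  interpret N: prob_space "normal_law m \<sigma>" by (rule prob_space_normal_density[OF \<sigma>])
  have "hiding_density m y = normal_density m \<sigma> y" for y
    unfolding hiding_density_def using True by simp
  then show ?thesis using N.emeasure_space_1 by (simp add: emeasure_density)
next
  case False
  interpret N: prob_space "normal_law m \<sigma>" by (rule prob_space_normal_density[OF \<sigma>])
  have n: "(\<integral>\<^sup>+y. ennreal (normal_density m \<sigma> y) \<partial>lborel) = 1"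
    using N.emeasure_space_1 by (simp add: emeasure_density)
  have "1 = (\<integral>\<^sup>+y. ennreal (flat_normal \<sigma> (\<sigma> * \<epsilon>) (y - soft_threshold (\<sigma> * \<epsilon>) m)) \<partial>lborel)"
    by (rule nn_integral_flat_normal[OF \<sigma> sigma_eps_nonneg, symmetric])
  also have "\<dots> = (\<integral>\<^sup>+y. ennreal (1 - \<epsilon>) * ennreal (normal_density m \<sigma> y) + ennreal \<epsilon> * ennreal (hiding_density m y) \<partial>lborel)"
    unfolding hiding_density_mixture[symmetric]
    using \<epsilon> hiding_density_nonneg by (intro nn_integral_cong) (simp add: ennreal_mult ennreal_plus)
  also have "\<dots> = ennreal (1 - \<epsilon>) + ennreal \<epsilon> * (\<integral>\<^sup>+y. ennreal (hiding_density m y) \<partial>lborel)"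
    by (simp add: nn_integral_add nn_integral_cmult n)
  finally have eq: "1 = ennreal (1 - \<epsilon>) + ennreal \<epsilon> * (\<integral>\<^sup>+y. ennreal (hiding_density m y) \<partial>lborel)" .
  have "1 = ennreal (1 - \<epsilon>) + ennreal \<epsilon>" using \<epsilon> by (simp flip: ennreal_plus)
  from eq[unfolded this] have "ennreal \<epsilon> = ennreal \<epsilon> * (\<integral>\<^sup>+y. ennreal (hiding_density m y) \<partial>lborel)"
    unfolding ennreal_add_left_cancel by (rule disjE) (simp_all only: infinity_ennreal_def ennreal_neq_top)
  then have "ennreal \<epsilon> * 1 = ennreal \<epsilon> * (\<integral>\<^sup>+y. ennreal (hiding_density m y) \<partial>lborel)" by (simp only: mult_1_right)
  then show ?thesis using False \<epsilon> unfolding ennreal_mult_cancel_left by auto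
qed

definition hiding_kernel :: "nat \<Rightarrow> (nat \<Rightarrow> real) \<Rightarrow> (nat \<Rightarrow> real) \<Rightarrow> real measure" where
  "hiding_kernel p \<beta> x = density lborel (\<lambda>y. ennreal (hiding_density (dot p x \<beta>) y))"

lemma hiding_kernel: "hiding_kernel p \<beta> \<in> contamination_kernels p"
proof (rule measurable_prob_algebraI)
  show prob: "prob_space (hiding_kernel p \<beta> x)" for x
    by standard (simp add: hiding_kernel_def emeasure_density nn_integral_hiding_density)
  show "hiding_kernel p \<beta> \<in> Rp p \<rightarrow>\<^sub>M subprob_algebra borel"
  proof (rule measurable_subprob_algebra)
    show "subprob_space (hiding_kernel p \<beta> x)" for x
      using prob by (rule prob_space_imp_subprob_space)
    show "(\<lambda>x. emeasure (hiding_kernel p \<beta> x) B) \<in> borel_measurable (Rp p)" if B[measurable]: "B \<in> sets borel" for B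
    proof -
      have [measurable]: "(\<lambda>z. hiding_density (dot p (fst z) \<beta>) (snd z)) \<in> borel_measurable (Rp p \<Otimes>\<^sub>M borel)"
        using measurable_compose[OF _ borel_measurable_hiding_density, of "\<lambda>z. (dot p (fst z) \<beta>, snd z)" "Rp p \<Otimes>\<^sub>M borel"]
        by simp
      have "(\<lambda>x. emeasure (hiding_kernel p \<beta> x) B) = (\<lambda>x. \<integral>\<^sup>+y. ennreal (hiding_density (dot p x \<beta>) y) * indicator B y \<partial>lborel)"
        unfolding hiding_kernel_def by (intro ext emeasure_density) auto
      also have "\<dots> \<in> borel_measurable (Rp p)"
      proof (rule lborel.borel_measurable_nn_integral)
        show "(\<lambda>(x, y). ennreal (hiding_density (dot p x \<beta>) y) * indicator B y) \<in> borel_measurable (Rp p \<Otimes>\<^sub>M lborel)"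
          unfolding measurable_cong_sets[OF sets_pair_measure_cong[OF refl sets_lborel] refl] case_prod_unfold by measurable
      qed
      finally show ?thesis .
    qed
  qed (simp add: hiding_kernel_def)
qed

lemma emeasure_response_law_hiding:
  assumes x: "x \<in> space (Rp p)" and B: "B \<in> sets borel"
  shows "emeasure (response_law p \<epsilon> \<sigma> \<beta> (hiding_kernel p \<beta>) x) B =
    (\<integral>\<^sup>+y. ennreal (flat_normal \<sigma> (\<sigma> * \<epsilon>) (y - soft_threshold (\<sigma> * \<epsilon>) (dot p x \<beta>))) * indicator B y \<partial>lborel)"
proof -
  let ?m = "dot p x \<beta>"
  have "emeasure (response_law p \<epsilon> \<sigma> \<beta> (hiding_kernel p \<beta>) x) B =
      ennreal (1 - \<epsilon>) * (\<integral>\<^sup>+y. ennreal (normal_density ?m \<sigma> y) * indicator B y \<partial>lborel) +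
      ennreal \<epsilon> * (\<integral>\<^sup>+y. ennreal (hiding_density ?m y) * indicator B y \<partial>lborel)"
    using B by (simp add: emeasure_response_law[OF \<epsilon> \<sigma> hiding_kernel x B] hiding_kernel_def emeasure_density)
  also have "\<dots> = (\<integral>\<^sup>+y. ennreal (1 - \<epsilon>) * (ennreal (normal_density ?m \<sigma> y) * indicator B y)
      + ennreal \<epsilon> * (ennreal (hiding_density ?m y) * indicator B y) \<partial>lborel)"
    using B by (simp add: nn_integral_add nn_integral_cmult)
  also have "\<dots> = (\<integral>\<^sup>+y. ennreal (flat_normal \<sigma> (\<sigma> * \<epsilon>) (y - soft_threshold (\<sigma> * \<epsilon>) ?m)) * indicator B y \<partial>lborel)"
    unfolding hiding_density_mixture[symmetric]
    using \<epsilon> hiding_density_nonneg by (intro nn_integral_cong) (simp add: ennreal_mult ennreal_plus indicator_def)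
  finally show ?thesis .
qed

text \<open>The base measure does not involve \<beta>, so the laws of different regression vectors
  can be compared through their densities.\<close>

lemma observation_law_hiding:
  assumes \<mu>: "prob_space \<mu>" "sets \<mu> = sets (Rp p)"
  shows "observation_law p \<mu> \<epsilon> \<sigma> \<beta> (hiding_kernel p \<beta>) = density (\<mu> \<Otimes>\<^sub>M lborel)
    (\<lambda>z. ennreal (flat_normal \<sigma> (\<sigma> * \<epsilon>) (snd z - soft_threshold (\<sigma> * \<epsilon>) (dot p (fst z) \<beta>))))"
proof (rule measure_eqI)
  have s: "sets (\<mu> \<Otimes>\<^sub>M lborel) = sets (Rp p \<Otimes>\<^sub>M borel)" by (intro sets_pair_measure_cong \<mu>) simp
  note so = sets_observation_law[OF \<epsilon> \<sigma> hiding_kernel \<mu>]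
  show "sets (observation_law p \<mu> \<epsilon> \<sigma> \<beta> (hiding_kernel p \<beta>)) = sets (density (\<mu> \<Otimes>\<^sub>M lborel)
    (\<lambda>z. ennreal (flat_normal \<sigma> (\<sigma> * \<epsilon>) (snd z - soft_threshold (\<sigma> * \<epsilon>) (dot p (fst z) \<beta>)))))"
    unfolding so sets_density s ..
  fix A assume "A \<in> sets (observation_law p \<mu> \<epsilon> \<sigma> \<beta> (hiding_kernel p \<beta>))"
  then have A: "A \<in> sets (Rp p \<Otimes>\<^sub>M borel)" by (simp add: so)
  have [measurable]: "(\<lambda>z. flat_normal \<sigma> (\<sigma> * \<epsilon>) (snd z - soft_threshold (\<sigma> * \<epsilon>) (dot p (fst z) \<beta>))) \<in> borel_measurable (\<mu> \<Otimes>\<^sub>M lborel)"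
    unfolding measurable_cong_sets[OF s refl] by measurable
  have A'[measurable]: "A \<in> sets (\<mu> \<Otimes>\<^sub>M lborel)" unfolding s by (rule A)
  have "emeasure (observation_law p \<mu> \<epsilon> \<sigma> \<beta> (hiding_kernel p \<beta>)) A
      = (\<integral>\<^sup>+x. (\<integral>\<^sup>+y. ennreal (flat_normal \<sigma> (\<sigma> * \<epsilon>) (y - soft_threshold (\<sigma> * \<epsilon>) (dot p x \<beta>))) * indicator A (x, y) \<partial>lborel) \<partial>\<mu>)"
    unfolding emeasure_observation_law[OF \<epsilon> \<sigma> hiding_kernel \<mu> A]
  proof (rule nn_integral_cong)
    fix x assume "x \<in> space \<mu>"
    then have x: "x \<in> space (Rp p)" using sets_eq_imp_space_eq[OF \<mu>(2)] by simp
    show "emeasure (response_law p \<epsilon> \<sigma> \<beta> (hiding_kernel p \<beta>) x) (Pair x -` A)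
      = (\<integral>\<^sup>+y. ennreal (flat_normal \<sigma> (\<sigma> * \<epsilon>) (y - soft_threshold (\<sigma> * \<epsilon>) (dot p x \<beta>))) * indicator A (x, y) \<partial>lborel)"
      unfolding emeasure_response_law_hiding[OF x sets_Pair1[OF A]]
      by (intro nn_integral_cong) (simp add: indicator_def)
  qed
  also have "\<dots> = (\<integral>\<^sup>+z. ennreal (flat_normal \<sigma> (\<sigma> * \<epsilon>) (snd z - soft_threshold (\<sigma> * \<epsilon>) (dot p (fst z) \<beta>))) * indicator A z \<partial>(\<mu> \<Otimes>\<^sub>M lborel))"
    by (subst lborel.nn_integral_fst[symmetric]) auto
  also have "\<dots> = emeasure (density (\<mu> \<Otimes>\<^sub>M lborel)
    (\<lambda>z. ennreal (flat_normal \<sigma> (\<sigma> * \<epsilon>) (snd z - soft_threshold (\<sigma> * \<epsilon>) (dot p (fst z) \<beta>))))) A"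
    by (rule emeasure_density[symmetric]) measurable
  finally show "emeasure (observation_law p \<mu> \<epsilon> \<sigma> \<beta> (hiding_kernel p \<beta>)) A = \<dots>" .
qed

end

lemma PiM_density:
  fixes f :: "'a \<Rightarrow> ennreal"
  assumes M: "sigma_finite_measure M" and f [measurable]: "f \<in> borel_measurable M"
    and prob: "prob_space (density M f)" and I: "finite I"
  shows "Pi\<^sub>M I (\<lambda>_. density M f) = density (Pi\<^sub>M I (\<lambda>_. M)) (\<lambda>x. \<Prod>i\<in>I. f (x i))"
proof -
  interpret M: product_sigma_finite "\<lambda>_. M" using M by (simp add: product_sigma_finite_def)
  interpret D: product_sigma_finite "\<lambda>_. density M f"
    using prob by (simp add: product_sigma_finite_def prob_space_imp_sigma_finite)
  show ?thesis
  proof (rule D.PiM_eqI[symmetric, OF I])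
    show "sets (density (Pi\<^sub>M I (\<lambda>_. M)) (\<lambda>x. \<Prod>i\<in>I. f (x i))) = sets (Pi\<^sub>M I (\<lambda>_. density M f))"
      by (simp cong: sets_PiM_cong)
    fix A assume "\<And>i. i \<in> I \<Longrightarrow> A i \<in> sets (density M f)"
    then have A[measurable]: "\<And>i. i \<in> I \<Longrightarrow> A i \<in> sets M" by simp
    have "emeasure (density (Pi\<^sub>M I (\<lambda>_. M)) (\<lambda>x. \<Prod>i\<in>I. f (x i))) (Pi\<^sub>E I A)
        = (\<integral>\<^sup>+x. (\<Prod>i\<in>I. f (x i)) * indicator (Pi\<^sub>E I A) x \<partial>Pi\<^sub>M I (\<lambda>_. M))"
      using I A by (intro emeasure_density) (auto intro!: borel_measurable_prod_ennreal sets_PiM_I_finite)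
    also have "\<dots> = (\<integral>\<^sup>+x. (\<Prod>i\<in>I. f (x i) * indicator (A i) (x i)) \<partial>Pi\<^sub>M I (\<lambda>_. M))"
    proof (rule nn_integral_cong)
      fix x assume x: "x \<in> space (Pi\<^sub>M I (\<lambda>_. M))"
      have "indicator (Pi\<^sub>E I A) x = (\<Prod>i\<in>I. indicator (A i) (x i) :: ennreal)"
      proof (cases "x \<in> Pi\<^sub>E I A")
        case False
        then obtain i where "i \<in> I" "x i \<notin> A i" using x by (auto simp: space_PiM PiE_iff)
        then show ?thesis using False I by (auto simp: prod_zero_iff intro!: bexI[of _ i])
      qed (auto simp: PiE_iff intro!: prod.neutral[symmetric])
      then show "(\<Prod>i\<in>I. f (x i)) * indicator (Pi\<^sub>E I A) x = (\<Prod>i\<in>I. f (x i) * indicator (A i) (x i))"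
        by (simp add: prod.distrib)
    qed
    also have "\<dots> = (\<Prod>i\<in>I. \<integral>\<^sup>+z. f z * indicator (A i) z \<partial>M)"
      by (rule M.product_nn_integral_prod[OF I]) (use A in measurable)
    also have "\<dots> = (\<Prod>i\<in>I. emeasure (density M f) (A i))"
      using A by (intro prod.cong refl emeasure_density[symmetric]) auto
    finally show "emeasure (density (Pi\<^sub>M I (\<lambda>_. M)) (\<lambda>x. \<Prod>i\<in>I. f (x i))) (Pi\<^sub>E I A)
        = (\<Prod>i\<in>I. emeasure (density M f) (A i))" .
  qed
qed

section \<open>Likelihood ratios over a grid\<close>

text \<open>To be used with \<open>a\<close> and \<open>b\<close> the likelihoods under a grid
  vector and under zero, \<open>V\<close> the sum of conditional chi-square exponents, and k = p.
  Large \<open>V\<close> is charged to its first moment. For small \<open>V\<close> the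
  arithmetic-geometric mean inequality splits \<open>a\<close> into a damped second moment and a
  multiple of \<open>b\<close>.\<close>

lemma likelihood_ratio_split:
  fixes a b V k :: real
  assumes a: "a \<ge> 0" and b: "b > 0" and k: "k > 0" and V: "V \<ge> 0"
  shows "a \<le> a * (V / k) + 1 / 8 * (exp (- V) * a\<^sup>2 / b) + 2 * exp k * b"
proof (cases "V \<ge> k")
  case True
  then have "a * 1 \<le> a * (V / k)" using a k by (intro mult_left_mono) auto
  moreover have "0 \<le> 1 / 8 * (exp (- V) * a\<^sup>2 / b) + 2 * exp k * b" using b by simp
  ultimately show ?thesis by linarith
next
  case False
  define c where "c = exp (- k)"
  have c: "c > 0" "exp k = 1 / c" by (auto simp: c_def exp_minus field_simps)
  \<comment> \<open>After division by 8bc this says a \<le> (1/8) c a^2 / b + 2 b / c.\<close>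
  have "0 \<le> (c * a - 4 * b)\<^sup>2" by simp
  then have "c * a * (8 * b) \<le> (c * a)\<^sup>2 + 16 * b\<^sup>2" by (simp add: power2_eq_square algebra_simps)
  then have "c * a * (8 * b) / (8 * b * c) \<le> ((c * a)\<^sup>2 + 16 * b\<^sup>2) / (8 * b * c)"
    using b c by (intro divide_right_mono) auto
  also have "c * a * (8 * b) / (8 * b * c) = a" using b c by simp
  also have "((c * a)\<^sup>2 + 16 * b\<^sup>2) / (8 * b * c) = 1 / 8 * (c * a\<^sup>2 / b) + 2 * exp k * b"
    unfolding c(2) using b c(1) by (simp add: add_divide_distrib power2_eq_square)
  finally have "a \<le> 1 / 8 * (c * a\<^sup>2 / b) + 2 * exp k * b" .
  moreover have "1 / 8 * (c * a\<^sup>2 / b) \<le> 1 / 8 * (exp (- V) * a\<^sup>2 / b)"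
    using b False unfolding c_def by (intro mult_left_mono divide_right_mono mult_right_mono) auto
  moreover have "0 \<le> a * (V / k)" using a k V by simp
  ultimately show ?thesis by linarith
qed

text \<open>The 1/4 is 1/8 from the first moment of \<open>V\<close>, by \<open>moment\<close>, plus
  1/8 from the damped second moment. The rest is an event probability under one fixed law, which can
  be summed over all grid vectors.\<close>

lemma sample_law_hiding_le:
  fixes \<sigma> \<epsilon> :: real and n p :: nat
  assumes \<sigma>: "\<sigma> > 0" and \<epsilon>: "0 \<le> \<epsilon>" "\<epsilon> \<le> 1" and \<mu>: "prob_space \<mu>" "sets \<mu> = sets (Rp p)" and p: "p \<ge> 1"
    and moment: "ennreal (real n) * (\<integral>\<^sup>+x. ennreal ((soft_threshold (\<sigma> * \<epsilon>) (dot p x \<beta>))\<^sup>2 / \<sigma>\<^sup>2) \<partial>\<mu>) \<le> ennreal (real p / 8)"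
    and S: "S \<in> sets (sample_space n p)"
  defines "P0 \<equiv> sample_law n p \<mu> \<epsilon> \<sigma> (\<lambda>_. 0) (hiding_kernel \<sigma> \<epsilon> p (\<lambda>_. 0))"
  shows "emeasure (sample_law n p \<mu> \<epsilon> \<sigma> \<beta> (hiding_kernel \<sigma> \<epsilon> p \<beta>)) S
    \<le> ennreal (1 / 4) + ennreal (2 * exp (real p)) * emeasure P0 S"
proof -
  interpret mu: prob_space \<mu> by (rule \<mu>)
  interpret pair: pair_sigma_finite \<mu> lborel by standard
  define b where "b = \<sigma> * \<epsilon>"
  have b: "b \<ge> 0" using \<sigma> \<epsilon> by (simp add: b_def)
  let ?B = "\<mu> \<Otimes>\<^sub>M (lborel :: real measure)"
  let ?I = "{..<n}"
  let ?PB = "Pi\<^sub>M ?I (\<lambda>_. ?B)"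
  define D where "D x = soft_threshold b (dot p x \<beta>)" for x
  define h where "h x = (D x)\<^sup>2 / \<sigma>\<^sup>2" for x
  define f where "f z = flat_normal \<sigma> b (snd z - D (fst z))" for z
  define f0 where "f0 z = flat_normal \<sigma> b (snd z)" for z :: "(nat \<Rightarrow> real) \<times> real"
  \<comment> \<open>Conditionally on the covariate, \<open>exp (- h)\<close> cancels the bound of
    \<open>flat_normal_chi_square\<close>. Hence \<open>g\<close> integrates to at most 1, and so
    does its n-fold product.\<close>
  define g where "g z = exp (- h (fst z)) * (f z)\<^sup>2 / f0 z" for z
  have sB: "sets ?B = sets (Rp p \<Otimes>\<^sub>M borel)" by (intro sets_pair_measure_cong \<mu>) simp
  have D_meas [measurable]: "D \<in> borel_measurable \<mu>"
    unfolding D_def measurable_cong_sets[OF \<mu>(2) refl] by measurable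
  have h_meas [measurable]: "h \<in> borel_measurable \<mu>" unfolding h_def by measurable
  have f_meas [measurable]: "f \<in> borel_measurable ?B" unfolding f_def by measurable
  have f0_meas [measurable]: "f0 \<in> borel_measurable ?B" unfolding f0_def by measurable
  have g_meas [measurable]: "g \<in> borel_measurable ?B" unfolding g_def by measurable
  have pos: "f z > 0" "f0 z > 0" "g z \<ge> 0" "h x \<ge> 0" for z x
    using flat_normal_pos[OF \<sigma> b] by (simp_all add: f_def f0_def g_def h_def less_imp_le)
  have obs: "observation_law p \<mu> \<epsilon> \<sigma> \<beta> (hiding_kernel \<sigma> \<epsilon> p \<beta>) = density ?B (\<lambda>z. ennreal (f z))"
    using observation_law_hiding[OF \<sigma> \<epsilon> \<mu>, of \<beta>] by (simp add: f_def D_def b_def)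
  interpret O: prob_space "density ?B (\<lambda>z. ennreal (f z))"
    unfolding obs[symmetric] by (rule prob_space_observation_law[OF \<epsilon> \<sigma> hiding_kernel[OF \<sigma> \<epsilon>] \<mu>])
  have obs0: "observation_law p \<mu> \<epsilon> \<sigma> (\<lambda>_. 0) (hiding_kernel \<sigma> \<epsilon> p (\<lambda>_. 0)) = density ?B (\<lambda>z. ennreal (f0 z))"
    using observation_law_hiding[OF \<sigma> \<epsilon> \<mu>, of "\<lambda>_. 0"] b by (simp add: f0_def b_def dot_def soft_threshold_def)
  have prob0: "prob_space (density ?B (\<lambda>z. ennreal (f0 z)))"
    unfolding obs0[symmetric] by (rule prob_space_observation_law[OF \<epsilon> \<sigma> hiding_kernel[OF \<sigma> \<epsilon>] \<mu>])
  have sfB: "sigma_finite_measure ?B" by (rule pair.sigma_finite_measure_axioms)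
  interpret PB: product_sigma_finite "\<lambda>_::nat. ?B" using sfB by (simp add: product_sigma_finite_def)
  have P1: "sample_law n p \<mu> \<epsilon> \<sigma> \<beta> (hiding_kernel \<sigma> \<epsilon> p \<beta>) = density ?PB (\<lambda>x. \<Prod>i\<in>?I. ennreal (f (x i)))"
    unfolding sample_law_def obs by (rule PiM_density[OF sfB _ O.prob_space_axioms]) auto
  have P0: "P0 = density ?PB (\<lambda>x. \<Prod>i\<in>?I. ennreal (f0 (x i)))"
    unfolding P0_def sample_law_def obs0 by (rule PiM_density[OF sfB _ prob0]) auto
  have sP: "sets ?PB = sets (sample_space n p)" by (intro sets_PiM_cong refl sB)
  have S' [measurable]: "S \<in> sets ?PB" unfolding sP by (rule S)
  let ?F = "\<lambda>x. \<Prod>i\<in>?I. ennreal (f (x i))" and ?N = "\<lambda>x. \<Prod>i\<in>?I. ennreal (f0 (x i))"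
    and ?G = "\<lambda>x. \<Prod>i\<in>?I. ennreal (g (x i))"
  have prod_f [measurable]: "?F \<in> borel_measurable ?PB"
    by (intro borel_measurable_prod_ennreal) measurable
  have prod_f0 [measurable]: "?N \<in> borel_measurable ?PB"
    by (intro borel_measurable_prod_ennreal) measurable
  have prod_g [measurable]: "?G \<in> borel_measurable ?PB"
    by (intro borel_measurable_prod_ennreal) measurable
  have h_comp: "(\<lambda>x. ennreal (h (fst (x i)))) \<in> borel_measurable ?PB" if "i \<in> {..<n}" for i
    using that by measurable
  define V where "V x = (\<Sum>i<n. h (fst (x i)))" for x :: "nat \<Rightarrow> (nat \<Rightarrow> real) \<times> real"
  have V_meas [measurable]: "V \<in> borel_measurable ?PB"
    unfolding V_def by measurable
  have V0: "V x \<ge> 0" for x unfolding V_def by (intro sum_nonneg pos)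
  have pointwise: "?F x * indicator S x
    \<le> ?F x * ennreal (V x / real p) + (ennreal (1 / 8) * ?G x
      + ennreal (2 * exp (real p)) * (?N x * indicator S x))" for x
  proof (cases "x \<in> S")
    case True
    define a where "a = (\<Prod>i\<in>?I. f (x i))"
    define b where "b = (\<Prod>i\<in>?I. f0 (x i))"
    have a: "a \<ge> 0" unfolding a_def by (intro prod_nonneg) (auto intro: less_imp_le pos)
    have b: "b > 0" unfolding b_def by (intro prod_pos) (auto intro: pos)
    have G: "(\<Prod>i\<in>?I. g (x i)) = exp (- V x) * a\<^sup>2 / b"
      by (simp add: g_def a_def b_def V_def prod.distrib prod_dividef exp_sum sum_negf[symmetric] prod_power_distrib)
    have "a \<le> a * (V x / real p) + (1 / 8 * (exp (- V x) * a\<^sup>2 / b) + 2 * exp (real p) * b)"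
      using likelihood_ratio_split[OF a b _ V0, of "real p" x] p by simp
    then have "ennreal a \<le> ennreal (a * (V x / real p) + (1 / 8 * (exp (- V x) * a\<^sup>2 / b) + 2 * exp (real p) * b))"
      by (rule ennreal_leI)
    also have "\<dots> = ennreal a * ennreal (V x / real p) + (ennreal (1 / 8) * ennreal (exp (- V x) * a\<^sup>2 / b) + ennreal (2 * exp (real p)) * ennreal b)"
    proof -
      have nn: "0 \<le> V x / real p" "0 \<le> exp (- V x) * a\<^sup>2 / b" "0 \<le> 2 * exp (real p) * b" "0 \<le> a * (V x / real p)"
        "0 \<le> 1 / 8 * (exp (- V x) * a\<^sup>2 / b)"
        using a b V0[of x] by simp_all
      have "ennreal (a * (V x / real p) + (1 / 8 * (exp (- V x) * a\<^sup>2 / b) + 2 * exp (real p) * b))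
          = ennreal (a * (V x / real p)) + (ennreal (1 / 8 * (exp (- V x) * a\<^sup>2 / b)) + ennreal (2 * exp (real p) * b))"
        using nn(3-5) by (simp only: ennreal_plus add_nonneg_nonneg)
      also have "ennreal (a * (V x / real p)) = ennreal a * ennreal (V x / real p)"
        using a nn(1) by (rule ennreal_mult)
      also have "ennreal (1 / 8 * (exp (- V x) * a\<^sup>2 / b)) = ennreal (1 / 8) * ennreal (exp (- V x) * a\<^sup>2 / b)"
        using nn(2) by (intro ennreal_mult) simp
      also have "ennreal (2 * exp (real p) * b) = ennreal (2 * exp (real p)) * ennreal b"
        using b by (intro ennreal_mult) auto
      finally show ?thesis .
    qed
    finally show ?thesis
      using True by (simp add: prod_ennreal pos less_imp_le G flip: a_def b_def)
  qed simp
  \<comment> \<open>\<open>h\<close> depends on the covariate alone, whose law is \<mu> under every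
    \<beta>; integrating out the response leaves an integral over \<mu>.\<close>
  have fst_eq: "(\<integral>\<^sup>+z. ennreal (f z) * ennreal (h (fst z)) \<partial>?B) = (\<integral>\<^sup>+x. ennreal (h x) \<partial>\<mu>)"
  proof -
    have "(\<integral>\<^sup>+z. ennreal (f z) * ennreal (h (fst z)) \<partial>?B)
        = (\<integral>\<^sup>+x. (\<integral>\<^sup>+y. ennreal (flat_normal \<sigma> b (y - D x)) * ennreal (h x) \<partial>lborel) \<partial>\<mu>)"
      by (subst lborel.nn_integral_fst[symmetric]) (auto simp: f_def)
    also have "\<dots> = (\<integral>\<^sup>+x. ennreal (h x) \<partial>\<mu>)"
      by (simp add: nn_integral_multc nn_integral_flat_normal[OF \<sigma> b])
    finally show ?thesis .
  qed
  have comp: "(\<integral>\<^sup>+x. ?F x * ennreal (h (fst (x i))) \<partial>?PB) = (\<integral>\<^sup>+x. ennreal (h x) \<partial>\<mu>)" if i: "i \<in> ?I" for i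
  proof -
    let ?O = "density ?B (\<lambda>z. ennreal (f z))"
    have m: "(\<lambda>x. x i) \<in> Pi\<^sub>M ?I (\<lambda>_. ?O) \<rightarrow>\<^sub>M ?O" using i by (rule measurable_component_singleton)
    have hm: "(\<lambda>z. ennreal (h (fst z))) \<in> borel_measurable ?O" by measurable
    have "(\<integral>\<^sup>+x. ?F x * ennreal (h (fst (x i))) \<partial>?PB)
        = (\<integral>\<^sup>+x. ennreal (h (fst (x i))) \<partial>density ?PB ?F)"
      using i by (intro nn_integral_density[symmetric] prod_f h_comp) simp
    also have "density ?PB ?F = Pi\<^sub>M ?I (\<lambda>_. ?O)"
      by (rule PiM_density[OF sfB _ O.prob_space_axioms, symmetric]) auto
    also have "(\<integral>\<^sup>+x. ennreal (h (fst (x i))) \<partial>Pi\<^sub>M ?I (\<lambda>_. ?O))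
        = (\<integral>\<^sup>+z. ennreal (h (fst z)) \<partial>distr (Pi\<^sub>M ?I (\<lambda>_. ?O)) ?O (\<lambda>x. x i))"
      by (rule nn_integral_distr[OF m, symmetric]) (use hm in simp)
    also have "distr (Pi\<^sub>M ?I (\<lambda>_. ?O)) ?O (\<lambda>x. x i) = ?O"
      by (rule distr_PiM_component[OF O.prob_space_axioms i])
    also have "(\<integral>\<^sup>+z. ennreal (h (fst z)) \<partial>?O) = (\<integral>\<^sup>+z. ennreal (f z) * ennreal (h (fst z)) \<partial>?B)"
      by (rule nn_integral_density) measurable
    finally show ?thesis using fst_eq by simp
  qed
  have term1: "(\<integral>\<^sup>+x. ?F x * ennreal (V x / real p) \<partial>?PB) \<le> ennreal (1 / 8)"
  proof -
    have "(\<integral>\<^sup>+x. ?F x * ennreal (V x / real p) \<partial>?PB)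
        = (\<integral>\<^sup>+x. ennreal (1 / real p) * (\<Sum>i\<in>?I. ?F x * ennreal (h (fst (x i)))) \<partial>?PB)"
    proof (rule nn_integral_cong)
      fix x
      have "ennreal (V x / real p) = ennreal (1 / real p) * (\<Sum>i\<in>?I. ennreal (h (fst (x i))))"
        using V0[of x] by (simp add: sum_ennreal pos V_def flip: ennreal_mult)
      then show "?F x * ennreal (V x / real p)
          = ennreal (1 / real p) * (\<Sum>i\<in>?I. ?F x * ennreal (h (fst (x i))))"
        by (simp add: sum_distrib_left mult_ac)
    qed
    also have "\<dots> = ennreal (1 / real p) * (\<Sum>i\<in>?I. (\<integral>\<^sup>+x. ?F x * ennreal (h (fst (x i))) \<partial>?PB))"
      using h_comp by (subst nn_integral_cmult) (auto intro!: nn_integral_sum borel_measurable_times_ennreal borel_measurable_sum prod_f arg_cong2[where f = times])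
    also have "\<dots> = ennreal (1 / real p) * (ennreal (real n) * (\<integral>\<^sup>+x. ennreal (h x) \<partial>\<mu>))"
      using comp by (simp add: ennreal_of_nat_eq_real_of_nat)
    also have "\<dots> \<le> ennreal (1 / real p) * ennreal (real p / 8)"
      using moment by (intro mult_left_mono) (auto simp: h_def D_def b_def)
    also have "\<dots> = ennreal (1 / 8)" using p by (simp flip: ennreal_mult)
    finally show ?thesis .
  qed
  have term2: "(\<integral>\<^sup>+x. ennreal (1 / 8) * ?G x \<partial>?PB) \<le> ennreal (1 / 8)"
  proof -
    have "(\<integral>\<^sup>+z. ennreal (g z) \<partial>?B) \<le> 1"
    proof -
      have "(\<integral>\<^sup>+z. ennreal (g z) \<partial>?B) = (\<integral>\<^sup>+x. (\<integral>\<^sup>+y. ennreal (g (x, y)) \<partial>lborel) \<partial>\<mu>)"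
        by (subst lborel.nn_integral_fst[symmetric]) auto
      also have "\<dots> \<le> (\<integral>\<^sup>+x. 1 \<partial>\<mu>)"
      proof (rule nn_integral_mono)
        fix x
        have "(\<integral>\<^sup>+y. ennreal (g (x, y)) \<partial>lborel)
            = (\<integral>\<^sup>+y. ennreal (exp (- h x)) * ennreal ((flat_normal \<sigma> b (y - D x))\<^sup>2 / flat_normal \<sigma> b y) \<partial>lborel)"
          using flat_normal_pos[OF \<sigma> b]
          by (intro nn_integral_cong) (simp add: g_def f_def f0_def less_imp_le flip: ennreal_mult)
        also have "\<dots> = ennreal (exp (- h x)) * (\<integral>\<^sup>+y. ennreal ((flat_normal \<sigma> b (y - D x))\<^sup>2 / flat_normal \<sigma> b y) \<partial>lborel)"
          by (rule nn_integral_cmult) measurable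
        also have "\<dots> \<le> ennreal (exp (- h x)) * ennreal (exp ((D x)\<^sup>2 / \<sigma>\<^sup>2))"
          by (intro mult_left_mono flat_normal_chi_square[OF \<sigma> b]) auto
        also have "\<dots> = 1" by (simp add: h_def exp_minus flip: ennreal_mult)
        finally show "(\<integral>\<^sup>+y. ennreal (g (x, y)) \<partial>lborel) \<le> 1" .
      qed
      finally show ?thesis by (simp add: mu.emeasure_space_1)
    qed
    then have "(\<integral>\<^sup>+x. ?G x \<partial>?PB) \<le> 1"
      by (subst PB.product_nn_integral_prod) (auto intro: power_le_one_iff[THEN iffD2] power_le_one)
    then have "ennreal (1 / 8) * (\<integral>\<^sup>+x. ?G x \<partial>?PB) \<le> ennreal (1 / 8) * 1"
      by (rule mult_left_mono) simp
    then show ?thesis by (simp add: nn_integral_cmult)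
  qed
  have "emeasure (sample_law n p \<mu> \<epsilon> \<sigma> \<beta> (hiding_kernel \<sigma> \<epsilon> p \<beta>)) S
      = (\<integral>\<^sup>+x. ?F x * indicator S x \<partial>?PB)"
    unfolding P1 by (rule emeasure_density) measurable
  also have "\<dots> \<le> (\<integral>\<^sup>+x. ?F x * ennreal (V x / real p) + (ennreal (1 / 8) * ?G x
      + ennreal (2 * exp (real p)) * (?N x * indicator S x)) \<partial>?PB)"
    by (rule nn_integral_mono) (rule pointwise)
  also have "\<dots> = (\<integral>\<^sup>+x. ?F x * ennreal (V x / real p) \<partial>?PB) +
      ((\<integral>\<^sup>+x. ennreal (1 / 8) * ?G x \<partial>?PB)
      + ennreal (2 * exp (real p)) * (\<integral>\<^sup>+x. ?N x * indicator S x \<partial>?PB))"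
    by (simp add: nn_integral_add nn_integral_cmult)
  also have "\<dots> \<le> ennreal (1 / 8) + (ennreal (1 / 8) + ennreal (2 * exp (real p)) * (\<integral>\<^sup>+x. ?N x * indicator S x \<partial>?PB))"
    by (intro add_mono term1 term2 order_refl)
  also have "(\<integral>\<^sup>+x. ?N x * indicator S x \<partial>?PB) = emeasure P0 S"
    unfolding P0 by (rule emeasure_density[symmetric]) measurable
  also have "ennreal (1 / 8) + (ennreal (1 / 8) + ennreal (2 * exp (real p)) * emeasure P0 S)
      = ennreal (1 / 4) + ennreal (2 * exp (real p)) * emeasure P0 S"
    unfolding add.assoc[symmetric] by (subst ennreal_plus[symmetric]) auto
  finally show ?thesis .
qed

text \<open>If the sampling term dominates the rate, the squared signal is of order p / n without
  any thresholding. Otherwise the signal stays below the plateau width \<sigma> \<epsilon> as long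
  as 2c\<bar>s\<bar> \<le> T and is invisible there; beyond that level the exponential weight takes
  over.\<close>

lemma hiding_moment_pointwise:
  fixes \<gamma> \<epsilon> \<sigma> c \<rho> s :: real and n p :: nat
  assumes \<gamma>: "\<gamma> > 0" and c: "c > 0" "(2 * c) powr \<gamma> \<le> 1 / 4" and np: "n \<ge> 1" "p \<ge> 1" and \<epsilon>: "\<epsilon> \<ge> 0" and \<sigma>: "\<sigma> > 0"
    and \<rho>: "0 \<le> \<rho>" "\<rho> \<le> c * \<sigma> * rate \<gamma> n p \<epsilon>"
  shows "real n * ((soft_threshold (\<sigma> * \<epsilon>) (\<rho> * s))\<^sup>2 / \<sigma>\<^sup>2) \<le> real p * (4 * c\<^sup>2) * (s\<^sup>2 * exp (\<bar>s\<bar> powr \<gamma> / 4))"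
proof -
  define q where "q = sqrt (real p / real n)"
  define L where "L = log_factor n p \<epsilon>"
  define T where "T = L powr (1 / \<gamma>)"
  have L: "L \<ge> 1" unfolding L_def by (rule log_factor_ge_1[OF np])
  have T: "T \<ge> 1" "T powr \<gamma> = L" using L \<gamma> by (auto simp: T_def ge_one_powr_ge_zero powr_powr)
  have r: "rate \<gamma> n p \<epsilon> = q + \<epsilon> / T" by (simp add: rate_def q_def T_def L_def)
  have q2: "real n * q\<^sup>2 = real p" using np by (simp add: q_def)
  have q0: "q \<ge> 0" by (simp add: q_def)
  define E where "E = max 0 (c * (q + \<epsilon> / T) * \<bar>s\<bar> - \<epsilon>)"
  have "\<bar>soft_threshold (\<sigma> * \<epsilon>) (\<rho> * s)\<bar> = max 0 (\<rho> * \<bar>s\<bar> - \<sigma> * \<epsilon>)"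
    using \<sigma> \<epsilon> \<rho>(1) by (simp add: abs_soft_threshold abs_mult)
  also have "\<dots> \<le> max 0 (c * \<sigma> * (q + \<epsilon> / T) * \<bar>s\<bar> - \<sigma> * \<epsilon>)"
    using \<rho>(2) \<epsilon> by (intro max.mono diff_mono mult_right_mono) (auto simp: r)
  also have "\<dots> = \<sigma> * E"
    using \<sigma> by (simp add: E_def max_mult_distrib_left algebra_simps)
  finally have "\<bar>soft_threshold (\<sigma> * \<epsilon>) (\<rho> * s)\<bar> / \<sigma> \<le> E" using \<sigma> by (simp add: field_simps)
  then have "(\<bar>soft_threshold (\<sigma> * \<epsilon>) (\<rho> * s)\<bar> / \<sigma>)\<^sup>2 \<le> E\<^sup>2" using \<sigma> by (intro power_mono) auto
  then have soft: "real n * ((soft_threshold (\<sigma> * \<epsilon>) (\<rho> * s))\<^sup>2 / \<sigma>\<^sup>2) \<le> real n * E\<^sup>2"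
    by (intro mult_left_mono) (simp_all add: power_divide)
  have E0: "E \<ge> 0" by (simp add: E_def)
  define W where "W = exp (\<bar>s\<bar> powr \<gamma> / 4)"
  have W1: "W \<ge> 1" by (simp add: W_def)
  have "real n * E\<^sup>2 \<le> real p * (4 * c\<^sup>2) * (s\<^sup>2 * W)"
  proof (cases "\<epsilon> / T \<le> q")
    case True
    have "E \<le> c * (2 * q) * \<bar>s\<bar>"
    proof -
      have "c * (q + \<epsilon> / T) * \<bar>s\<bar> \<le> c * (2 * q) * \<bar>s\<bar>" using True c by (intro mult_right_mono mult_left_mono) auto
      moreover have "0 \<le> c * (2 * q) * \<bar>s\<bar>" using c q0 by simp
      ultimately show ?thesis using \<epsilon> by (simp add: E_def)
    qed
    then have "E\<^sup>2 \<le> (c * (2 * q) * \<bar>s\<bar>)\<^sup>2" using E0 by (intro power_mono) auto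
    also have "\<dots> = 4 * c\<^sup>2 * s\<^sup>2 * q\<^sup>2" by (simp add: power_mult_distrib)
    finally have "real n * E\<^sup>2 \<le> real n * (4 * c\<^sup>2 * s\<^sup>2 * q\<^sup>2)" by (intro mult_left_mono) auto
    also have "\<dots> = (real n * q\<^sup>2) * (4 * c\<^sup>2) * (s\<^sup>2 * 1)" by simp
    also have "\<dots> \<le> real p * (4 * c\<^sup>2) * (s\<^sup>2 * W)" unfolding q2 using W1 by (intro mult_left_mono) auto
    finally show ?thesis .
  next
    case False
    show ?thesis
    proof (cases "2 * c * \<bar>s\<bar> \<le> T")
      case True
      have "c * (q + \<epsilon> / T) * \<bar>s\<bar> \<le> c * (2 * (\<epsilon> / T)) * \<bar>s\<bar>" using False c by (intro mult_right_mono mult_left_mono) auto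
      also have "\<dots> = \<epsilon> * (2 * c * \<bar>s\<bar> / T)" by simp
      also have "\<dots> \<le> \<epsilon> * 1" using True T \<epsilon> by (intro mult_left_mono) auto
      finally have "E = 0" by (simp add: E_def)
      then show ?thesis using W1 by simp
    next
      case big: False
      have "c * (q + \<epsilon> / T) * \<bar>s\<bar> \<le> c * (2 * (\<epsilon> / T)) * \<bar>s\<bar>" using False c by (intro mult_right_mono mult_left_mono) auto
      also have "\<dots> \<le> c * (2 * (\<epsilon> / 1)) * \<bar>s\<bar>"
        using T \<epsilon> c by (intro mult_right_mono mult_left_mono divide_left_mono) auto
      also have "\<dots> = 2 * c * \<epsilon> * \<bar>s\<bar>" by simp
      finally have "c * (q + \<epsilon> / T) * \<bar>s\<bar> - \<epsilon> \<le> 2 * c * \<epsilon> * \<bar>s\<bar>" using \<epsilon> by linarith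
      moreover have "0 \<le> 2 * c * \<epsilon> * \<bar>s\<bar>" using \<epsilon> c by simp
      ultimately have "E \<le> 2 * c * \<epsilon> * \<bar>s\<bar>" unfolding E_def by (intro max.boundedI)
      then have "E\<^sup>2 \<le> (2 * c * \<epsilon> * \<bar>s\<bar>)\<^sup>2" using E0 by (intro power_mono) auto
      also have "\<dots> = 4 * c\<^sup>2 * s\<^sup>2 * \<epsilon>\<^sup>2" by (simp add: power_mult_distrib)
      finally have "real n * E\<^sup>2 \<le> real n * (4 * c\<^sup>2 * s\<^sup>2 * \<epsilon>\<^sup>2)" by (intro mult_left_mono) auto
      also have "\<dots> = real p * (4 * c\<^sup>2) * (s\<^sup>2 * (real n * \<epsilon>\<^sup>2 / real p))" using np by simp
      also have "\<dots> \<le> real p * (4 * c\<^sup>2) * (s\<^sup>2 * W)"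
      proof (intro mult_left_mono)
        \<comment> \<open>Origin of the logarithm in the rate: in this range \<bar>s\<bar>^\<gamma>
          \<ge> 4L, so the weight is at least exp(L) = n \<epsilon>^2 / p + e.\<close>
        have "4 * L \<le> L / (2 * c) powr \<gamma>" using c L by (simp add: field_simps)
        also have "\<dots> = (T / (2 * c)) powr \<gamma>" using T c by (simp add: powr_divide)
        also have "\<dots> \<le> \<bar>s\<bar> powr \<gamma>" using big c T \<gamma> by (intro powr_mono2) (auto simp: field_simps)
        finally have "exp L \<le> W" by (simp add: W_def)
        moreover have "exp L = real n * \<epsilon>\<^sup>2 / real p + exp 1"
          by (simp add: L_def log_factor_def add_nonneg_pos)
        ultimately show "real n * \<epsilon>\<^sup>2 / real p \<le> W" using exp_gt_zero[of "1::real"] by linarith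
      qed auto
      finally show ?thesis .
    qed
  qed
  with soft show ?thesis unfolding W_def by linarith
qed

lemma hiding_moment_le:
  fixes \<gamma> \<epsilon> \<sigma> c :: real and n p :: nat
  assumes \<gamma>: "\<gamma> > 0" and c: "c > 0" "(2 * c) powr \<gamma> \<le> 1 / 4" and np: "n \<ge> 1" "p \<ge> 1" and \<epsilon>: "\<epsilon> \<ge> 0" and \<sigma>: "\<sigma> > 0"
    and \<mu>: "generalized_gaussian \<gamma> p \<mu>" and \<beta>: "L2_set \<beta> {..<p} \<le> c * \<sigma> * rate \<gamma> n p \<epsilon>"
    and M: "(\<integral>\<^sup>+t. ennreal (t\<^sup>2 * exp (\<bar>t\<bar> powr \<gamma> / 4)) \<partial>gg_law \<gamma>) \<le> ennreal M" and M0: "M \<ge> 0"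
  shows "ennreal (real n) * (\<integral>\<^sup>+x. ennreal ((soft_threshold (\<sigma> * \<epsilon>) (dot p x \<beta>))\<^sup>2 / \<sigma>\<^sup>2) \<partial>\<mu>)
    \<le> ennreal (real p * (4 * c\<^sup>2 * M))"
proof -
  define \<rho> where "\<rho> = L2_set \<beta> {..<p}"
  show ?thesis
  proof (cases "\<rho> = 0")
    case True
    then have "\<beta> j = 0" if "j < p" for j using that by (simp add: \<rho>_def L2_set_eq_0_iff)
    then have "dot p x \<beta> = 0" for x by (simp add: dot_def)
    moreover have "soft_threshold (\<sigma> * \<epsilon>) 0 = 0" using \<sigma> \<epsilon> by (simp add: soft_threshold_def)
    ultimately show ?thesis by simp
  next
    case False
    have \<rho>0: "\<rho> > 0" using False L2_set_nonneg[of \<beta> "{..<p}"] unfolding \<rho>_def by linarith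
    define v where "v = (\<lambda>j\<in>{..<p}. \<beta> j / \<rho>)"
    have "L2_set v {..<p} = L2_set (\<lambda>j. (1 / \<rho>) * \<beta> j) {..<p}"
      by (rule L2_set_cong) (auto simp: v_def)
    also have "\<dots> = (1 / \<rho>) * \<rho>"
      unfolding \<rho>_def by (rule L2_set_right_distrib[symmetric]) simp
    also have "\<dots> = 1" using \<rho>0 by simp
    finally have v: "v \<in> unit_sphere p" by (auto simp: unit_sphere_def space_PiM v_def)
    have dotv: "dot p x \<beta> = \<rho> * dot p v x" for x
      unfolding dot_def sum_distrib_left using \<rho>0 by (intro sum.cong) (auto simp: v_def)
    have "ennreal (real n) * (\<integral>\<^sup>+x. ennreal ((soft_threshold (\<sigma> * \<epsilon>) (dot p x \<beta>))\<^sup>2 / \<sigma>\<^sup>2) \<partial>\<mu>)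
        = ennreal (real n) * (\<integral>\<^sup>+s. ennreal ((soft_threshold (\<sigma> * \<epsilon>) (\<rho> * s))\<^sup>2 / \<sigma>\<^sup>2) \<partial>gg_law \<gamma>)"
      unfolding dotv
      by (subst nn_integral_generalized_gaussian[OF \<gamma> \<mu> v, of "\<lambda>s. ennreal ((soft_threshold (\<sigma> * \<epsilon>) (\<rho> * s))\<^sup>2 / \<sigma>\<^sup>2)"]) auto
    also have "\<dots> = (\<integral>\<^sup>+s. ennreal (real n) * ennreal ((soft_threshold (\<sigma> * \<epsilon>) (\<rho> * s))\<^sup>2 / \<sigma>\<^sup>2) \<partial>gg_law \<gamma>)"
      by (rule nn_integral_cmult[symmetric]) measurable
    also have "\<dots> \<le> (\<integral>\<^sup>+s. ennreal (real p * (4 * c\<^sup>2)) * ennreal (s\<^sup>2 * exp (\<bar>s\<bar> powr \<gamma> / 4)) \<partial>gg_law \<gamma>)"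
      using hiding_moment_pointwise[OF \<gamma> c np \<epsilon> \<sigma> less_imp_le[OF \<rho>0] \<beta>[folded \<rho>_def]]
      by (intro nn_integral_mono) (simp add: ennreal_leI flip: ennreal_mult)
    also have "\<dots> = ennreal (real p * (4 * c\<^sup>2)) * (\<integral>\<^sup>+s. ennreal (s\<^sup>2 * exp (\<bar>s\<bar> powr \<gamma> / 4)) \<partial>gg_law \<gamma>)"
      by (rule nn_integral_cmult) measurable
    also have "\<dots> \<le> ennreal (real p * (4 * c\<^sup>2)) * ennreal M" by (intro mult_left_mono M) auto
    also have "\<dots> = ennreal (real p * (4 * c\<^sup>2 * M))" using M0 by (simp add: mult.assoc flip: ennreal_mult)
    finally show ?thesis .
  qed
qed

text \<open>All grid points in the ball lie within 2r of one of them, hence have squared index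
  distance at most p / 9 and differ from it in few coordinates. Such a Hamming ball is counted with
  product weights, whose sum over the whole grid factorises.\<close>

lemma grid_ball_card_le:
  fixes \<delta> r :: real and z :: "nat \<Rightarrow> real"
  assumes \<delta>: "\<delta> > 0" and r: "r \<ge> 0" "36 * r\<^sup>2 \<le> \<delta>\<^sup>2 * real p"
  shows "card {j \<in> PiE {..<p} (\<lambda>_. {..<100::nat}). l2_dist p z (\<lambda>i\<in>{..<p}. \<delta> * real (j i)) < r} \<le> 4 ^ p"
proof -
  let ?X = "PiE {..<p} (\<lambda>_. {..<100::nat})"
  define J where "J = {j \<in> ?X. l2_dist p z (\<lambda>i\<in>{..<p}. \<delta> * real (j i)) < r}"
  have finX: "finite ?X" by (intro finite_PiE) auto
  show ?thesis
  proof (cases "J = {}")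
    case False
    then obtain j0 where j0: "j0 \<in> J" by auto
    \<comment> \<open>Each coordinate has total weight at most 2, while a point differing from
      \<open>j0\<close> in m coordinates has weight 100^(-m).\<close>
    define w where "w i k = (if k = j0 i then 1 else 1 / 100 :: real)" for i k
    have J_le: "1 \<le> 2 ^ p * (\<Prod>i<p. w i (j i))" if j: "j \<in> J" for j
    proof -
      have "L2_set (\<lambda>i. \<delta> * (real (j i) - real (j0 i))) {..<p}
          = L2_set (\<lambda>i. - (z i - \<delta> * real (j i)) + (z i - \<delta> * real (j0 i))) {..<p}"
        by (rule L2_set_cong) (auto simp: algebra_simps)
      also have "\<dots> \<le> L2_set (\<lambda>i. - (z i - \<delta> * real (j i))) {..<p} + L2_set (\<lambda>i. z i - \<delta> * real (j0 i)) {..<p}"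
        by (rule L2_set_triangle_ineq)
      also have "L2_set (\<lambda>i. - (z i - \<delta> * real (j i))) {..<p} = l2_dist p z (\<lambda>i\<in>{..<p}. \<delta> * real (j i))"
        unfolding l2_dist_def L2_set_def by (intro arg_cong[where f = sqrt] sum.cong) (auto simp: power2_commute)
      also have "L2_set (\<lambda>i. z i - \<delta> * real (j0 i)) {..<p} = l2_dist p z (\<lambda>i\<in>{..<p}. \<delta> * real (j0 i))"
        unfolding l2_dist_def by (rule L2_set_cong) auto
      finally have tri: "L2_set (\<lambda>i. \<delta> * (real (j i) - real (j0 i))) {..<p}
        \<le> l2_dist p z (\<lambda>i\<in>{..<p}. \<delta> * real (j i)) + l2_dist p z (\<lambda>i\<in>{..<p}. \<delta> * real (j0 i))" .
      have "l2_dist p z (\<lambda>i\<in>{..<p}. \<delta> * real (j i)) < r" "l2_dist p z (\<lambda>i\<in>{..<p}. \<delta> * real (j0 i)) < r"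
        using j j0 by (simp_all only: J_def mem_Collect_eq)
      with tri have "L2_set (\<lambda>i. \<delta> * (real (j i) - real (j0 i))) {..<p} \<le> 2 * r" by linarith
      then have "(L2_set (\<lambda>i. \<delta> * (real (j i) - real (j0 i))) {..<p})\<^sup>2 \<le> (2 * r)\<^sup>2"
        by (intro power_mono L2_set_nonneg)
      then have "(\<Sum>i<p. (\<delta> * (real (j i) - real (j0 i)))\<^sup>2) \<le> 4 * r\<^sup>2"
        by (simp add: L2_set_def sum_nonneg power_mult_distrib)
      then have "\<delta>\<^sup>2 * (\<Sum>i<p. (real (j i) - real (j0 i))\<^sup>2) \<le> 4 * r\<^sup>2"
        by (simp add: power_mult_distrib sum_distrib_left)
      with r(2) have "\<delta>\<^sup>2 * (9 * (\<Sum>i<p. (real (j i) - real (j0 i))\<^sup>2)) \<le> \<delta>\<^sup>2 * real p" by simp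
      then have sq: "9 * (\<Sum>i<p. (real (j i) - real (j0 i))\<^sup>2) \<le> real p"
        using \<delta> by (simp only: mult_le_cancel_left_pos zero_less_power)
      define m where "m = card {i\<in>{..<p}. j i \<noteq> j0 i}"
      have "real m = (\<Sum>i\<in>{i\<in>{..<p}. j i \<noteq> j0 i}. 1)" by (simp add: m_def)
      also have "\<dots> = (\<Sum>i<p. if j i \<noteq> j0 i then 1 else 0)" by (rule sum.inter_filter) simp
      also have "\<dots> \<le> (\<Sum>i<p. (real (j i) - real (j0 i))\<^sup>2)"
      proof (rule sum_mono)
        fix i
        have "1 \<le> \<bar>real (j i) - real (j0 i)\<bar>" if "j i \<noteq> j0 i" using that by linarith
        then have "1 \<le> (real (j i) - real (j0 i))\<^sup>2" if "j i \<noteq> j0 i" using that abs_le_square_iff[of 1 "real (j i) - real (j0 i)"] by simp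
        then show "(if j i \<noteq> j0 i then 1 else 0) \<le> (real (j i) - real (j0 i))\<^sup>2" by simp
      qed
      finally have "9 * real m \<le> real p" using sq by linarith
      \<comment> \<open>The factor 7 is what 100 \<le> 2^7 needs: then 2^p makes up for the weight
        100^(-m), and the total is 2^p * 2^p.\<close>
      then have m: "7 * m \<le> p" by linarith
      have "(\<Prod>i\<in>{i\<in>{..<p}. j i \<noteq> j0 i}. 1 / 100 :: real) = (\<Prod>i<p. if j i \<noteq> j0 i then 1 / 100 else 1)"
        by (rule prod.inter_filter) simp
      also have "\<dots> = (\<Prod>i<p. w i (j i))" by (rule prod.cong) (simp_all add: w_def)
      finally have w: "(1 / 100) ^ m = (\<Prod>i<p. w i (j i))" by (simp add: m_def)
      have "(100::real) ^ m \<le> (2 ^ 7) ^ m" by (intro power_mono) auto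
      also have "\<dots> = 2 ^ (7 * m)" by (simp only: power_mult)
      also have "\<dots> \<le> 2 ^ p" using m by (intro power_increasing) auto
      finally have "(100::real) ^ m \<le> 2 ^ p" .
      then show ?thesis unfolding w[symmetric] by (simp add: power_divide field_simps)
    qed
    have "real (card J) = (\<Sum>j\<in>J. 1)" by simp
    also have "\<dots> \<le> (\<Sum>j\<in>J. 2 ^ p * (\<Prod>i<p. w i (j i)))" by (intro sum_mono J_le)
    also have "\<dots> \<le> (\<Sum>j\<in>?X. 2 ^ p * (\<Prod>i<p. w i (j i)))"
    proof (rule sum_mono2[OF finX])
      show "J \<subseteq> ?X" unfolding J_def by (rule Collect_restrict)
      show "0 \<le> 2 ^ p * (\<Prod>i<p. w i (j i))" for j
        by (intro mult_nonneg_nonneg prod_nonneg) (simp_all add: w_def)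
    qed
    also have "\<dots> = 2 ^ p * (\<Prod>i<p. \<Sum>k<100. w i k)"
      by (simp only: sum_distrib_left prod_sum_PiE finite_lessThan)
    also have "\<dots> \<le> 2 ^ p * (\<Prod>i<p. 2)"
    proof (intro mult_left_mono prod_mono conjI)
      fix i assume "i \<in> {..<p}"
      show "0 \<le> (\<Sum>k<100. w i k)" by (intro sum_nonneg) (auto simp: w_def)
      have "(\<Sum>k<100. w i k) \<le> (\<Sum>k<100::nat. (if k = j0 i then 1 else 0) + 1 / 100)"
        by (intro sum_mono) (auto simp: w_def)
      also have "\<dots> \<le> 2" by (simp add: sum.distrib)
      finally show "(\<Sum>k<100. w i k) \<le> 2" .
    qed simp
    also have "\<dots> = 4 ^ p" by (simp flip: power_mult_distrib)
    finally have "card J \<le> 4 ^ p" by (simp flip: of_nat_le_iff)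
    then show ?thesis by (simp add: J_def)
  next
    case True
    then have "card J = 0" by simp
    then show ?thesis unfolding J_def by simp
  qed
qed

theorem minimax_lower_bound:
  fixes \<gamma> :: real
  assumes \<gamma>: "\<gamma> > 0"
  shows "\<exists>C' :: real. C' > 0 \<and>
        (\<forall>(n::nat) (p::nat) (\<epsilon>::real) (\<sigma>::real) \<mu>.
           n \<ge> 1 \<longrightarrow> p \<ge> 1 \<longrightarrow> 0 \<le> \<epsilon> \<longrightarrow> \<epsilon> < 1 / 2 \<longrightarrow> \<sigma> > 0 \<longrightarrow>
           generalized_gaussian \<gamma> p \<mu> \<longrightarrow>
           (INF \<beta>hat \<in> sample_space n p \<rightarrow>\<^sub>M Rp p.
              SUP (\<beta>, Q) \<in> space (Rp p) \<times> contamination_kernels p.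
                emeasure (sample_law n p \<mu> \<epsilon> \<sigma> \<beta> Q)
                  {d \<in> space (sample_law n p \<mu> \<epsilon> \<sigma> \<beta> Q).
                     l2_dist p (\<beta>hat d) \<beta> \<ge> C' * \<sigma> * rate \<gamma> n p \<epsilon>}) \<ge> 1 / 2)"
proof -
  define M where "M = enn2real (\<integral>\<^sup>+t. ennreal (t\<^sup>2 * exp (\<bar>t\<bar> powr \<gamma> / 4)) \<partial>gg_law \<gamma>)"
  have M: "(\<integral>\<^sup>+t. ennreal (t\<^sup>2 * exp (\<bar>t\<bar> powr \<gamma> / 4)) \<partial>gg_law \<gamma>) \<le> ennreal M" "M \<ge> 0"
    using gg_moment_finite[OF \<gamma>] by (auto simp: M_def)
  \<comment> \<open>The first entry gives (2c)^\<gamma> \<le> 1/4, the requirement of the tail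
    regime; the second brings the moment down to p / 8.\<close>
  define c where "c = min ((1 / 4) powr (1 / \<gamma>) / 2) (1 / sqrt (32 * (M + 1)))"
  have c0: "c > 0" using M by (simp add: c_def)
  have "(2 * c) powr \<gamma> \<le> ((1 / 4) powr (1 / \<gamma>)) powr \<gamma>"
    using c0 \<gamma> by (intro powr_mono2) (auto simp: c_def)
  then have c1: "(2 * c) powr \<gamma> \<le> 1 / 4" using \<gamma> by (simp add: powr_powr)
  have c2: "4 * c\<^sup>2 * M \<le> 1 / 8"
  proof -
    have "c\<^sup>2 \<le> (1 / sqrt (32 * (M + 1)))\<^sup>2" using c0 by (intro power_mono) (auto simp: c_def)
    also have "\<dots> = 1 / (32 * (M + 1))" using M by (simp add: power_divide)
    finally have "4 * c\<^sup>2 * M \<le> 4 * (1 / (32 * (M + 1))) * M" using M by (intro mult_right_mono) auto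
    also have "\<dots> \<le> 1 / 8" using M by (simp add: field_simps)
    finally show ?thesis .
  qed
  have main: "(INF \<beta>hat \<in> sample_space n p \<rightarrow>\<^sub>M Rp p.
              SUP (\<beta>, Q) \<in> space (Rp p) \<times> contamination_kernels p.
                emeasure (sample_law n p \<mu> \<epsilon> \<sigma> \<beta> Q)
                  {d \<in> space (sample_law n p \<mu> \<epsilon> \<sigma> \<beta> Q).
                     l2_dist p (\<beta>hat d) \<beta> \<ge> c / 600 * \<sigma> * rate \<gamma> n p \<epsilon>}) \<ge> 1 / 2"
    if np: "n \<ge> 1" "p \<ge> 1" and \<epsilon>: "0 \<le> \<epsilon>" "\<epsilon> < 1 / 2" and \<sigma>: "\<sigma> > 0" and \<mu>: "generalized_gaussian \<gamma> p \<mu>"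
    for n p :: nat and \<epsilon> \<sigma> \<mu>
  proof (rule INF_greatest)
    fix \<beta>hat assume \<beta>hat: "\<beta>hat \<in> sample_space n p \<rightarrow>\<^sub>M Rp p"
    have \<epsilon>1: "\<epsilon> \<le> 1" using \<epsilon> by simp
    have mu: "prob_space \<mu>" "sets \<mu> = sets (Rp p)" using \<mu> by (auto simp: generalized_gaussian_def)
    have kernel: "hiding_kernel \<sigma> \<epsilon> p \<beta> \<in> contamination_kernels p" for \<beta> by (rule hiding_kernel[OF \<sigma> \<epsilon>(1) \<epsilon>1])
    define P where "P \<beta> = sample_law n p \<mu> \<epsilon> \<sigma> \<beta> (hiding_kernel \<sigma> \<epsilon> p \<beta>)" for \<beta>
    have P_prob: "prob_space (P \<beta>)" for \<beta>
      unfolding P_def sample_law_def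
      by (intro prob_space_PiM prob_space_observation_law[OF \<epsilon>(1) \<epsilon>1 \<sigma> kernel mu])
    have P_sets: "sets (P \<beta>) = sets (sample_space n p)" for \<beta>
      unfolding P_def sample_law_def
      by (intro sets_PiM_cong refl sets_observation_law[OF \<epsilon>(1) \<epsilon>1 \<sigma> kernel mu])
    have P_space: "space (P \<beta>) = space (sample_space n p)" for \<beta> by (rule sets_eq_imp_space_eq[OF P_sets])
    define R where "R = rate \<gamma> n p \<epsilon>"
    have R: "R > 0" using np \<epsilon> by (simp add: R_def rate_def add_pos_nonneg)
    \<comment> \<open>A grid of 100 values per coordinate with spacing \<delta> has norms at most
      100 \<delta> sqrt(p) = c \<sigma> R. With 600 = 6 * 100 one gets 6r = \<delta> sqrt(p), the
      equality case of the hypothesis of \<open>grid_ball_card_le\<close>.\<close>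
    define r where "r = c / 600 * \<sigma> * R"
    define \<delta> where "\<delta> = c * \<sigma> * R / (100 * sqrt p)"
    have \<delta>: "\<delta> > 0" using c0 \<sigma> R np by (simp add: \<delta>_def)
    have \<delta>p: "100 * \<delta> * sqrt p = c * \<sigma> * R" using np by (simp add: \<delta>_def)
    have r: "r \<ge> 0" "36 * r\<^sup>2 \<le> \<delta>\<^sup>2 * real p"
    proof -
      have "r = 100 * \<delta> * sqrt p / 600" unfolding \<delta>p by (simp add: r_def)
      then have "6 * r = \<delta> * sqrt p" by simp
      then have "(6 * r)\<^sup>2 = (\<delta> * sqrt p)\<^sup>2" by (rule arg_cong)
      then show "36 * r\<^sup>2 \<le> \<delta>\<^sup>2 * real p" by (simp add: power_mult_distrib)
    qed (use c0 \<sigma> R in \<open>simp add: r_def\<close>)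
    define X where "X = PiE {..<p} (\<lambda>_. {..<100::nat})"
    have finX: "finite X" unfolding X_def by (intro finite_PiE) auto
    have cardX: "real (card X) = 100 ^ p" by (simp add: X_def card_PiE)
    define \<beta> where "\<beta> j = (\<lambda>i\<in>{..<p}. \<delta> * real (j i))" for j :: "nat \<Rightarrow> nat"
    have \<beta>_space: "\<beta> j \<in> space (Rp p)" for j by (auto simp: \<beta>_def space_PiM)
    have \<beta>_norm: "L2_set (\<beta> j) {..<p} \<le> c * \<sigma> * rate \<gamma> n p \<epsilon>" if j: "j \<in> X" for j
    proof -
      have "(\<Sum>i<p. (\<beta> j i)\<^sup>2) \<le> (\<Sum>i<p. (100 * \<delta>)\<^sup>2)"
      proof (rule sum_mono)
        fix i assume i: "i \<in> {..<p}"
        then have "j i < 100" using j by (auto simp: X_def PiE_iff)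
        then have "\<delta> * real (j i) \<le> \<delta> * 100" using \<delta> by (intro mult_left_mono) auto
        then show "(\<beta> j i)\<^sup>2 \<le> (100 * \<delta>)\<^sup>2" using i \<delta> by (intro power_mono) (auto simp: \<beta>_def)
      qed
      then have "L2_set (\<beta> j) {..<p} \<le> sqrt (real p * (100 * \<delta>)\<^sup>2)" unfolding L2_set_def by simp
      also have "\<dots> = 100 * \<delta> * sqrt p" using \<delta> by (simp add: real_sqrt_mult)
      finally show ?thesis using \<delta>p by (simp add: R_def)
    qed
    define S where "S j = {d \<in> space (sample_space n p). l2_dist p (\<beta>hat d) (\<beta> j) < r}" for j
    have S: "S j \<in> sets (sample_space n p)" for j
    proof -
      have [measurable]: "(\<lambda>d. \<beta>hat d i) \<in> borel_measurable (sample_space n p)" if "i \<in> {..<p}" for i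
        by (rule measurable_compose[OF \<beta>hat measurable_component_singleton]) (use that in simp)
      have "(\<lambda>d. l2_dist p (\<beta>hat d) (\<beta> j)) \<in> borel_measurable (sample_space n p)"
        unfolding l2_dist_def L2_set_def by measurable
      then show ?thesis unfolding S_def by (intro borel_measurable_less borel_measurable_const)
    qed
    interpret P0: prob_space "P (\<lambda>_. 0)" by (rule P_prob)
    \<comment> \<open>\<open>S j\<close> is success at grid point j. Bounding every success
      probability by one under the same law, at zero, allows the successes to be counted
      jointly.\<close>
    have each: "measure (P (\<beta> j)) (S j) \<le> 1 / 4 + 2 * exp (real p) * measure (P (\<lambda>_. 0)) (S j)" if j: "j \<in> X" for j
    proof -
      interpret Pj: prob_space "P (\<beta> j)" by (rule P_prob)
      have "ennreal (real n) * (\<integral>\<^sup>+x. ennreal ((soft_threshold (\<sigma> * \<epsilon>) (dot p x (\<beta> j)))\<^sup>2 / \<sigma>\<^sup>2) \<partial>\<mu>) \<le> ennreal (real p * (4 * c\<^sup>2 * M))"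
        by (rule hiding_moment_le[OF \<gamma> c0 c1 np \<epsilon>(1) \<sigma> \<mu> \<beta>_norm[OF j] M])
      also have "\<dots> \<le> ennreal (real p * (1 / 8))" by (intro ennreal_leI mult_left_mono c2) auto
      finally have "emeasure (P (\<beta> j)) (S j) \<le> ennreal (1 / 4) + ennreal (2 * exp (real p)) * emeasure (P (\<lambda>_. 0)) (S j)"
        unfolding P_def using sample_law_hiding_le[OF \<sigma> \<epsilon>(1) \<epsilon>1 mu np(2) _ S] by simp
      also have "\<dots> = ennreal (1 / 4 + 2 * exp (real p) * measure (P (\<lambda>_. 0)) (S j))"
        by (simp only: P0.emeasure_eq_measure) (subst ennreal_plus, auto simp: ennreal_mult)
      finally have "ennreal (measure (P (\<beta> j)) (S j)) \<le> ennreal (1 / 4 + 2 * exp (real p) * measure (P (\<lambda>_. 0)) (S j))"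
        by (simp only: Pj.emeasure_eq_measure)
      then show ?thesis by (subst (asm) ennreal_le_iff) auto
    qed
    have SP: "S j \<in> sets (P \<beta>')" for j \<beta>' unfolding P_sets by (rule S)
    \<comment> \<open>The sum is the expected number of grid points within r of the estimate, which
      is at most 4^p on every sample.\<close>
    have "(\<Sum>j\<in>X. emeasure (P (\<lambda>_. 0)) (S j)) = (\<integral>\<^sup>+d. (\<Sum>j\<in>X. indicator (S j) d) \<partial>P (\<lambda>_. 0))"
      using SP by (subst nn_integral_sum) auto
    also have "\<dots> \<le> (\<integral>\<^sup>+d. ennreal (4 ^ p) \<partial>P (\<lambda>_. 0))"
    proof (rule nn_integral_mono)
      fix d assume "d \<in> space (P (\<lambda>_. 0))"
      have "(\<Sum>j\<in>X. indicator (S j) d :: ennreal) = (\<Sum>j\<in>X. if d \<in> S j then 1 else 0)"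
        by (rule sum.cong) auto
      also have "\<dots> = of_nat (card {j\<in>X. d \<in> S j})" using finX by (simp flip: sum.inter_filter)
      also have "card {j\<in>X. d \<in> S j} \<le> card {j \<in> X. l2_dist p (\<beta>hat d) (\<beta> j) < r}"
        by (rule card_mono) (use finX in \<open>auto simp: S_def\<close>)
      also have "\<dots> \<le> 4 ^ p"
        unfolding X_def \<beta>_def by (rule grid_ball_card_le[OF \<delta> r])
      finally show "(\<Sum>j\<in>X. indicator (S j) d) \<le> ennreal (4 ^ p)"
        by (simp add: ennreal_of_nat_eq_real_of_nat ennreal_leI)
    qed
    also have "\<dots> = ennreal (4 ^ p)" by (simp add: P0.emeasure_space_1)
    finally have overlap: "(\<Sum>j\<in>X. measure (P (\<lambda>_. 0)) (S j)) \<le> 4 ^ p"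
      by (simp add: P0.emeasure_eq_measure)
    have "\<exists>j\<in>X. measure (P (\<beta> j)) (S j) \<le> 1 / 2"
    proof (rule ccontr)
      assume "\<not> (\<exists>j\<in>X. measure (P (\<beta> j)) (S j) \<le> 1 / 2)"
      then have big: "1 / 2 < measure (P (\<beta> j)) (S j)" if "j \<in> X" for j using that by (simp add: not_le)
      have "X \<noteq> {}" using cardX by auto
      then have "(\<Sum>j\<in>X. 1 / 2) < (\<Sum>j\<in>X. measure (P (\<beta> j)) (S j))" using big finX by (intro sum_strict_mono) auto
      also have "\<dots> \<le> (\<Sum>j\<in>X. 1 / 4 + 2 * exp (real p) * measure (P (\<lambda>_. 0)) (S j))" by (intro sum_mono each)
      also have "\<dots> = real (card X) / 4 + 2 * exp (real p) * (\<Sum>j\<in>X. measure (P (\<lambda>_. 0)) (S j))"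
        by (simp add: sum.distrib sum_distrib_left)
      also have "\<dots> \<le> real (card X) / 4 + 2 * exp (real p) * 4 ^ p"
        using overlap by simp
      finally have "100 ^ p / 4 < 2 * exp (real p) * 4 ^ p" by (simp add: cardX)
      also have "exp (real p) = exp 1 ^ p" by (simp flip: exp_of_nat_mult)
      also have "2 * exp 1 ^ p * (4::real) ^ p = 2 * (exp 1 * 4) ^ p" by (simp add: power_mult_distrib)
      also have "\<dots> \<le> 2 * 12 ^ p" using exp_le by (intro mult_left_mono power_mono) auto
      finally have "(100::real) ^ p < 8 * 12 ^ p" by simp
      \<comment> \<open>The constants just suffice at p = 1, where 8 * 12 = 96 < 100; larger p only
        widens the gap.\<close>
      moreover obtain m where m: "p = Suc m" using np by (cases p) auto
      moreover have "(12::real) ^ m \<le> 100 ^ m" by (rule power_mono) auto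
      moreover have "(0::real) < 100 ^ m" by simp
      ultimately show False by simp
    qed
    then obtain j where j: "j \<in> X" "measure (P (\<beta> j)) (S j) \<le> 1 / 2" by auto
    interpret Pj: prob_space "P (\<beta> j)" by (rule P_prob)
    have fail: "{d \<in> space (P (\<beta> j)). l2_dist p (\<beta>hat d) (\<beta> j) \<ge> r} = space (P (\<beta> j)) - S j"
      unfolding P_space by (auto simp: S_def)
    have "1 / 2 = ennreal (1 / 2)" by (simp add: ennreal_divide_numeral flip: ennreal_1)
    also have "\<dots> \<le> ennreal (measure (P (\<beta> j)) (space (P (\<beta> j)) - S j))"
      using j(2) Pj.prob_compl[of "S j"] S[of j] P_sets by (intro ennreal_leI) auto
    also have "\<dots> = emeasure (P (\<beta> j)) {d \<in> space (P (\<beta> j)). l2_dist p (\<beta>hat d) (\<beta> j) \<ge> r}"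
      by (simp only: fail Pj.emeasure_eq_measure)
    finally have *: "1 / 2 \<le> emeasure (P (\<beta> j)) {d \<in> space (P (\<beta> j)). l2_dist p (\<beta>hat d) (\<beta> j) \<ge> r}" .
    show "1 / 2 \<le> (SUP (\<beta>, Q) \<in> space (Rp p) \<times> contamination_kernels p.
                emeasure (sample_law n p \<mu> \<epsilon> \<sigma> \<beta> Q)
                  {d \<in> space (sample_law n p \<mu> \<epsilon> \<sigma> \<beta> Q).
                     l2_dist p (\<beta>hat d) \<beta> \<ge> c / 600 * \<sigma> * rate \<gamma> n p \<epsilon>})"
      by (rule SUP_upper2[of "(\<beta> j, hiding_kernel \<sigma> \<epsilon> p (\<beta> j))"])
        (use \<beta>_space kernel * in \<open>auto simp: P_def r_def R_def\<close>)
  qed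
  show ?thesis
  proof (intro exI conjI allI impI)
    show "c / 600 > 0" using c0 by simp
  qed (rule main; assumption)
qed

theorem theorem5p3:
  fixes \<gamma> :: real
  assumes "\<gamma> > 0"
  shows
    "(\<forall>\<alpha>::real. 0 < \<alpha> \<and> \<alpha> < 1 \<longrightarrow>
       (\<exists>C c :: real. C > 0 \<and> c > 0 \<and>
         (\<forall>(n::nat) (p::nat) (\<epsilon>::real) (\<sigma>::real) \<mu> \<beta> Q \<beta>hat.
            n \<ge> 1 \<longrightarrow> p \<ge> 1 \<longrightarrow> 0 \<le> \<epsilon> \<longrightarrow> \<epsilon> < 1 / 2 \<longrightarrow> \<sigma> > 0 \<longrightarrow>
            generalized_gaussian \<gamma> p \<mu> \<longrightarrow>
            \<beta> \<in> space (Rp p) \<longrightarrow>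
            Q \<in> contamination_kernels p \<longrightarrow>
            sqrt (real p / real n) + \<epsilon> \<le> c \<longrightarrow>
            (\<forall>d \<in> space (sample_space n p).
               is_arg_max (truncated_depth n p d (truncation_level \<gamma> n p \<epsilon>))
                 (\<lambda>b. b \<in> space (Rp p)) (\<beta>hat d)) \<longrightarrow>
            (\<exists>A \<in> sets (sample_law n p \<mu> \<epsilon> \<sigma> \<beta> Q).
               measure (sample_law n p \<mu> \<epsilon> \<sigma> \<beta> Q) A \<ge> 1 - \<alpha> \<and>
               (\<forall>d \<in> A. l2_dist p (\<beta>hat d) \<beta> \<le> C * \<sigma> * rate \<gamma> n p \<epsilon>)))))
     \<and>
     (\<exists>C' :: real. C' > 0 \<and>
        (\<forall>(n::nat) (p::nat) (\<epsilon>::real) (\<sigma>::real) \<mu>.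
           n \<ge> 1 \<longrightarrow> p \<ge> 1 \<longrightarrow> 0 \<le> \<epsilon> \<longrightarrow> \<epsilon> < 1 / 2 \<longrightarrow> \<sigma> > 0 \<longrightarrow>
           generalized_gaussian \<gamma> p \<mu> \<longrightarrow>
           (INF \<beta>hat \<in> sample_space n p \<rightarrow>\<^sub>M Rp p.
              SUP (\<beta>, Q) \<in> space (Rp p) \<times> contamination_kernels p.
                emeasure (sample_law n p \<mu> \<epsilon> \<sigma> \<beta> Q)
                  {d \<in> space (sample_law n p \<mu> \<epsilon> \<sigma> \<beta> Q).
                     l2_dist p (\<beta>hat d) \<beta> \<ge> C' * \<sigma> * rate \<gamma> n p \<epsilon>}) \<ge> 1 / 2))"
  using truncated_depth_upper_bound[OF assms] minimax_lower_bound[OF assms] by blast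

end
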